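(* Let $P_{XY}=P_XP_{Y|X}$ with $P_{XY}\ll P_X\times P_Y$, and suppose $R>I(X;Y)>0$. Assume that $\mathbb{E}[\exp(\tau\,\imath(X;Y))]<\infty$ for all $\tau$ in a neighborhood of the origin, where $(X,Y)\sim P_{XY}$. For each $n$, let $\mathsf{P}_{Y^n}$ be the random output distribution induced on the memoryless channel $P_{Y|X}^{\otimes n}$ by a codebook of $\mathsf{M}_n=\lceil\exp(nR)\rceil$ codewords drawn i.i.d. from $P_X^{\otimes n}$. Let $$\tau^*=\arg\max_{0\le\tau\le1}\ \tau R-\log\mathbb{E}[\exp(\tau\,\imath(X;Y))].$$ Then, as $n\to\infty$, $$\mathbb{E}\big[D(\mathsf{P}_{Y^n}\|P_Y^{\otimes n})\big]=\begin{cases}\Theta\!\left(\dfrac{\exp(-n\tau^*R)}{\sqrt n}\,\big(\mathbb{E}[\exp(\tau^*\imath(X;Y))]\big)^n\right), & \tau^*<1,\\[2mm] \Theta\!\left(\exp(-nR)\,\big(\mathbb{E}[\exp(\imath(X;Y))]\big)^n\right), & \tau^*=1,\end{cases}$$ where the expectation on the left is over the random codebook.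
   Context: Alphabets are arbitrary measurable spaces; $P_Y$ is the $Y$-marginal of $P_{XY}$; $\log,\exp$ are to base $\mathrm{e}$. Information density: $\imath(x;y)=\imath_{X;Y}(x;y)=\log\frac{\mathrm{d}P_{XY}}{\mathrm{d}(P_X\times P_Y)}(x,y)$. Mutual information: $I(X;Y)=\mathbb{E}[\imath(X;Y)]$, $(X,Y)\sim P_{XY}$. Relative entropy (for $P\ll Q$): $D(P\|Q)=\mathbb{E}_{X\sim P}[\log\frac{\mathrm{d}P}{\mathrm{d}Q}(X)]$. Codebook and induced distribution: $\mathbf{X}(1),\dots,\mathbf{X}(\mathsf{M}_n)$ are i.i.d. with law $P_X^{\otimes n}$ (the $n$-fold product), and $\mathsf{P}_{Y^n}(\cdot)=\frac1{\mathsf{M}_n}\sum_{k=1}^{\mathsf{M}_n}P_{Y|X}^{\otimes n}(\cdot\,|\mathbf{X}(k))$, where $P_{Y|X}^{\otimes n}(\cdot|\mathbf{x})=\prod_{i=1}^nP_{Y|X}(\cdot|x_i)$. $a_n=\Theta(b_n)$ means there are constants $0<c\le C<\infty$, independent of $n$ (they may depend on $P_{XY}$ and $R$), with $c\,b_n\le a_n\le C\,b_n$ for all sufficiently large $n$.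
   Formalization: Adds two conditions without which the claim can fail: P_{Y|X=x} has density dP_XY/d(P_X×P_Y)(x,·) w.r.t. P_Y for almost every x (automatic for countably generated output σ-algebras); and if τ*<1, E[exp(τ i(X;Y))] is finite for some τ>τ* (automatic if E[exp(i(X;Y))]<∞). *)

theory Defs
  imports "HOL-Probability.Probability" "HOL-Library.Landau_Symbols"
begin

text \<open>
  The input law is a probability measure \<open>PX\<close>; the output alphabet is the measurable space
  underlying \<open>MY\<close> (only \<open>sets MY\<close> matters); the channel is a Markov kernel
  \<open>K \<in> PX \<rightarrow>\<^sub>M prob_algebra MY\<close>, with \<open>K x\<close> the output law given the input \<open>x\<close>.
  All logarithms are natural, hence the base \<open>exp 1\<close> in library notions that take a base.
\<close>

definition joint_law :: "'a measure \<Rightarrow> 'b measure \<Rightarrow> ('a \<Rightarrow> 'b measure) \<Rightarrow> ('a \<times> 'b) measure" where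
  "joint_law PX MY K =
     PX \<bind> (\<lambda>x. K x \<bind> (\<lambda>y. return (PX \<Otimes>\<^sub>M MY) (x, y)))"

definition output_law :: "'a measure \<Rightarrow> 'b measure \<Rightarrow> ('a \<Rightarrow> 'b measure) \<Rightarrow> 'b measure" where
  "output_law PX MY K = distr (joint_law PX MY K) MY snd"

definition product_law :: "'a measure \<Rightarrow> 'b measure \<Rightarrow> ('a \<Rightarrow> 'b measure) \<Rightarrow> ('a \<times> 'b) measure" where
  "product_law PX MY K = PX \<Otimes>\<^sub>M output_law PX MY K"

text \<open>
  \<open>entropy_density b Q P\<close> is the logarithm to base \<open>b\<close> of the Radon-Nikodym derivative of \<open>P\<close>
  with respect to \<open>Q\<close>: in this and in \<open>KL_divergence\<close> the reference measure comes first.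
\<close>

definition info_density ::
  "'a measure \<Rightarrow> 'b measure \<Rightarrow> ('a \<Rightarrow> 'b measure) \<Rightarrow> 'a \<times> 'b \<Rightarrow> real" where
  "info_density PX MY K =
     entropy_density (exp 1) (product_law PX MY K) (joint_law PX MY K)"

definition mutual_info :: "'a measure \<Rightarrow> 'b measure \<Rightarrow> ('a \<Rightarrow> 'b measure) \<Rightarrow> real" where
  "mutual_info PX MY K = (\<integral>z. info_density PX MY K z \<partial>joint_law PX MY K)"

definition info_mgf ::
  "'a measure \<Rightarrow> 'b measure \<Rightarrow> ('a \<Rightarrow> 'b measure) \<Rightarrow> real \<Rightarrow> ennreal" where
  "info_mgf PX MY K \<tau> =
     (\<integral>\<^sup>+z. ennreal (exp (\<tau> * info_density PX MY K z)) \<partial>joint_law PX MY K)"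

definition info_log_mgf ::
  "'a measure \<Rightarrow> 'b measure \<Rightarrow> ('a \<Rightarrow> 'b measure) \<Rightarrow> real \<Rightarrow> ereal" where
  "info_log_mgf PX MY K \<tau> =
     (if info_mgf PX MY K \<tau> = \<infinity> then \<infinity> else ereal (ln (enn2real (info_mgf PX MY K \<tau>))))"

text \<open>
  The objective is extended-real valued because the moment generating function may be infinite
  on part of the unit interval; such \<open>\<tau>\<close> get the value \<open>-\<infinity>\<close>. The maximum may then be attained
  at the right end of the domain of finiteness, where the derivative need not vanish and the
  factor \<open>1 / sqrt n\<close> of the case \<open>tau_star < 1\<close> can fail; ruling this out takes finiteness of
  the moment generating function at some point beyond \<open>tau_star\<close>, which is automatic when
  \<open>info_mgf PX MY K 1\<close> is finite.
\<close>

definition tau_star ::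
  "'a measure \<Rightarrow> 'b measure \<Rightarrow> ('a \<Rightarrow> 'b measure) \<Rightarrow> real \<Rightarrow> real" where
  "tau_star PX MY K R =
     arg_max_on (\<lambda>\<tau>. ereal (\<tau> * R) - info_log_mgf PX MY K \<tau>) {0..1}"

text \<open>
  A version of the conditional law whose densities are the joint density: \<open>K x\<close> has density
  \<open>exp (info_density PX MY K (x, _))\<close> with respect to the output law, for almost every \<open>x\<close>.
  Absolute continuity of the joint law only yields, for each fixed event \<open>B\<close>, that
  \<open>emeasure (K x) B\<close> is the integral of that density over \<open>B\<close> for almost every \<open>x\<close>, with an
  exceptional null set that may depend on \<open>B\<close>. If the output sigma-algebra is countably
  generated the condition is automatic (lemma \<open>regular_version_countably_generated\<close> below).
  In general it is not: with the uniform law on the unit interval as input and the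
  countable-cocountable sigma-algebra on the output side, the kernel \<open>x \<mapsto> Dirac measure at x\<close>
  has joint law equal to the product of its marginals, yet no \<open>K x\<close> is absolutely continuous
  with respect to the output law.
\<close>

definition regular_version ::
  "'a measure \<Rightarrow> 'b measure \<Rightarrow> ('a \<Rightarrow> 'b measure) \<Rightarrow> bool" where
  "regular_version PX MY K \<longleftrightarrow>
     (AE x in PX. K x = density (output_law PX MY K)
        (\<lambda>y. RN_deriv (product_law PX MY K) (joint_law PX MY K) (x, y)))"

text \<open>
  Relative entropy of \<open>P\<close> with respect to \<open>Q\<close>, with values in \<open>[0, \<infinity>]\<close>. The library's
  \<open>KL_divergence\<close> is a Bochner integral and equals 0 when the integral diverges. For probability
  measures with \<open>P\<close> absolutely continuous with respect to \<open>Q\<close> the negative part of the logarithm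
  is always \<open>P\<close>-integrable, so that failure of integrability means that the divergence is infinite.
\<close>

definition rel_entropy :: "'a measure \<Rightarrow> 'a measure \<Rightarrow> ennreal" where
  "rel_entropy P Q =
     (if absolutely_continuous Q P \<and> integrable P (entropy_density (exp 1) Q P)
      then ennreal (KL_divergence (exp 1) Q P) else \<infinity>)"

definition iid_law :: "nat \<Rightarrow> 'a measure \<Rightarrow> (nat \<Rightarrow> 'a) measure" where
  "iid_law n P = Pi\<^sub>M {..<n} (\<lambda>_. P)"

definition memoryless :: "nat \<Rightarrow> ('a \<Rightarrow> 'b measure) \<Rightarrow> (nat \<Rightarrow> 'a) \<Rightarrow> (nat \<Rightarrow> 'b) measure" where
  "memoryless n K x = Pi\<^sub>M {..<n} (\<lambda>i. K (x i))"

definition num_codewords :: "real \<Rightarrow> nat \<Rightarrow> nat" where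
  "num_codewords R n = nat \<lceil>exp (real n * R)\<rceil>"

text \<open>A codebook maps the index \<open>k < M\<close> to the codeword \<open>c k\<close>, itself indexed by \<open>i < n\<close>.\<close>

definition codebook_law :: "nat \<Rightarrow> nat \<Rightarrow> 'a measure \<Rightarrow> (nat \<Rightarrow> nat \<Rightarrow> 'a) measure" where
  "codebook_law M n PX = iid_law M (iid_law n PX)"

definition induced_output ::
  "nat \<Rightarrow> nat \<Rightarrow> 'b measure \<Rightarrow> ('a \<Rightarrow> 'b measure) \<Rightarrow> (nat \<Rightarrow> nat \<Rightarrow> 'a) \<Rightarrow> (nat \<Rightarrow> 'b) measure" where
  "induced_output M n MY K c =
     measure_of (space (iid_law n MY)) (sets (iid_law n MY))
       (\<lambda>A. (\<Sum>k<M. emeasure (memoryless n K (c k)) A) / of_nat M)"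

text \<open>
  The nonnegative integral is insensitive to null sets of codebooks on which the divergence is
  infinite or irregular. Since \<open>enn2real \<infinity> = 0\<close>, a bound \<open>enn2real (expected_divergence \<dots>) \<in> \<Theta>(b)\<close>
  with positive \<open>b\<close> asserts in particular that the expectation is eventually finite.
\<close>

definition expected_divergence ::
  "'a measure \<Rightarrow> 'b measure \<Rightarrow> ('a \<Rightarrow> 'b measure) \<Rightarrow> real \<Rightarrow> nat \<Rightarrow> ennreal" where
  "expected_divergence PX MY K R n =
     (\<integral>\<^sup>+c. rel_entropy (induced_output (num_codewords R n) n MY K c)
                       (iid_law n (output_law PX MY K))
      \<partial>codebook_law (num_codewords R n) n PX)"

text \<open>The set function in \<open>induced_output\<close> is a measure, so \<open>measure_of\<close> does not collapse it.\<close>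

lemma sets_memoryless:
  assumes "\<And>i. i < n \<Longrightarrow> sets (K (x i)) = sets MY"
  shows "sets (memoryless n K x) = sets (iid_law n MY)"
  unfolding memoryless_def iid_law_def using assms by (intro sets_PiM_cong) auto

lemma emeasure_induced_output:
  fixes MY :: "'b measure" and K :: "'a \<Rightarrow> 'b measure"
  assumes K: "\<And>k i. k < M \<Longrightarrow> i < n \<Longrightarrow> sets (K (c k i)) = sets MY"
    and A: "A \<in> sets (iid_law n MY)"
  shows "emeasure (induced_output M n MY K c) A =
           (\<Sum>k<M. emeasure (memoryless n K (c k)) A) / of_nat M"
proof -
  let ?\<mu> = "\<lambda>A. (\<Sum>k<M. emeasure (memoryless n K (c k)) A) / of_nat M"
  have S: "sets (memoryless n K (c k)) = sets (iid_law n MY)" if "k < M" for k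
    using K that by (intro sets_memoryless)
  have ca: "countably_additive (sets (iid_law n MY)) ?\<mu>"
  proof (rule countably_additiveI)
    fix F :: "nat \<Rightarrow> (nat \<Rightarrow> 'b) set"
    assume F: "range F \<subseteq> sets (iid_law n MY)" "disjoint_family F"
    have "(\<Sum>i. ?\<mu> (F i)) = (\<Sum>i. \<Sum>k<M. emeasure (memoryless n K (c k)) (F i)) / of_nat M"
      by (simp add: divide_ennreal_def)
    also have "(\<Sum>i. \<Sum>k<M. emeasure (memoryless n K (c k)) (F i)) =
               (\<Sum>k<M. \<Sum>i. emeasure (memoryless n K (c k)) (F i))"
      by (intro suminf_sum) auto
    also have "\<dots> = (\<Sum>k<M. emeasure (memoryless n K (c k)) (\<Union>i. F i))"
      using F S by (intro sum.cong refl suminf_emeasure) auto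
    finally show "(\<Sum>i. ?\<mu> (F i)) = ?\<mu> (\<Union>i. F i)" .
  qed
  show ?thesis
    unfolding induced_output_def
    by (rule emeasure_measure_of_sigma[OF _ _ ca A])
       (auto simp: sets.sigma_algebra_axioms positive_def)
qed

lemma emeasure_joint_law_Times:
  assumes PX: "prob_space PX" and K: "K \<in> PX \<rightarrow>\<^sub>M prob_algebra MY"
    and A: "A \<in> sets PX" and B: "B \<in> sets MY"
  shows "emeasure (joint_law PX MY K) (A \<times> B) = (\<integral>\<^sup>+x. indicator A x * emeasure (K x) B \<partial>PX)"
proof -
  interpret prob_space PX by fact
  have [measurable]: "K \<in> PX \<rightarrow>\<^sub>M subprob_algebra MY"
    using K by (rule measurable_prob_algebraD)
  have [measurable]: "A \<in> sets PX" "B \<in> sets MY" by fact+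
  have "emeasure (joint_law PX MY K) (A \<times> B) =
      (\<integral>\<^sup>+x. emeasure (K x \<bind> (\<lambda>y. return (PX \<Otimes>\<^sub>M MY) (x, y))) (A \<times> B) \<partial>PX)"
    unfolding joint_law_def
    by (rule emeasure_bind[where N = "PX \<Otimes>\<^sub>M MY"]) (auto simp: not_empty)
  also have "\<dots> = (\<integral>\<^sup>+x. indicator A x * emeasure (K x) B \<partial>PX)"
  proof (rule nn_integral_cong)
    fix x assume x: "x \<in> space PX"
    have sK [measurable_cong]: "sets (K x) = sets MY"
      using measurable_space[OF K x] by (simp add: space_prob_algebra)
    have "prob_space (K x)"
      using measurable_space[OF K x] by (simp add: space_prob_algebra)
    then have ne: "space (K x) \<noteq> {}" by (rule prob_space.not_empty)
    have "emeasure (K x \<bind> (\<lambda>y. return (PX \<Otimes>\<^sub>M MY) (x, y))) (A \<times> B) =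
        (\<integral>\<^sup>+y. emeasure (return (PX \<Otimes>\<^sub>M MY) (x, y)) (A \<times> B) \<partial>K x)"
      using x ne by (intro emeasure_bind[where N = "PX \<Otimes>\<^sub>M MY"]) auto
    also have "\<dots> = (\<integral>\<^sup>+y. indicator A x * indicator B y \<partial>K x)"
      by (intro nn_integral_cong) (auto simp: indicator_def)
    also have "\<dots> = indicator A x * emeasure (K x) B"
    proof -
      have "B \<in> sets (K x)" by (simp add: sK)
      then show ?thesis by (subst nn_integral_cmult) auto
    qed
    finally show "emeasure (K x \<bind> (\<lambda>y. return (PX \<Otimes>\<^sub>M MY) (x, y))) (A \<times> B) =
        indicator A x * emeasure (K x) B" .
  qed
  finally show ?thesis .
qed

lemma sets_joint_law:
  assumes "prob_space PX" "K \<in> PX \<rightarrow>\<^sub>M prob_algebra MY"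
  shows "sets (joint_law PX MY K) = sets (PX \<Otimes>\<^sub>M MY)"
proof -
  interpret prob_space PX by fact
  show ?thesis
    unfolding joint_law_def
  proof (rule sets_bind)
    fix x assume x: "x \<in> space PX"
    have "prob_space (K x)"
      using measurable_space[OF assms(2) x] by (simp add: space_prob_algebra)
    then have "space (K x) \<noteq> {}" by (rule prob_space.not_empty)
    then show "sets (K x \<bind> (\<lambda>y. return (PX \<Otimes>\<^sub>M MY) (x, y))) = sets (PX \<Otimes>\<^sub>M MY)"
      by (intro sets_bind) auto
  qed (simp add: not_empty)
qed

lemma prob_space_joint_law:
  assumes PX: "prob_space PX" and K: "K \<in> PX \<rightarrow>\<^sub>M prob_algebra MY"
  shows "prob_space (joint_law PX MY K)"
proof
  interpret prob_space PX by fact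
  have "space (joint_law PX MY K) = space PX \<times> space MY"
    using sets_eq_imp_space_eq[OF sets_joint_law[OF PX K]] by (simp add: space_pair_measure)
  then have "emeasure (joint_law PX MY K) (space (joint_law PX MY K)) =
      (\<integral>\<^sup>+x. indicator (space PX) x * emeasure (K x) (space MY) \<partial>PX)"
    by (simp add: emeasure_joint_law_Times[OF PX K])
  also have "\<dots> = (\<integral>\<^sup>+x. 1 \<partial>PX)"
  proof (rule nn_integral_cong)
    fix x assume x: "x \<in> space PX"
    have "prob_space (K x)" "sets (K x) = sets MY"
      using measurable_space[OF K x] by (simp_all add: space_prob_algebra)
    then show "indicator (space PX) x * emeasure (K x) (space MY) = 1"
      using x prob_space.emeasure_space_1[of "K x"] sets_eq_imp_space_eq[of "K x" MY] by simp
  qed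
  finally show "emeasure (joint_law PX MY K) (space (joint_law PX MY K)) = 1"
    by (simp add: emeasure_space_1)
qed

lemma regular_version_countably_generated:
  assumes PX: "prob_space PX" and K: "K \<in> PX \<rightarrow>\<^sub>M prob_algebra MY"
    and ac: "absolutely_continuous (product_law PX MY K) (joint_law PX MY K)"
    and G: "countable G" "G \<subseteq> Pow (space MY)" "sets MY = sigma_sets (space MY) G"
  shows "regular_version PX MY K"
proof -
  interpret prob_space PX by fact
  define Q where "Q = output_law PX MY K"
  define f where "f = RN_deriv (product_law PX MY K) (joint_law PX MY K)"
  have sJ: "sets (joint_law PX MY K) = sets (PX \<Otimes>\<^sub>M MY)"
    using PX K by (rule sets_joint_law)
  have sQ [measurable_cong]: "sets Q = sets MY"
    by (simp add: Q_def output_law_def)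
  interpret J: prob_space "joint_law PX MY K" using PX K by (rule prob_space_joint_law)
  have "snd \<in> joint_law PX MY K \<rightarrow>\<^sub>M MY"
    unfolding measurable_cong_sets[OF sJ refl] by simp
  then interpret Q: prob_space Q
    unfolding Q_def output_law_def by (rule J.prob_space_distr)
  interpret PQ: pair_prob_space PX Q ..
  have pl: "product_law PX MY K = PX \<Otimes>\<^sub>M Q"
    by (simp add: product_law_def Q_def)
  have sPQ: "sets (PX \<Otimes>\<^sub>M Q) = sets (PX \<Otimes>\<^sub>M MY)"
    by (intro sets_pair_measure_cong refl sQ)
  have f [measurable]: "f \<in> borel_measurable (PX \<Otimes>\<^sub>M Q)"
    by (simp add: f_def pl)
  have dens: "density (PX \<Otimes>\<^sub>M Q) f = joint_law PX MY K"
    using PQ.density_RN_deriv[of "joint_law PX MY K"] ac sJ sPQ by (simp add: f_def pl)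
  have [measurable]: "K \<in> PX \<rightarrow>\<^sub>M subprob_algebra MY"
    using K by (rule measurable_prob_algebraD)
  have ae: "AE x in PX. emeasure (K x) B = (\<integral>\<^sup>+y. f (x, y) * indicator B y \<partial>Q)"
    if B[measurable]: "B \<in> sets MY" for B
  proof -
    let ?g = "\<lambda>x. \<integral>\<^sup>+y. f (x, y) * indicator B y \<partial>Q"
    have "density PX (\<lambda>x. emeasure (K x) B) = density PX ?g"
    proof (rule measure_eqI)
      fix A assume "A \<in> sets (density PX (\<lambda>x. emeasure (K x) B))"
      then have A [measurable]: "A \<in> sets PX" by simp
      have "emeasure (density PX (\<lambda>x. emeasure (K x) B)) A =
          (\<integral>\<^sup>+x. indicator A x * emeasure (K x) B \<partial>PX)"
        by (subst emeasure_density) (auto simp: mult.commute)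
      also have "\<dots> = emeasure (density (PX \<Otimes>\<^sub>M Q) f) (A \<times> B)"
        using emeasure_joint_law_Times[OF PX K A B] dens by simp
      also have "\<dots> = (\<integral>\<^sup>+z. f z * indicator (A \<times> B) z \<partial>(PX \<Otimes>\<^sub>M Q))"
        by (rule emeasure_density) (auto simp: sQ)
      also have "\<dots> = (\<integral>\<^sup>+x. \<integral>\<^sup>+y. f (x, y) * indicator (A \<times> B) (x, y) \<partial>Q \<partial>PX)"
        by (rule Q.nn_integral_fst[symmetric]) simp
      also have "\<dots> = (\<integral>\<^sup>+x. ?g x * indicator A x \<partial>PX)"
        by (intro nn_integral_cong) (auto simp: indicator_def)
      also have "\<dots> = emeasure (density PX ?g) A"
        by (subst emeasure_density) auto
      finally show "emeasure (density PX (\<lambda>x. emeasure (K x) B)) A = emeasure (density PX ?g) A" .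
    qed simp
    then show ?thesis
      by (subst (asm) density_unique_iff) auto
  qed
  define E where "E = insert (space MY) (\<Inter> ` {F. finite F \<and> F \<noteq> {} \<and> F \<subseteq> G})"
  have cE: "countable E"
  proof -
    have "countable {F. finite F \<and> F \<subseteq> G}"
      using G(1) by (rule countable_Collect_finite_subset)
    then have "countable {F. finite F \<and> F \<noteq> {} \<and> F \<subseteq> G}"
      by (rule countable_subset[rotated]) auto
    then show ?thesis by (simp add: E_def)
  qed
  have EP: "E \<subseteq> Pow (space MY)"
    using G(2) by (auto simp: E_def)
  have IE: "Int_stable E"
  proof (rule Int_stableI)
    fix a b assume ab: "a \<in> E" "b \<in> E"
    have sub: "a \<subseteq> space MY" "b \<subseteq> space MY" using ab EP by auto
    show "a \<inter> b \<in> E"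
    proof (cases "a = space MY \<or> b = space MY")
      case True
      then show ?thesis using ab sub by (auto simp: Int_absorb1 Int_absorb2)
    next
      case False
      then obtain F F' where F: "a = \<Inter>F" "finite F" "F \<noteq> {}" "F \<subseteq> G"
        and F': "b = \<Inter>F'" "finite F'" "F' \<noteq> {}" "F' \<subseteq> G"
        using ab by (auto simp: E_def)
      have "a \<inter> b = \<Inter>(F \<union> F')" using F F' by auto
      moreover have "F \<union> F' \<in> {F. finite F \<and> F \<noteq> {} \<and> F \<subseteq> G}" using F F' by auto
      ultimately show ?thesis unfolding E_def by blast
    qed
  qed
  have GE: "G \<subseteq> E"
  proof
    fix g assume "g \<in> G"
    then have "g = \<Inter>{g}" "{g} \<in> {F. finite F \<and> F \<noteq> {} \<and> F \<subseteq> G}" by auto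
    then show "g \<in> E" unfolding E_def by blast
  qed
  have Gsets: "G \<subseteq> sets MY" using G(3) by auto
  have Esets: "E \<subseteq> sets MY"
  proof
    fix e assume "e \<in> E"
    then consider "e = space MY" | F where "e = \<Inter>F" "finite F" "F \<noteq> {}" "F \<subseteq> G"
      by (auto simp: E_def)
    then show "e \<in> sets MY"
    proof cases
      case 2
      then show ?thesis using Gsets sets.finite_INT[of F "\<lambda>x. x" MY] by auto
    qed simp
  qed
  have sE: "sets MY = sigma_sets (space MY) E"
  proof
    show "sets MY \<subseteq> sigma_sets (space MY) E"
      unfolding G(3) using GE by (rule sigma_sets_mono')
    show "sigma_sets (space MY) E \<subseteq> sets MY"
      using Esets by (rule sets.sigma_sets_subset)
  qed
  have "AE x in PX. \<forall>B\<in>E. emeasure (K x) B = (\<integral>\<^sup>+y. f (x, y) * indicator B y \<partial>Q)"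
    using ae Esets by (subst AE_ball_countable[OF cE]) auto
  then have "AE x in PX. K x = density Q (\<lambda>y. f (x, y))"
  proof (rule AE_mp, intro AE_I2 impI)
    fix x assume x: "x \<in> space PX"
      and eq: "\<forall>B\<in>E. emeasure (K x) B = (\<integral>\<^sup>+y. f (x, y) * indicator B y \<partial>Q)"
    have sK: "sets (K x) = sets MY" and pK: "prob_space (K x)"
      using measurable_space[OF K x] by (simp_all add: space_prob_algebra)
    have fx [measurable]: "(\<lambda>y. f (x, y)) \<in> borel_measurable Q"
      using x by measurable
    show "K x = density Q (\<lambda>y. f (x, y))"
    proof (rule measure_eqI_generator_eq[OF IE EP, where A = "\<lambda>_. space MY"])
      fix B assume B: "B \<in> E"
      then have "B \<in> sets Q" using Esets sQ by auto
      then show "emeasure (K x) B = emeasure (density Q (\<lambda>y. f (x, y))) B"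
        using eq B by (simp add: emeasure_density)
    next
      show "emeasure (K x) (space MY) \<noteq> \<infinity>" for i :: nat
        using prob_space.emeasure_space_1[OF pK] sets_eq_imp_space_eq[OF sK] by simp
    qed (auto simp: sK sQ sE E_def)
  qed
  then show ?thesis
    by (simp add: regular_version_def Q_def f_def)
qed

end

theory Submission
  imports Defs "HOL-Real_Asymp.Real_Asymp"
begin

text \<open>
  Write \<open>W k\<close> for the likelihood ratio of the \<open>k\<close>-th codeword at a fixed output, and
  \<open>L = (1 / M) * (\<Sum>k. W k)\<close>; given the output the \<open>W k\<close> are i.i.d. with mean 1. The expected divergence
  is the mean of \<open>L ln L - L + 1\<close>. The tangent of \<open>ln\<close> at \<open>1 + W k / M\<close> bounds it from above, and
  \<open>l ln l - l + 1 \<ge> exp (1 - l) + l - 2\<close>, whose mean factorises over the codewords, bounds it from below.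
  In terms of the random walk \<open>S\<close> with steps \<open>info_density - R\<close> under the joint law this gives
  \<open>c E min 1 (exp S) - O(exp (- n R)) \<le> E D \<le> E ln (1 + exp S)\<close>.

  Both sides are evaluated by exponential tilting at \<open>\<tau>\<^sup>*\<close>. For \<open>\<tau>\<^sup>* < 1\<close> the tilted walk is centred and the
  probability that it stays in a bounded window is of order \<open>1 / sqrt n\<close>; this holds also for lattice steps
  and follows by integrating the Fejer kernel, whose Fourier transform has compact support, against the
  walk. For \<open>\<tau>\<^sup>* = 1\<close> the tilted walk has nonpositive drift, possibly with infinite variance, and is
  nonpositive with probability bounded away from 0.
\<close>

section \<open>Elementary inequalities\<close>

text \<open>The familiar upper bound by the chi-square distance costs the second moment of
  \<open>W k\<close>, the \<open>n\<close>-th power of the moment generating function at 1; this may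
  be infinite, and its exponent is too weak when the optimal \<tau> is below 1. The tangent point
  \<open>1 + W k / M\<close> is, up to \<open>1 / M\<close>, the mean of \<open>L\<close> given
  \<open>W k\<close>, so the linear term costs nothing on average and only
  \<open>ln (1 + W k / M)\<close>, weighted by \<open>W k\<close>, remains. This weight is the
  density of the joint law with respect to the product law. Subtracting \<open>L - 1\<close>, of
  mean zero, makes the integrand nonnegative, so that Tonelli applies without integrability
  conditions. The two bounds have the same order: after tilting, \<open>ln (1 + exp s)\<close> and
  \<open>min 1 (exp s)\<close> both decay exponentially on either side of 0 if 0 < \<tau> < 1, and
  both tend to 1 as \<open>s\<close> tends to minus infinity if \<tau> = 1. The error
  \<open>exp (- n R)\<close> is of smaller order because positive mutual information makes the
  moment generating function exceed 1 at the optimal \<tau>, which is positive because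
  \<open>R\<close> exceeds the mutual information.\<close>

definition ent_fun :: "real \<Rightarrow> real" where
  "ent_fun l = l * ln l - l + 1"

text \<open>The part of \<open>exp (- x)\<close> beyond first order. As a likelihood ratio
  \<open>w\<close> has mean 1, the mean of \<open>exp (- w / M)\<close> is \<open>1 - 1 / M\<close>
  plus the mean of \<open>exp_rem (w / M)\<close>.\<close>

definition exp_rem :: "real \<Rightarrow> real" where
  "exp_rem x = exp (- x) - 1 + x"

lemma ent_fun_measurable [measurable]: "ent_fun \<in> borel_measurable borel"
  unfolding ent_fun_def[abs_def] by measurable

lemma exp_rem_measurable [measurable]: "exp_rem \<in> borel_measurable borel"
  unfolding exp_rem_def[abs_def] by measurable

lemma exp_rem_nonneg: "0 \<le> exp_rem x"
  using exp_ge_add_one_self[of "- x"] by (simp add: exp_rem_def)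

text \<open>The difference of the two sides is convex on the positive axis, because
  \<open>x \<le> exp (x - 1)\<close>, and it vanishes at 1 together with its derivative. At 0 the
  claim is \<open>exp 1 \<le> 3\<close>.\<close>

lemma ent_fun_ge:
  assumes "0 \<le> l"
  shows "exp (1 - l) + l - 2 \<le> ent_fun l"
proof (cases "l = 0")
  case True
  then show ?thesis using exp_le by (simp add: ent_fun_def)
next
  case False
  define d where "d l = ent_fun l - exp (1 - l) - l + 2" for l :: real
  define d' where "d' l = ln l + exp (1 - l) - 1" for l :: real
  have 1: "(d has_real_derivative d' x) (at x)" if "0 < x" for x
    unfolding d_def d'_def ent_fun_def using that
    by (auto intro!: derivative_eq_intros simp: field_simps)
  have 2: "(d' has_real_derivative (1 / x - exp (1 - x))) (at x)" if "0 < x" for x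
    unfolding d'_def using that by (auto intro!: derivative_eq_intros simp: field_simps)
  have 3: "1 / x - exp (1 - x) \<ge> 0" if "0 < x" for x :: real
  proof -
    have "x \<le> exp (x - 1)" using exp_ge_add_one_self[of "x - 1"] by simp
    then have "x * exp (1 - x) \<le> exp (x - 1) * exp (1 - x)" by (intro mult_right_mono) auto
    also have "\<dots> = 1" by (simp flip: exp_add)
    finally show ?thesis using that by (simp add: field_simps)
  qed
  have cv: "convex_on {0<..} d"
    by (rule f''_ge0_imp_convex[where f' = d' and f'' = "\<lambda>x. 1 / x - exp (1 - x)"])
       (use 1 2 3 in auto)
  have "d l - d 1 \<ge> d' 1 * (l - 1)"
    by (rule convex_on_imp_above_tangent[OF cv])
       (use False assms 1[of 1] in \<open>auto intro: has_field_derivative_at_within simp: is_interval_connected interior_open\<close>)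
  then show ?thesis by (simp add: d_def d'_def ent_fun_def)
qed

lemma ent_fun_nonneg: "0 \<le> l \<Longrightarrow> 0 \<le> ent_fun l"
  using ent_fun_ge[of l] exp_ge_add_one_self[of "1 - l"] by linarith

text \<open>The factor \<open>x\<close> is kept in front for the sake of \<open>x = w / M\<close>:
  after multiplication by \<open>M\<close> the bound reads \<open>w * min 1 (w / M) / 4\<close>, in
  which \<open>w\<close> can serve as the density of a change of measure.\<close>

lemma exp_rem_ge:
  assumes "0 \<le> x"
  shows "x * min 1 x / 4 \<le> exp_rem x"
proof (cases "x \<le> 1")
  case True
  have "exp_rem 0 - 0^2 / 4 \<le> exp_rem x - x^2 / 4"
  proof (rule DERIV_nonneg_imp_nondecreasing[OF assms])
    fix y assume y: "0 \<le> y" "y \<le> x"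
    have "exp (- y) \<le> 1 / (1 + y)"
      using y exp_ge_add_one_self[of y] by (simp add: exp_minus field_simps)
    also have "\<dots> \<le> 1 - y / 2"
    proof -
      have "y * y \<le> y * 1" using y True by (intro mult_left_mono) auto
      then show ?thesis using y by (simp add: field_simps)
    qed
    finally have "0 \<le> - exp (- y) + 1 - y / 2" by simp
    moreover have "((\<lambda>x. exp_rem x - x^2 / 4) has_real_derivative (- exp (- y) + 1 - y / 2)) (at y)"
      unfolding exp_rem_def by (auto intro!: derivative_eq_intros)
    ultimately show "\<exists>z. ((\<lambda>x. exp_rem x - x^2 / 4) has_real_derivative z) (at y) \<and> 0 \<le> z"
      by blast
  qed
  then show ?thesis using True by (simp add: exp_rem_def power2_eq_square)
next
  case False
  have "x / 4 \<le> exp_rem x"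
  \<comment> \<open>From 4/3 on, \<open>x - 1\<close> alone exceeds \<open>x / 4\<close>. Below it,
    the tangent of \<open>exp\<close> at 0, applied to \<open>exp (1 - x)\<close>, suffices.\<close>
  proof (cases "x \<le> 4/3")
    case True
    have "(2 - x) / 3 \<le> exp (- 1) * exp (1 - x)"
    proof -
      have "1 / 3 \<le> exp (- 1 :: real)" using exp_le by (simp add: exp_minus field_simps)
      then have "1 / 3 * (2 - x) \<le> exp (- 1) * exp (1 - x)"
        using True exp_ge_add_one_self[of "1 - x"] by (intro mult_mono) auto
      then show ?thesis by simp
    qed
    also have "\<dots> = exp (- x)" by (simp flip: exp_add)
    finally show ?thesis using False by (simp add: exp_rem_def)
  next
    case False
    then show ?thesis using exp_gt_zero[of "- x"] unfolding exp_rem_def by linarith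
  qed
  then show ?thesis using False by simp
qed

lemma tangent_bound:
  fixes l a :: real
  assumes "0 < l" "0 \<le> a"
  shows "ln l \<le> ln (1 + a) + l / (1 + a) - 1"
proof -
  have "ln (l / (1 + a)) \<le> l / (1 + a) - 1"
    using assms by (intro ln_le_minus_one) (simp add: add_pos_nonneg)
  then show ?thesis using assms by (simp add: ln_div)
qed

section \<open>Soft covering at a fixed output\<close>

lemma nn_integral_PiM_component:
  assumes "prob_space A" "finite I" "k \<in> I" and [measurable]: "F \<in> borel_measurable A"
  shows "(\<integral>\<^sup>+c. F (c k) \<partial>Pi\<^sub>M I (\<lambda>_. A)) = (\<integral>\<^sup>+x. F x \<partial>A)"
proof -
  have "distr (Pi\<^sub>M I (\<lambda>_. A)) A (\<lambda>c. c k) = A"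
    using assms by (intro distr_PiM_component) auto
  then have "(\<integral>\<^sup>+x. F x \<partial>A) = (\<integral>\<^sup>+x. F x \<partial>distr (Pi\<^sub>M I (\<lambda>_. A)) A (\<lambda>c. c k))" by simp
  also have "\<dots> = (\<integral>\<^sup>+c. F (c k) \<partial>Pi\<^sub>M I (\<lambda>_. A))"
    using assms by (intro nn_integral_distr) auto
  finally show ?thesis by simp
qed

text \<open>Inserting the constant 1 at the remaining indices reduces independence of two
  coordinates to the product rule over all of them.\<close>

lemma nn_integral_PiM_two_components:
  fixes F H :: "'a \<Rightarrow> ennreal"
  assumes "prob_space A" "finite I" "k \<in> I" "j \<in> I" "j \<noteq> k"
    and [measurable]: "F \<in> borel_measurable A" "H \<in> borel_measurable A"
  shows "(\<integral>\<^sup>+c. F (c k) * H (c j) \<partial>Pi\<^sub>M I (\<lambda>_. A)) = (\<integral>\<^sup>+x. F x \<partial>A) * (\<integral>\<^sup>+x. H x \<partial>A)"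
proof -
  interpret A: prob_space A by fact
  interpret product_prob_space "\<lambda>_. A" I by unfold_locales
  define f where "f i = (if i = k then F else if i = j then H else (\<lambda>_. 1))" for i
  have [measurable]: "f i \<in> borel_measurable A" for i by (simp add: f_def)
  have *: "(\<Prod>i\<in>I. g i) = g k * g j" if "\<And>i. i \<in> I - {k, j} \<Longrightarrow> g i = 1" for g :: "'b \<Rightarrow> ennreal"
  proof -
    have "(\<Prod>i\<in>I. g i) = (\<Prod>i\<in>{k, j}. g i)"
      using assms that by (intro prod.mono_neutral_right) auto
    then show ?thesis using assms by auto
  qed
  have "(\<integral>\<^sup>+c. F (c k) * H (c j) \<partial>Pi\<^sub>M I (\<lambda>_. A)) = (\<integral>\<^sup>+c. (\<Prod>i\<in>I. f i (c i)) \<partial>Pi\<^sub>M I (\<lambda>_. A))"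
    using assms by (subst *) (auto simp: f_def)
  also have "\<dots> = (\<Prod>i\<in>I. integral\<^sup>N A (f i))"
    using assms by (intro product_nn_integral_prod) auto
  also have "\<dots> = (\<integral>\<^sup>+x. F x \<partial>A) * (\<integral>\<^sup>+x. H x \<partial>A)"
    using assms by (subst *) (auto simp: f_def A.emeasure_space_1)
  finally show ?thesis .
qed

lemma nn_integral_sample_mean:
  fixes w :: "'a \<Rightarrow> real" and M :: nat
  assumes A: "prob_space A" and w [measurable]: "w \<in> borel_measurable A"
    and nonneg: "\<And>x. 0 \<le> w x" and int: "(\<integral>\<^sup>+x. w x \<partial>A) = 1" and M: "0 < M"
  shows "(\<integral>\<^sup>+c. ennreal ((\<Sum>k<M. w (c k)) / M) \<partial>Pi\<^sub>M {..<M} (\<lambda>_. A)) = 1"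
proof -
  let ?P = "Pi\<^sub>M {..<M} (\<lambda>_. A)"
  have "(\<integral>\<^sup>+c. ennreal ((\<Sum>k<M. w (c k)) / M) \<partial>?P) =
      (\<integral>\<^sup>+c. ennreal (1 / M) * (\<Sum>k<M. ennreal (w (c k))) \<partial>?P)"
    by (intro nn_integral_cong) (simp add: nonneg sum_nonneg flip: ennreal_mult)
  also have "\<dots> = ennreal (1 / M) * (\<Sum>k<M. \<integral>\<^sup>+c. ennreal (w (c k)) \<partial>?P)"
    by (simp add: nn_integral_cmult nn_integral_sum)
  also have "\<dots> = ennreal (1 / M) * (\<Sum>k<M. 1)"
    using int by (simp add: nn_integral_PiM_component[OF A, where F = "\<lambda>x. ennreal (w x)"])
  also have "\<dots> = 1" using M by (simp add: ennreal_of_nat_eq_real_of_nat flip: ennreal_mult)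
  finally show ?thesis .
qed

text \<open>Write \<open>L ln L\<close> as the average of \<open>w (c k) * ln (L c)\<close> and
  apply the tangent at \<open>1 + w (c k) / M\<close> to each term. In the linear part,
  \<open>L\<close> splits into \<open>w (c k) / M\<close> and a remainder that is independent of
  \<open>c k\<close> with mean at most 1; the two pieces then add up to at most the mean of
  \<open>w\<close>, which is 1 and cancels.\<close>

lemma soft_covering_upper:
  fixes w :: "'a \<Rightarrow> real" and M :: nat
  assumes A: "prob_space A" and w [measurable]: "w \<in> borel_measurable A"
    and nonneg: "\<And>x. 0 \<le> w x" and int: "(\<integral>\<^sup>+x. w x \<partial>A) = 1" and M: "0 < M"
  shows "(\<integral>\<^sup>+c. ent_fun ((\<Sum>k<M. w (c k)) / M) \<partial>Pi\<^sub>M {..<M} (\<lambda>_. A)) \<le>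
    (\<integral>\<^sup>+x. w x * ln (1 + w x / M) \<partial>A)" (is "?X \<le> ?U")
proof -
  interpret A: prob_space A by fact
  let ?P = "Pi\<^sub>M {..<M} (\<lambda>_. A)"
  interpret P: product_prob_space "\<lambda>_. A" "{..<M}" by unfold_locales
  define L where "L c = (\<Sum>k<M. w (c k)) / M" for c
  define u where "u x = ennreal (w x * ln (1 + w x / M))" for x
  define q where "q x = ennreal (w x * (w x / M) / (1 + w x / M))" for x
  define p where "p x = ennreal (w x / (1 + w x / M) / M)" for x
  have [measurable]: "u \<in> borel_measurable A" "q \<in> borel_measurable A" "p \<in> borel_measurable A"
    unfolding u_def q_def p_def by measurable
  have [measurable]: "L \<in> borel_measurable ?P" unfolding L_def by measurable
  \<comment> \<open>\<open>u\<close> is the logarithmic term; \<open>q\<close> and the products of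
    \<open>p\<close> with \<open>w\<close> are the diagonal and the off-diagonal part of the linear
    term. All are nonnegative, so their integrals may be added freely.\<close>
  define g where "g k c = u (c k) + q (c k) + (\<Sum>j\<in>{..<M}-{k}. p (c k) * ennreal (w (c j)))" for k c
  have [measurable]: "(\<lambda>c. c j) \<in> measurable ?P A" if "j < M" for j
    using that by (intro measurable_component_singleton) auto
  have pw_meas [measurable]: "(\<lambda>c. p (c k) * ennreal (w (c j))) \<in> borel_measurable ?P"
    if "k < M" "j < M" for k j using that by measurable
  have [measurable]: "g k \<in> borel_measurable ?P" if "k < M" for k
    unfolding g_def using that by measurable
  have Lnn: "0 \<le> L c" for c unfolding L_def by (simp add: sum_nonneg nonneg)
  \<comment> \<open>Adding \<open>2 * L\<close> turns the left side into
    \<open>L * (ln L + 1) + 1\<close> and removes every minus sign; since \<open>L\<close> has mean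
    1, exactly 2 is cancelled at the end.\<close>
  have pw: "ennreal (ent_fun (L c)) + 2 * ennreal (L c) \<le> 1 + ennreal (1 / M) * (\<Sum>k<M. g k c)" for c
  proof -
    have gk: "g k c = ennreal (w (c k) * ln (1 + w (c k) / M) + w (c k) * L c / (1 + w (c k) / M))"
      if "k < M" for k
    proof -
      let ?a = "w (c k) / M"
      have a: "0 \<le> ?a" using nonneg by simp
      have Lc: "L c = ?a + (\<Sum>j\<in>{..<M}-{k}. w (c j)) / M"
        unfolding L_def using that by (subst sum.remove[of _ k]) (auto simp: add_divide_distrib)
      then have eq: "w (c k) * L c / (1 + ?a) = w (c k) * ?a / (1 + ?a) +
          (\<Sum>j\<in>{..<M}-{k}. w (c k) / (1 + ?a) / M * w (c j))"
      proof -
        have gen: "v * (b + S / real M) / (1 + b) = v * b / (1 + b) + v / (1 + b) / real M * S"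
          for v b S :: real by (simp add: distrib_left add_divide_distrib ac_simps)
        have "w (c k) * (?a + (\<Sum>j\<in>{..<M}-{k}. w (c j)) / M) / (1 + ?a) = w (c k) * ?a / (1 + ?a) +
            w (c k) / (1 + ?a) / M * (\<Sum>j\<in>{..<M}-{k}. w (c j))" by (rule gen)
        also have "w (c k) / (1 + ?a) / M * (\<Sum>j\<in>{..<M}-{k}. w (c j)) =
            (\<Sum>j\<in>{..<M}-{k}. w (c k) / (1 + ?a) / M * w (c j))" by (rule sum_distrib_left)
        finally show ?thesis by (subst Lc)
      qed
      have s: "(\<Sum>j\<in>{..<M}-{k}. p (c k) * ennreal (w (c j))) =
          ennreal (\<Sum>j\<in>{..<M}-{k}. w (c k) / (1 + ?a) / M * w (c j))"
      proof -
        have "0 \<le> w (c k) / (1 + ?a) / M" using a nonneg[of "c k"] by simp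
        then have "p (c k) * ennreal (w (c j)) = ennreal (w (c k) / (1 + ?a) / M * w (c j))"
          "0 \<le> w (c k) / (1 + ?a) / M * w (c j)" for j
          unfolding p_def using nonneg[of "c j"] by (simp_all only: ennreal_mult mult_nonneg_nonneg)
        then show ?thesis by (simp only: sum_ennreal)
      qed
      have gen: "ennreal x + ennreal y + ennreal z = ennreal (x + (y + z))"
        if "0 \<le> x" "0 \<le> y" "0 \<le> z" for x y z using that by (simp add: add.assoc)
      show ?thesis unfolding eq g_def s u_def q_def
        by (rule gen) (use a nonneg in \<open>auto intro!: mult_nonneg_nonneg divide_nonneg_nonneg sum_nonneg\<close>)
    qed
    have "ent_fun (L c) + 2 * L c \<le> 1 + (1 / M) *
        (\<Sum>k<M. w (c k) * ln (1 + w (c k) / M) + w (c k) * L c / (1 + w (c k) / M))"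
    proof -
      have "(\<Sum>k<M. w (c k) * (ln (L c) + 1)) \<le>
          (\<Sum>k<M. w (c k) * ln (1 + w (c k) / M) + w (c k) * L c / (1 + w (c k) / M))"
      proof (intro sum_mono)
        fix k assume k: "k \<in> {..<M}"
        show "w (c k) * (ln (L c) + 1) \<le> w (c k) * ln (1 + w (c k) / M) + w (c k) * L c / (1 + w (c k) / M)"
        \<comment> \<open>The tangent bound requires \<open>L c > 0\<close>. This follows as soon as
          one summand is positive, and a vanishing summand contributes nothing on either
          side.\<close>
        proof (cases "w (c k) = 0")
          case False
          then have "0 < w (c k)" using nonneg[of "c k"] by simp
          then have "0 < (\<Sum>k<M. w (c k))"
            using k nonneg by (intro sum_pos2[of _ k]) auto
          then have "0 < L c" using M by (simp add: L_def)
          then have "ln (L c) + 1 \<le> ln (1 + w (c k) / M) + L c / (1 + w (c k) / M)"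
            using tangent_bound[of "L c" "w (c k) / M"] nonneg by simp
          then have "w (c k) * (ln (L c) + 1) \<le> w (c k) * (ln (1 + w (c k) / M) + L c / (1 + w (c k) / M))"
            using nonneg by (intro mult_left_mono) auto
          then show ?thesis by (simp add: distrib_left)
        qed simp
      qed
      then have "(1 / M) * (\<Sum>k<M. w (c k) * (ln (L c) + 1)) \<le> (1 / M) *
          (\<Sum>k<M. w (c k) * ln (1 + w (c k) / M) + w (c k) * L c / (1 + w (c k) / M))"
        by (intro mult_left_mono) auto
      also have "(1 / M) * (\<Sum>k<M. w (c k) * (ln (L c) + 1)) = L c * (ln (L c) + 1)"
        by (simp add: L_def sum_distrib_right)
      finally show ?thesis by (simp add: ent_fun_def algebra_simps)
    qed
    then have "ennreal (ent_fun (L c) + 2 * L c) \<le> ennreal (1 + (1 / M) *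
        (\<Sum>k<M. w (c k) * ln (1 + w (c k) / M) + w (c k) * L c / (1 + w (c k) / M)))"
      by (rule ennreal_leI)
    also have "\<dots> = 1 + ennreal (1 / M) * (\<Sum>k<M. g k c)"
    proof -
      define h where "h k = w (c k) * ln (1 + w (c k) / M) + w (c k) * L c / (1 + w (c k) / M)" for k
      have "0 \<le> h k" for k
        unfolding h_def using nonneg Lnn by (auto intro!: mult_nonneg_nonneg divide_nonneg_nonneg add_nonneg_nonneg)
      then have "ennreal (1 + 1 / M * sum h {..<M}) = 1 + ennreal (1 / M) * (\<Sum>k<M. ennreal (h k))"
        by (simp add: sum_nonneg flip: ennreal_mult)
      also have "(\<Sum>k<M. ennreal (h k)) = (\<Sum>k<M. g k c)"
        by (intro sum.cong) (auto simp: gk h_def)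
      finally show ?thesis by (simp only: h_def)
    qed
    finally show ?thesis using Lnn ent_fun_nonneg[of "L c"] by (simp add: ennreal_mult)
  qed
  have intL: "(\<integral>\<^sup>+c. ennreal (L c) \<partial>?P) = 1"
    unfolding L_def using M by (intro nn_integral_sample_mean A w nonneg int) auto
  have intg: "(\<integral>\<^sup>+c. g k c \<partial>?P) \<le> ?U + 1" if k: "k < M" for k
  proof -
    have "(\<integral>\<^sup>+c. g k c \<partial>?P) = (\<integral>\<^sup>+c. u (c k) \<partial>?P) + (\<integral>\<^sup>+c. q (c k) \<partial>?P) +
        (\<Sum>j\<in>{..<M}-{k}. \<integral>\<^sup>+c. p (c k) * ennreal (w (c j)) \<partial>?P)"
    proof -
      have "(\<integral>\<^sup>+c. g k c \<partial>?P) = (\<integral>\<^sup>+c. u (c k) + q (c k) \<partial>?P) +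
          (\<integral>\<^sup>+c. (\<Sum>j\<in>{..<M}-{k}. p (c k) * ennreal (w (c j))) \<partial>?P)"
        unfolding g_def using k by (intro nn_integral_add) measurable
      also have "(\<integral>\<^sup>+c. u (c k) + q (c k) \<partial>?P) = (\<integral>\<^sup>+c. u (c k) \<partial>?P) + (\<integral>\<^sup>+c. q (c k) \<partial>?P)"
        using k by (intro nn_integral_add) measurable
      also have "(\<integral>\<^sup>+c. (\<Sum>j\<in>{..<M}-{k}. p (c k) * ennreal (w (c j))) \<partial>?P) =
          (\<Sum>j\<in>{..<M}-{k}. \<integral>\<^sup>+c. p (c k) * ennreal (w (c j)) \<partial>?P)"
        using k by (intro nn_integral_sum pw_meas) auto
      finally show ?thesis .
    qed
    also have "\<dots> = ?U + (\<integral>\<^sup>+x. q x \<partial>A) + (\<Sum>j\<in>{..<M}-{k}. \<integral>\<^sup>+x. p x \<partial>A)"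
      using k int
      by (simp add: nn_integral_PiM_component[OF A] u_def[symmetric]
            nn_integral_PiM_two_components[OF A, where F = p and H = "\<lambda>x. ennreal (w x)"])
    \<comment> \<open>Restoring the missing index \<open>j = k\<close> only enlarges the sum, and
      makes \<open>q + M * p\<close> collapse to \<open>w\<close> exactly.\<close>
    also have "\<dots> \<le> ?U + (\<integral>\<^sup>+x. q x \<partial>A) + (\<Sum>j<M. \<integral>\<^sup>+x. p x \<partial>A)"
      by (intro add_left_mono sum_mono2) auto
    also have "\<dots> = ?U + ((\<integral>\<^sup>+x. q x \<partial>A) + (\<integral>\<^sup>+x. M * p x \<partial>A))"
      by (simp add: nn_integral_cmult add.assoc)
    also have "(\<integral>\<^sup>+x. q x \<partial>A) + (\<integral>\<^sup>+x. M * p x \<partial>A) = (\<integral>\<^sup>+x. w x \<partial>A)"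
    proof (subst nn_integral_add[symmetric]; (intro nn_integral_cong)?)
      fix x
      have "q x + of_nat M * p x = ennreal (w x * (w x / M) / (1 + w x / M) + M * (w x / (1 + w x / M) / M))"
        using nonneg[of x] by (simp add: q_def p_def ennreal_of_nat_eq_real_of_nat flip: ennreal_mult)
      also have "w x * (w x / M) / (1 + w x / M) + M * (w x / (1 + w x / M) / M) = w x"
      proof -
        have "0 < 1 + w x / M" using nonneg[of x] by (simp add: add_pos_nonneg)
        moreover have "w x * (w x / M) / (1 + w x / M) + w x / (1 + w x / M) = w x * (1 + w x / M) / (1 + w x / M)"
          by (simp add: distrib_left add_divide_distrib)
        ultimately show ?thesis using M by simp
      qed
      finally show "q x + of_nat M * p x = ennreal (w x)" .
    qed auto
    finally show ?thesis using int by simp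
  qed
  have "?X + 2 = (\<integral>\<^sup>+c. ennreal (ent_fun (L c)) + 2 * ennreal (L c) \<partial>?P)"
    by (simp add: nn_integral_add nn_integral_cmult intL flip: L_def)
  also have "\<dots> \<le> (\<integral>\<^sup>+c. 1 + ennreal (1 / M) * (\<Sum>k<M. g k c) \<partial>?P)"
    by (intro nn_integral_mono pw)
  also have "\<dots> = 1 + ennreal (1 / M) * (\<Sum>k<M. \<integral>\<^sup>+c. g k c \<partial>?P)"
  proof -
    have "(\<integral>\<^sup>+c. (\<Sum>k<M. g k c) \<partial>?P) = (\<Sum>k<M. \<integral>\<^sup>+c. g k c \<partial>?P)"
      by (intro nn_integral_sum) auto
    then show ?thesis
      by (subst nn_integral_add) (auto simp: nn_integral_cmult P.emeasure_space_1)
  qed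
  also have "\<dots> \<le> 1 + ennreal (1 / M) * (\<Sum>k<M. ?U + 1)"
    by (intro add_left_mono mult_left_mono sum_mono intg) auto
  also have "\<dots> = 1 + ennreal (1 / M) * M * (?U + 1)" by (simp add: mult.assoc)
  also have "ennreal (1 / M) * M = 1"
    using M by (simp add: ennreal_of_nat_eq_real_of_nat flip: ennreal_mult)
  also have "1 + 1 * (?U + 1) = ?U + 2" by (simp add: ac_simps flip: one_add_one)
  finally show ?thesis by (simp add: ennreal_add_left_cancel_le add.commute[of _ 2])
qed

text \<open>The mean of \<open>exp (1 - L)\<close> is \<open>exp 1 * E ^ M\<close> with
  \<open>E = 1 - 1 / M + \<rho>\<close>. Dropping a cross term,
  \<open>E \<ge> (1 - 1 / M) * (1 + \<rho>)\<close>; Bernoulli's inequality turns the second factor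
  into \<open>1 + M * \<rho>\<close>, and the first one costs only \<open>1 - 2 / M\<close>, because
  \<open>(1 - 1 / M) ^ M\<close> nearly cancels \<open>exp 1\<close>. The summand 1 on both sides
  avoids subtraction of extended reals.\<close>

lemma soft_covering_lower:
  fixes w :: "'a \<Rightarrow> real" and M :: nat
  assumes A: "prob_space A" and w [measurable]: "w \<in> borel_measurable A"
    and nonneg: "\<And>x. 0 \<le> w x" and int: "(\<integral>\<^sup>+x. w x \<partial>A) = 1" and M: "2 \<le> M"
  shows "ennreal (1 - 2 / M) * (1 + M * (\<integral>\<^sup>+x. exp_rem (w x / M) \<partial>A)) \<le>
    (\<integral>\<^sup>+c. ent_fun ((\<Sum>k<M. w (c k)) / M) \<partial>Pi\<^sub>M {..<M} (\<lambda>_. A)) + 1" (is "_ \<le> ?X + 1")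
proof -
  interpret A: prob_space A by fact
  let ?P = "Pi\<^sub>M {..<M} (\<lambda>_. A)"
  interpret P: product_prob_space "\<lambda>_. A" "{..<M}" by unfold_locales
  define L where "L c = (\<Sum>k<M. w (c k)) / M" for c
  have [measurable]: "L \<in> borel_measurable ?P" unfolding L_def by measurable
  have Lnn: "0 \<le> L c" for c unfolding L_def by (simp add: sum_nonneg nonneg)
  have intL: "(\<integral>\<^sup>+c. ennreal (L c) \<partial>?P) = 1"
    unfolding L_def using M by (intro nn_integral_sample_mean A w nonneg int) auto
  define E where "E = (\<integral>x. exp (- (w x / M)) \<partial>A)"
  define \<rho> where "\<rho> = E - 1 + 1 / M"
  have ie: "integrable A (\<lambda>x. exp (- (w x / M)))"
    using nonneg by (intro A.integrable_const_bound[of _ 1]) auto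
  have iw: "integrable A w" "(\<integral>x. w x \<partial>A) = 1"
    using int nonneg by (auto simp: integrable_iff_bounded integral_eq_nn_integral)
  have E: "(\<integral>\<^sup>+x. ennreal (exp (- (w x / M))) \<partial>A) = ennreal E" "0 \<le> E"
    unfolding E_def by (auto intro!: nn_integral_eq_integral ie)
  have R: "(\<integral>\<^sup>+x. exp_rem (w x / M) \<partial>A) = ennreal \<rho>" "0 \<le> \<rho>"
  proof -
    have i: "integrable A (\<lambda>x. exp_rem (w x / M))"
      unfolding exp_rem_def using ie iw by auto
    have "(\<integral>x. exp_rem (w x / M) \<partial>A) = \<rho>"
      unfolding exp_rem_def \<rho>_def E_def using ie iw by (simp add: A.prob_space)
    then show "(\<integral>\<^sup>+x. exp_rem (w x / M) \<partial>A) = ennreal \<rho>" "0 \<le> \<rho>"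
      using i by (auto simp: nn_integral_eq_integral exp_rem_nonneg intro!: integral_nonneg)
  qed
  have "(\<integral>\<^sup>+c. ennreal (exp 1) * (\<Prod>k<M. ennreal (exp (- (w (c k) / M)))) + ennreal (L c) \<partial>?P) \<le>
      (\<integral>\<^sup>+c. ennreal (ent_fun (L c)) + 2 \<partial>?P)"
  proof (intro nn_integral_mono)
    fix c
    have "(\<Prod>k<M. exp (- (w (c k) / M))) = exp (- L c)"
      by (simp add: L_def sum_divide_distrib sum_negf exp_sum[symmetric])
    then have "ennreal (exp 1) * (\<Prod>k<M. ennreal (exp (- (w (c k) / M)))) + ennreal (L c) =
        ennreal (exp (1 - L c) + L c)"
      using Lnn by (simp add: prod_ennreal exp_diff exp_minus divide_inverse flip: ennreal_mult)
    also have "\<dots> \<le> ennreal (ent_fun (L c) + 2)"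
      using ent_fun_ge[OF Lnn[of c]] by (intro ennreal_leI) simp
    also have "\<dots> = ennreal (ent_fun (L c)) + 2"
      using ent_fun_nonneg[OF Lnn[of c]] by simp
    finally show "ennreal (exp 1) * (\<Prod>k<M. ennreal (exp (- (w (c k) / M)))) + ennreal (L c) \<le> ennreal (ent_fun (L c)) + 2" .
  qed
  also have "\<dots> = ?X + 2"
    by (subst nn_integral_add) (auto simp: L_def P.emeasure_space_1)
  also have "(\<integral>\<^sup>+c. ennreal (exp 1) * (\<Prod>k<M. ennreal (exp (- (w (c k) / M)))) + ennreal (L c) \<partial>?P) =
     ennreal (exp 1) * (\<Prod>k<M. ennreal E) + 1"
    by (simp add: nn_integral_add nn_integral_cmult intL P.product_nn_integral_prod[where f = "\<lambda>_ x. ennreal (exp (- (w x / M)))"] E(1))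
  also have "ennreal (exp 1) * (\<Prod>k<M. ennreal E) + 1 = 1 + ennreal (exp 1 * E ^ M)"
    using E(2) by (simp add: ennreal_power ennreal_mult add.commute)
  finally have "1 + ennreal (exp 1 * E ^ M) \<le> 1 + (?X + 1)"
    by (simp add: ac_simps flip: one_add_one)
  then have X: "ennreal (exp 1 * E ^ M) \<le> ?X + 1"
    by (simp only: ennreal_add_left_cancel_le) auto
  \<comment> \<open>\<open>2 \<le> M\<close> puts \<open>?x\<close> into the range where
    \<open>ln (1 - x) \<ge> - x - 2 * x^2\<close>; multiplied by \<open>M\<close>, the right side
    becomes \<open>- 1 - 2 / M\<close>.\<close>
  let ?x = "1 / real M"
  have x: "0 < ?x" "?x \<le> 1 / 2" using M by (auto simp: field_simps)
  have "1 - 2 / M \<le> exp (- 2 / M)" using exp_ge_add_one_self[of "- 2 / M"] by simp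
  also have "\<dots> \<le> exp (1 + M * ln (1 - ?x))"
  proof -
    have "- ?x - 2 * ?x^2 \<le> ln (1 - ?x)"
      using ln_one_minus_pos_lower_bound[of ?x] x by simp
    then have "M * (- ?x - 2 * ?x^2) \<le> M * ln (1 - ?x)" by (intro mult_left_mono) auto
    moreover have "M * (- ?x - 2 * ?x^2) = - 1 - 2 / M"
      using M by (simp add: field_simps power2_eq_square)
    ultimately show ?thesis by simp
  qed
  also have "\<dots> = exp 1 * (1 - ?x) ^ M"
    using x by (simp add: exp_add exp_of_nat_mult)
  finally have 1: "1 - 2 / M \<le> exp 1 * (1 - ?x) ^ M" .
  have "(1 - 2 / M) * (1 + M * \<rho>) \<le> exp 1 * (1 - ?x) ^ M * (1 + \<rho>) ^ M"
    using 1 x R(2) M Bernoulli_inequality[of \<rho> M] by (intro mult_mono) auto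
  also have "\<dots> = exp 1 * ((1 - ?x) * (1 + \<rho>)) ^ M" by (simp add: power_mult_distrib)
  also have "\<dots> \<le> exp 1 * E ^ M"
  proof (intro mult_left_mono power_mono)
    show "(1 - ?x) * (1 + \<rho>) \<le> E"
    proof -
      have "(1 - ?x) * (1 + \<rho>) = 1 - ?x + \<rho> - ?x * \<rho>" by (simp only: algebra_simps mult_1_right)
      moreover have "0 \<le> ?x * \<rho>" using R(2) x by (intro mult_nonneg_nonneg) auto
      ultimately show ?thesis unfolding \<rho>_def by linarith
    qed
  qed (use x R(2) in auto)
  finally have "ennreal ((1 - 2 / M) * (1 + M * \<rho>)) \<le> ennreal (exp 1 * E ^ M)" by (rule ennreal_leI)
  also note X
  finally show ?thesis using R(2) M
    by (simp add: R(1) ennreal_mult ennreal_of_nat_eq_real_of_nat)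
qed

section \<open>Product measures and relative entropy\<close>

lemma PiM_density:
  fixes f :: "'i \<Rightarrow> 'a \<Rightarrow> ennreal"
  assumes I: "finite I" and A: "prob_space A"
    and f: "\<And>i. i \<in> I \<Longrightarrow> f i \<in> borel_measurable A"
    and p: "\<And>i. i \<in> I \<Longrightarrow> prob_space (density A (f i))"
  shows "Pi\<^sub>M I (\<lambda>i. density A (f i)) = density (Pi\<^sub>M I (\<lambda>_. A)) (\<lambda>x. \<Prod>i\<in>I. f i (x i))"
proof -
  interpret A: prob_space A by fact
  interpret PA: product_sigma_finite "\<lambda>_. A" ..
  \<comment> \<open>The locale of product measures wants a sigma-finite measure at every index, also
    outside \<open>I\<close>; there the density is set to 1.\<close>
  define g where "g i = (if i \<in> I then f i else (\<lambda>_. 1))" for i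
  have g [measurable]: "g i \<in> borel_measurable A" for i using f by (simp add: g_def)
  have gp: "prob_space (density A (g i))" for i
    using p by (auto simp: g_def density_1 A)
  interpret D: product_sigma_finite "\<lambda>i. density A (g i)"
    using gp by (simp add: product_sigma_finite_def prob_space_imp_sigma_finite)
  have "density (Pi\<^sub>M I (\<lambda>_. A)) (\<lambda>x. \<Prod>i\<in>I. g i (x i)) = Pi\<^sub>M I (\<lambda>i. density A (g i))"
  proof (rule D.PiM_eqI[OF I])
    show "sets (density (Pi\<^sub>M I (\<lambda>_. A)) (\<lambda>x. \<Prod>i\<in>I. g i (x i))) = sets (Pi\<^sub>M I (\<lambda>i. density A (g i)))"
      by (simp cong: sets_PiM_cong)
    fix X assume X: "\<And>i. i \<in> I \<Longrightarrow> X i \<in> sets (density A (g i))"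
    then have [measurable]: "Pi\<^sub>E I X \<in> sets (Pi\<^sub>M I (\<lambda>_. A))"
      using I by (intro sets_PiM_I_finite) auto
    have "emeasure (density (Pi\<^sub>M I (\<lambda>_. A)) (\<lambda>x. \<Prod>i\<in>I. g i (x i))) (Pi\<^sub>E I X) =
        (\<integral>\<^sup>+x. (\<Prod>i\<in>I. g i (x i)) * indicator (Pi\<^sub>E I X) x \<partial>Pi\<^sub>M I (\<lambda>_. A))"
      using I by (intro emeasure_density) measurable
    also have "\<dots> = (\<integral>\<^sup>+x. (\<Prod>i\<in>I. g i (x i) * indicator (X i) (x i)) \<partial>Pi\<^sub>M I (\<lambda>_. A))"
    proof (intro nn_integral_cong)
      fix x assume "x \<in> space (Pi\<^sub>M I (\<lambda>_. A))"
      then have "x \<in> extensional I" by (auto simp: space_PiM PiE_def)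
      then have "indicator (Pi\<^sub>E I X) x = (\<Prod>i\<in>I. indicator (X i) (x i) :: ennreal)"
        using I by (auto simp: indicator_def PiE_def Pi_def prod_zero_iff intro!: prod.neutral[symmetric])
      then show "(\<Prod>i\<in>I. g i (x i)) * indicator (Pi\<^sub>E I X) x = (\<Prod>i\<in>I. g i (x i) * indicator (X i) (x i))"
        by (simp add: prod.distrib)
    qed
    also have "\<dots> = (\<Prod>i\<in>I. \<integral>\<^sup>+x. g i x * indicator (X i) x \<partial>A)"
      using I X by (intro PA.product_nn_integral_prod) auto
    also have "\<dots> = (\<Prod>i\<in>I. emeasure (density A (g i)) (X i))"
      using X by (intro prod.cong) (auto simp: emeasure_density)
    finally show "emeasure (density (Pi\<^sub>M I (\<lambda>_. A)) (\<lambda>x. \<Prod>i\<in>I. g i (x i))) (Pi\<^sub>E I X) =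
      (\<Prod>i\<in>I. emeasure (density A (g i)) (X i))" .
  qed
  moreover have "Pi\<^sub>M I (\<lambda>i. density A (g i)) = Pi\<^sub>M I (\<lambda>i. density A (f i))"
    by (intro PiM_cong) (auto simp: g_def)
  moreover have "(\<Prod>i\<in>I. g i (x i)) = (\<Prod>i\<in>I. f i (x i))" for x
    by (intro prod.cong) (auto simp: g_def)
  ultimately show ?thesis by simp
qed

text \<open>A codeword and an output word are integrated as two sequences, whereas the random walk
  takes one i.i.d. pair of letters per step; this is the translation.\<close>

lemma distr_PiM_zip:
  assumes I: "finite I" and A: "prob_space A" and B: "prob_space B"
  shows "distr (Pi\<^sub>M I (\<lambda>_. A) \<Otimes>\<^sub>M Pi\<^sub>M I (\<lambda>_. B)) (Pi\<^sub>M I (\<lambda>_. A \<Otimes>\<^sub>M B))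
      (\<lambda>(x, y). \<lambda>i\<in>I. (x i, y i)) = Pi\<^sub>M I (\<lambda>_. A \<Otimes>\<^sub>M B)"
proof -
  interpret A: prob_space A by fact
  interpret B: prob_space B by fact
  interpret AB: pair_prob_space A B ..
  interpret PA: product_prob_space "\<lambda>_. A" I ..
  interpret PB: product_prob_space "\<lambda>_. B" I ..
  interpret PAB: product_prob_space "\<lambda>_. A \<Otimes>\<^sub>M B" I ..
  let ?zip = "\<lambda>(x, y). \<lambda>i\<in>I. (x i, y i)"
  have zip [measurable]: "?zip \<in> measurable (Pi\<^sub>M I (\<lambda>_. A) \<Otimes>\<^sub>M Pi\<^sub>M I (\<lambda>_. B)) (Pi\<^sub>M I (\<lambda>_. A \<Otimes>\<^sub>M B))"
    unfolding case_prod_beta by (intro measurable_restrict) measurable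
  show ?thesis
  proof (rule PAB.PiM_eqI[OF I])
    fix X assume X: "\<And>i. i \<in> I \<Longrightarrow> X i \<in> sets (A \<Otimes>\<^sub>M B)"
    then have PX [measurable]: "Pi\<^sub>E I X \<in> sets (Pi\<^sub>M I (\<lambda>_. A \<Otimes>\<^sub>M B))"
      using I by (intro sets_PiM_I_finite) auto
    have ind: "indicator (Pi\<^sub>E I X) (\<lambda>i\<in>I. (x i, y i)) = (\<Prod>i\<in>I. indicator (X i) (x i, y i) :: ennreal)" for x y
      using I by (auto simp: indicator_def PiE_def Pi_def prod_zero_iff intro!: prod.neutral[symmetric])
    have "emeasure (distr (Pi\<^sub>M I (\<lambda>_. A) \<Otimes>\<^sub>M Pi\<^sub>M I (\<lambda>_. B)) (Pi\<^sub>M I (\<lambda>_. A \<Otimes>\<^sub>M B)) ?zip) (Pi\<^sub>E I X) =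
        (\<integral>\<^sup>+z. indicator (Pi\<^sub>E I X) z \<partial>distr (Pi\<^sub>M I (\<lambda>_. A) \<Otimes>\<^sub>M Pi\<^sub>M I (\<lambda>_. B)) (Pi\<^sub>M I (\<lambda>_. A \<Otimes>\<^sub>M B)) ?zip)"
      by simp
    also have "\<dots> = (\<integral>\<^sup>+z. indicator (Pi\<^sub>E I X) (?zip z) \<partial>(Pi\<^sub>M I (\<lambda>_. A) \<Otimes>\<^sub>M Pi\<^sub>M I (\<lambda>_. B)))"
      by (intro nn_integral_distr) measurable
    also have "\<dots> = (\<integral>\<^sup>+x. \<integral>\<^sup>+y. indicator (Pi\<^sub>E I X) (?zip (x, y)) \<partial>Pi\<^sub>M I (\<lambda>_. B) \<partial>Pi\<^sub>M I (\<lambda>_. A))"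
      by (intro PB.P.nn_integral_fst[symmetric]) measurable
    also have "\<dots> = (\<integral>\<^sup>+x. \<integral>\<^sup>+y. (\<Prod>i\<in>I. indicator (X i) (x i, y i)) \<partial>Pi\<^sub>M I (\<lambda>_. B) \<partial>Pi\<^sub>M I (\<lambda>_. A))"
      by (simp add: ind)
    also have "\<dots> = (\<integral>\<^sup>+x. (\<Prod>i\<in>I. \<integral>\<^sup>+y. indicator (X i) (x i, y) \<partial>B) \<partial>Pi\<^sub>M I (\<lambda>_. A))"
    proof (intro nn_integral_cong PB.product_nn_integral_prod[OF I])
      fix x i assume "x \<in> space (Pi\<^sub>M I (\<lambda>_. A))" "i \<in> I"
      then have [measurable]: "x i \<in> space A" "X i \<in> sets (A \<Otimes>\<^sub>M B)" using X by (auto simp: space_PiM)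
      show "(\<lambda>y. indicator (X i) (x i, y) :: ennreal) \<in> borel_measurable B" by measurable
    qed
    also have "\<dots> = (\<Prod>i\<in>I. \<integral>\<^sup>+x. \<integral>\<^sup>+y. indicator (X i) (x, y) \<partial>B \<partial>A)"
      using X by (intro PA.product_nn_integral_prod[OF I] B.borel_measurable_nn_integral_fst) auto
    also have "\<dots> = (\<Prod>i\<in>I. emeasure (A \<Otimes>\<^sub>M B) (X i))"
      using X by (intro prod.cong refl) (simp add: B.nn_integral_fst)
    finally show "emeasure (distr (Pi\<^sub>M I (\<lambda>_. A) \<Otimes>\<^sub>M Pi\<^sub>M I (\<lambda>_. B)) (Pi\<^sub>M I (\<lambda>_. A \<Otimes>\<^sub>M B)) ?zip) (Pi\<^sub>E I X) =
        (\<Prod>i\<in>I. emeasure (A \<Otimes>\<^sub>M B) (X i))" .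
  qed simp
qed

text \<open>\<open>ent_fun L\<close> and \<open>L * ln L\<close> differ by the integrable function
  \<open>1 - L\<close> of mean 0, so one is integrable if and only if the other is. Since
  \<open>ent_fun L\<close> is nonnegative, its failure to be integrable means an infinite integral,
  in agreement with the value \<open>\<infinity>\<close> in \<open>rel_entropy\<close>.\<close>

lemma rel_entropy_density:
  fixes L :: "'a \<Rightarrow> real"
  assumes Q: "prob_space Q" and L [measurable]: "L \<in> borel_measurable Q"
    and nonneg: "\<And>x. 0 \<le> L x" and int: "(\<integral>\<^sup>+x. L x \<partial>Q) = 1"
  shows "rel_entropy (density Q L) Q = (\<integral>\<^sup>+x. ent_fun (L x) \<partial>Q)"
proof -
  interpret Q: prob_space Q by fact
  have iL: "integrable Q L" "(\<integral>x. L x \<partial>Q) = 1"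
    using int nonneg by (auto simp: integrable_iff_bounded integral_eq_nn_integral)
  have ac: "absolutely_continuous Q (density Q L)"
    by (rule absolutely_continuousI_density) measurable
  have "AE x in Q. ennreal (L x) = RN_deriv Q (density Q L) x"
    by (rule Q.RN_deriv_unique) auto
  then have ed: "AE x in Q. entropy_density (exp 1) Q (density Q L) x = ln (L x)"
    by eventually_elim (metis comp_apply enn2real_ennreal entropy_density_def exp_gt_zero ln_exp log_def div_by_1 nonneg)
  have eq: "integrable (density Q L) (entropy_density (exp 1) Q (density Q L)) \<longleftrightarrow>
      integrable Q (\<lambda>x. L x * ln (L x))"
  proof -
    have "integrable (density Q L) (entropy_density (exp 1) Q (density Q L)) \<longleftrightarrow>
        integrable Q (\<lambda>x. L x * entropy_density (exp 1) Q (density Q L) x)"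
      using nonneg by (subst integrable_real_density) auto
    also have "\<dots> \<longleftrightarrow> integrable Q (\<lambda>x. L x * ln (L x))"
      using ed by (intro integrable_cong_AE) auto
    finally show ?thesis .
  qed
  have KL: "KL_divergence (exp 1) Q (density Q L) = (\<integral>x. L x * ln (L x) \<partial>Q)"
    using nonneg by (subst Q.KL_density) (auto simp: log_def)
  show ?thesis
  proof (cases "integrable Q (\<lambda>x. L x * ln (L x))")
    case True
    then have "integrable Q (\<lambda>x. ent_fun (L x))" "(\<integral>x. ent_fun (L x) \<partial>Q) = (\<integral>x. L x * ln (L x) \<partial>Q)"
      using iL by (auto simp: ent_fun_def Q.prob_space)
    then show ?thesis
      using True ac eq KL by (simp add: rel_entropy_def nn_integral_eq_integral ent_fun_nonneg nonneg)
  next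
    case False
    have "(\<integral>\<^sup>+x. ent_fun (L x) \<partial>Q) = \<infinity>"
    proof (rule ccontr)
      assume "(\<integral>\<^sup>+x. ent_fun (L x) \<partial>Q) \<noteq> \<infinity>"
      then have "integrable Q (\<lambda>x. ent_fun (L x))"
        by (auto simp: integrable_iff_bounded ent_fun_nonneg nonneg top.not_eq_extremum)
      then have "integrable Q (\<lambda>x. ent_fun (L x) + L x - 1)" using iL by auto
      then show False using False by (simp add: ent_fun_def)
    qed
    then show ?thesis using False eq by (simp add: rel_entropy_def)
  qed
qed

section \<open>Reduction to a random walk\<close>

text \<open>A single real-valued density \<open>w\<close> of the joint law serves in both
  directions: by \<open>regular_version\<close> its sections in \<open>y\<close> are channel
  densities, and its sections in \<open>x\<close> have mean 1, which is the normalisation that soft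
  covering needs at a fixed output.\<close>

lemma channel_density:
  fixes PX :: "'a measure" and MY :: "'b measure" and K :: "'a \<Rightarrow> 'b measure"
  assumes PX: "prob_space PX" and K: "K \<in> PX \<rightarrow>\<^sub>M prob_algebra MY"
    and ac: "absolutely_continuous (product_law PX MY K) (joint_law PX MY K)"
    and version: "regular_version PX MY K"
  obtains w where "w \<in> borel_measurable (PX \<Otimes>\<^sub>M output_law PX MY K)" "\<And>z. 0 \<le> w z"
    "joint_law PX MY K = density (PX \<Otimes>\<^sub>M output_law PX MY K) w"
    "AE x in PX. K x = density (output_law PX MY K) (\<lambda>y. ennreal (w (x, y)))"
    "AE y in output_law PX MY K. (\<integral>\<^sup>+x. w (x, y) \<partial>PX) = 1"
    "\<And>z. info_density PX MY K z = ln (w z)"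
    "prob_space (output_law PX MY K)" "sets (output_law PX MY K) = sets MY"
proof -
  interpret prob_space PX by fact
  define Q where "Q = output_law PX MY K"
  define J where "J = joint_law PX MY K"
  define f where "f = RN_deriv (PX \<Otimes>\<^sub>M Q) J"
  define w where "w z = enn2real (f z)" for z
  have sJ: "sets J = sets (PX \<Otimes>\<^sub>M MY)"
    unfolding J_def using PX K by (rule sets_joint_law)
  have sQ [measurable_cong]: "sets Q = sets MY"
    by (simp add: Q_def output_law_def)
  interpret J: prob_space J unfolding J_def using PX K by (rule prob_space_joint_law)
  have snd_meas: "snd \<in> J \<rightarrow>\<^sub>M MY"
    unfolding measurable_cong_sets[OF sJ refl] by simp
  then interpret Q: prob_space Q
    unfolding Q_def J_def output_law_def by (intro prob_space.prob_space_distr prob_space_joint_law PX K)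
  interpret PQ: pair_prob_space PX Q ..
  interpret QP: pair_prob_space Q PX ..
  have pl: "product_law PX MY K = PX \<Otimes>\<^sub>M Q"
    by (simp add: product_law_def Q_def)
  have sPQ: "sets (PX \<Otimes>\<^sub>M Q) = sets (PX \<Otimes>\<^sub>M MY)"
    by (intro sets_pair_measure_cong refl sQ)
  have acJ: "absolutely_continuous (PX \<Otimes>\<^sub>M Q) J" using ac by (simp add: pl J_def)
  have f [measurable]: "f \<in> borel_measurable (PX \<Otimes>\<^sub>M Q)"
    by (simp add: f_def)
  have w [measurable]: "w \<in> borel_measurable (PX \<Otimes>\<^sub>M Q)" unfolding w_def by measurable
  have "AE z in PX \<Otimes>\<^sub>M Q. f z \<noteq> \<infinity>" unfolding f_def
    by (intro PQ.RN_deriv_finite acJ) (auto simp: sJ sPQ J.sigma_finite_measure_axioms)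
  then have fw: "AE z in PX \<Otimes>\<^sub>M Q. f z = ennreal (w z)"
    by eventually_elim (simp add: w_def less_top)
  have J: "J = density (PX \<Otimes>\<^sub>M Q) w"
  proof -
    have "J = density (PX \<Otimes>\<^sub>M Q) f"
      using PQ.density_RN_deriv[of J] acJ sJ sPQ by (simp add: f_def)
    also have "\<dots> = density (PX \<Otimes>\<^sub>M Q) w" using fw by (intro density_cong) auto
    finally show ?thesis .
  qed
  have "AE x in PX. AE y in Q. f (x, y) = ennreal (w (x, y))"
    using PQ.AE_pair[OF fw] .
  moreover have "AE x in PX. K x = density Q (\<lambda>y. f (x, y))"
    using version by (simp add: regular_version_def Q_def J_def f_def product_law_def)
  ultimately have Kw: "AE x in PX. K x = density Q (\<lambda>y. ennreal (w (x, y)))"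
    using AE_space
  proof eventually_elim
    case (elim x)
    then show ?case by (auto intro!: density_cong)
  qed
  \<comment> \<open>Integrating out the input must return the output marginal, so \<open>g\<close>
    is a density of \<open>Q\<close> with respect to itself and equals 1 almost everywhere.\<close>
  define g where "g y = (\<integral>\<^sup>+x. ennreal (w (x, y)) \<partial>PX)" for y
  have g [measurable]: "g \<in> borel_measurable Q" unfolding g_def by measurable
  have "density Q g = density Q (\<lambda>_. 1)"
  proof (rule measure_eqI)
    fix B assume "B \<in> sets (density Q g)"
    then have B [measurable]: "B \<in> sets Q" "B \<in> sets MY" using sQ by auto
    have "emeasure (density Q (\<lambda>_. 1)) B = emeasure Q B" by (simp add: density_1)
    also have "\<dots> = emeasure J (snd -` B \<inter> space J)"
      using snd_meas B by (simp add: Q_def J_def output_law_def emeasure_distr)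
    also have "\<dots> = (\<integral>\<^sup>+z. indicator (snd -` B \<inter> space J) z \<partial>J)"
      using measurable_sets[OF snd_meas B(2)] by simp
    also have "\<dots> = (\<integral>\<^sup>+z. indicator B (snd z) \<partial>J)"
      by (intro nn_integral_cong) (auto simp: indicator_def)
    also have "\<dots> = (\<integral>\<^sup>+z. ennreal (w z) * indicator B (snd z) \<partial>(PX \<Otimes>\<^sub>M Q))"
      unfolding J by (subst nn_integral_density) auto
    also have "\<dots> = (\<integral>\<^sup>+y. \<integral>\<^sup>+x. ennreal (w (x, y)) * indicator B y \<partial>PX \<partial>Q)"
      by (subst PQ.nn_integral_snd[symmetric]) auto
    also have "\<dots> = (\<integral>\<^sup>+y. g y * indicator B y \<partial>Q)"
      unfolding g_def by (intro nn_integral_cong nn_integral_multc) measurable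
    also have "\<dots> = emeasure (density Q g) B" by (subst emeasure_density) auto
    finally show "emeasure (density Q g) B = emeasure (density Q (\<lambda>_. 1)) B" by simp
  qed simp
  then have "AE y in Q. g y = 1" by (subst (asm) Q.density_unique_iff) auto
  then have g1: "AE y in Q. (\<integral>\<^sup>+x. ennreal (w (x, y)) \<partial>PX) = 1" by (simp add: g_def)
  have i: "info_density PX MY K z = ln (w z)" for z
    by (simp add: Q_def J_def w_def f_def info_density_def product_law_def entropy_density_def log_def)
  show ?thesis
    by (rule that[of w]; (fold Q_def J_def)?)
       (use w J Kw sQ Q.prob_space_axioms g1 i in \<open>auto simp: w_def\<close>)
qed

lemma nn_integral_PiM_prod_eq_1:
  assumes "prob_space A" "finite I" and w: "\<And>i. i \<in> I \<Longrightarrow> w i \<in> borel_measurable A"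
    and "\<And>i x. 0 \<le> w i x" and "\<And>i. i \<in> I \<Longrightarrow> (\<integral>\<^sup>+x. ennreal (w i x) \<partial>A) = 1"
  shows "(\<integral>\<^sup>+x. ennreal (\<Prod>i\<in>I. w i (x i)) \<partial>Pi\<^sub>M I (\<lambda>_. A)) = 1"
proof -
  interpret A: prob_space A by fact
  interpret PA: product_sigma_finite "\<lambda>_. A" ..
  have "(\<integral>\<^sup>+x. ennreal (\<Prod>i\<in>I. w i (x i)) \<partial>Pi\<^sub>M I (\<lambda>_. A)) =
      (\<integral>\<^sup>+x. (\<Prod>i\<in>I. ennreal (w i (x i))) \<partial>Pi\<^sub>M I (\<lambda>_. A))"
    using assms(4) by (simp add: prod_ennreal)
  also have "\<dots> = (\<Prod>i\<in>I. \<integral>\<^sup>+x. ennreal (w i x) \<partial>A)"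
    using assms by (intro PA.product_nn_integral_prod) auto
  also have "\<dots> = 1" using assms(5) by simp
  finally show ?thesis .
qed

text \<open>The exceptional inputs form a null set and a codebook has finitely many letters, so
  almost every codebook avoids them altogether. For such a codebook the induced output law has the
  averaged product density, and \<open>rel_entropy_density\<close> applies.\<close>

lemma expected_divergence_eq:
  fixes PX :: "'a measure" and MY :: "'b measure" and K :: "'a \<Rightarrow> 'b measure" and w :: "'a \<times> 'b \<Rightarrow> real"
  assumes PX: "prob_space PX" and Q: "prob_space Q" and Q_eq: "Q = output_law PX MY K"
    and sQ: "sets Q = sets MY"
    and w [measurable]: "w \<in> borel_measurable (PX \<Otimes>\<^sub>M Q)" and nonneg: "\<And>z. 0 \<le> w z"
    and Kw: "AE x in PX. K x = density Q (\<lambda>y. ennreal (w (x, y)))"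
    and Kp: "\<And>x. x \<in> space PX \<Longrightarrow> prob_space (K x)"
    and M: "M = num_codewords R n" "0 < M"
  shows "expected_divergence PX MY K R n =
    (\<integral>\<^sup>+c. \<integral>\<^sup>+y. ent_fun ((\<Sum>k<M. \<Prod>i<n. w (c k i, y i)) / M) \<partial>iid_law n Q \<partial>codebook_law M n PX)"
proof -
  interpret PX: prob_space PX by fact
  interpret Q: prob_space Q by fact
  interpret PXn: product_prob_space "\<lambda>_. PX" "{..<n}" ..
  interpret Qn: product_prob_space "\<lambda>_. Q" "{..<n}" ..
  interpret C: product_prob_space "\<lambda>_. Pi\<^sub>M {..<n} (\<lambda>_. PX)" "{..<M}" ..
  have "AE x in Pi\<^sub>M {..<n} (\<lambda>_. PX). \<forall>i\<in>{..<n}. K (x i) = density Q (\<lambda>y. ennreal (w (x i, y)))"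
    by (intro AE_finite_allI AE_PiM_component Kw) (auto simp: PX)
  then have "AE c in codebook_law M n PX. \<forall>k\<in>{..<M}. \<forall>i\<in>{..<n}.
      K (c k i) = density Q (\<lambda>y. ennreal (w (c k i, y)))"
    unfolding codebook_law_def iid_law_def
    by (intro AE_finite_allI AE_PiM_component[where P = "\<lambda>x. \<forall>i\<in>{..<n}. K (x i) = density Q (\<lambda>y. ennreal (w (x i, y)))"])
       (auto intro: PXn.prob_space_axioms)
  then have "AE c in codebook_law M n PX.
      rel_entropy (induced_output M n MY K c) (iid_law n (output_law PX MY K)) =
      (\<integral>\<^sup>+y. ent_fun ((\<Sum>k<M. \<Prod>i<n. w (c k i, y i)) / M) \<partial>iid_law n Q)"
    using AE_space
  proof eventually_elim
    case (elim c)
    have cs: "c k i \<in> space PX" if "k < M" "i < n" for k i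
      using elim(2) that by (auto simp: codebook_law_def iid_law_def space_PiM PiE_def Pi_def)
    then have [measurable]: "(\<lambda>y. w (c k i, y)) \<in> borel_measurable Q" if "k < M" "i < n" for k i
      using that by measurable
    have Kc: "K (c k i) = density Q (\<lambda>y. ennreal (w (c k i, y)))" if "k < M" "i < n" for k i
      using elim(1) that by auto
    have pc: "prob_space (density Q (\<lambda>y. ennreal (w (c k i, y))))" if "k < M" "i < n" for k i
      using Kp[OF cs[OF that]] Kc[OF that] by simp
    have int1: "(\<integral>\<^sup>+y. ennreal (w (c k i, y)) \<partial>Q) = 1" if "k < M" "i < n" for k i
      using prob_space.emeasure_space_1[OF pc[OF that]] that
      by (simp add: emeasure_density cong: nn_integral_cong)
    define L where "L y = (\<Sum>k<M. \<Prod>i<n. w (c k i, y i)) / M" for y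
    have yi [measurable]: "(\<lambda>y. y i) \<in> measurable (iid_law n Q) Q" if "i < n" for i
      unfolding iid_law_def using that by (intro measurable_component_singleton) auto
    have [measurable]: "(\<lambda>y. w (c k i, y i)) \<in> borel_measurable (iid_law n Q)" if "k < M" "i < n" for k i
      using that by measurable
    have Lm [measurable]: "L \<in> borel_measurable (iid_law n Q)" unfolding L_def by measurable
    have Lnn: "0 \<le> L y" for y unfolding L_def by (auto intro!: divide_nonneg_nonneg sum_nonneg prod_nonneg nonneg)
    have Lsum: "ennreal (L y) = (\<Sum>k<M. ennreal (\<Prod>i<n. w (c k i, y i))) / of_nat M" for y
      unfolding L_def using M(2) nonneg
      by (simp add: sum_ennreal prod_nonneg ennreal_of_nat_eq_real_of_nat divide_ennreal sum_nonneg)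
    have mem: "memoryless n K (c k) = density (iid_law n Q) (\<lambda>y. ennreal (\<Prod>i<n. w (c k i, y i)))" if "k < M" for k
    proof -
      have "memoryless n K (c k) = Pi\<^sub>M {..<n} (\<lambda>i. density Q (\<lambda>y. ennreal (w (c k i, y))))"
        unfolding memoryless_def using Kc[OF that] by (intro PiM_cong) auto
      also have "\<dots> = density (Pi\<^sub>M {..<n} (\<lambda>_. Q)) (\<lambda>y. \<Prod>i<n. ennreal (w (c k i, y i)))"
        using that pc by (intro PiM_density Q) auto
      finally show ?thesis by (simp add: iid_law_def prod_ennreal nonneg)
    qed
    have sQn: "sets (iid_law n Q) = sets (iid_law n MY)"
      unfolding iid_law_def by (intro sets_PiM_cong) (auto simp: sQ)
    have sK: "sets (K (c k i)) = sets MY" if "k < M" "i < n" for k i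
      using Kc[OF that] sQ by simp
    have "induced_output M n MY K c = density (iid_law n Q) L"
    proof (rule measure_eqI)
      show "sets (induced_output M n MY K c) = sets (density (iid_law n Q) L)"
        by (simp add: induced_output_def sQn sets.sigma_sets_eq sets.space_closed)
      fix A assume "A \<in> sets (induced_output M n MY K c)"
      then have A: "A \<in> sets (iid_law n MY)"
        by (simp add: induced_output_def sets.sigma_sets_eq sets.space_closed)
      then have A' [measurable]: "A \<in> sets (iid_law n Q)" by (simp add: sQn)
      have "emeasure (induced_output M n MY K c) A = (\<Sum>k<M. emeasure (memoryless n K (c k)) A) / of_nat M"
        using sK A by (intro emeasure_induced_output) auto
      also have "\<dots> = (\<Sum>k<M. \<integral>\<^sup>+y. ennreal (\<Prod>i<n. w (c k i, y i)) * indicator A y \<partial>iid_law n Q) / of_nat M"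
        by (intro arg_cong2[where f = "(/)"] sum.cong) (auto simp: mem emeasure_density)
      also have "\<dots> = (\<integral>\<^sup>+y. (\<Sum>k<M. ennreal (\<Prod>i<n. w (c k i, y i)) * indicator A y) \<partial>iid_law n Q) / of_nat M"
        by (subst nn_integral_sum) auto
      also have "\<dots> = (\<integral>\<^sup>+y. (\<Sum>k<M. ennreal (\<Prod>i<n. w (c k i, y i)) * indicator A y) / of_nat M \<partial>iid_law n Q)"
        unfolding divide_ennreal_def by (intro nn_integral_multc[symmetric]) auto
      also have "\<dots> = (\<integral>\<^sup>+y. ennreal (L y) * indicator A y \<partial>iid_law n Q)"
        by (intro nn_integral_cong) (auto simp: Lsum lessThan_def split: split_indicator)
      also have "\<dots> = emeasure (density (iid_law n Q) L) A" by (subst emeasure_density) auto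
      finally show "emeasure (induced_output M n MY K c) A = emeasure (density (iid_law n Q) L) A" .
    qed
    moreover have "(\<integral>\<^sup>+y. ennreal (L y) \<partial>iid_law n Q) = 1"
    proof -
      have "(\<integral>\<^sup>+y. ennreal (L y) \<partial>iid_law n Q) =
          (\<Sum>k<M. \<integral>\<^sup>+y. ennreal (\<Prod>i<n. w (c k i, y i)) \<partial>iid_law n Q) / of_nat M"
      proof -
        have "(\<integral>\<^sup>+y. (\<Sum>k<M. ennreal (\<Prod>i<n. w (c k i, y i))) \<partial>iid_law n Q) =
            (\<Sum>k<M. \<integral>\<^sup>+y. ennreal (\<Prod>i<n. w (c k i, y i)) \<partial>iid_law n Q)"
          by (intro nn_integral_sum) auto
        then show ?thesis
          unfolding Lsum divide_ennreal_def by (subst nn_integral_multc) auto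
      qed
      also have "\<dots> = (\<Sum>k<M. 1) / of_nat M"
        unfolding iid_law_def
        by (intro arg_cong2[where f = "(/)"] sum.cong refl nn_integral_PiM_prod_eq_1 Q) (auto simp: int1 nonneg)
      also have "\<dots> = 1" using M(2) by (simp add: ennreal_of_nat_eq_real_of_nat divide_ennreal)
      finally show ?thesis .
    qed
    ultimately show ?case
      using rel_entropy_density[of "iid_law n Q" L] Lm Lnn Qn.prob_space_axioms
      by (simp add: L_def[symmetric] iid_law_def Q_eq[symmetric])
  qed
  then show ?thesis
    unfolding expected_divergence_def M(1)[symmetric] by (rule nn_integral_cong_AE)
qed

text \<open>After exchanging the integrals the output \<open>y\<close> is fixed and the ratios
  \<open>W (c k) y\<close> are i.i.d. over the codebook with mean 1, so both soft covering bounds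
  apply for almost every \<open>y\<close>. Each bound carries one factor \<open>W x y\<close>, which
  is then absorbed as the density of the joint law.\<close>

lemma expected_divergence_bounds:
  fixes PX :: "'a measure" and MY :: "'b measure" and K :: "'a \<Rightarrow> 'b measure"
  assumes PX: "prob_space PX" and K: "K \<in> PX \<rightarrow>\<^sub>M prob_algebra MY"
    and ac: "absolutely_continuous (product_law PX MY K) (joint_law PX MY K)"
    and version: "regular_version PX MY K"
    and M: "M = num_codewords R n" "2 \<le> M"
  defines "a \<equiv> \<lambda>z. exp (\<Sum>i<n. info_density PX MY K (z i)) / M"
  shows "expected_divergence PX MY K R n \<le> (\<integral>\<^sup>+z. ennreal (ln (1 + a z)) \<partial>iid_law n (joint_law PX MY K))"
    and "ennreal (1 - 2 / real M) * (1 + (\<integral>\<^sup>+z. ennreal (min 1 (a z) / 4) \<partial>iid_law n (joint_law PX MY K))) \<le>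
      expected_divergence PX MY K R n + 1"
proof -
  obtain w where w0: "w \<in> borel_measurable (PX \<Otimes>\<^sub>M output_law PX MY K)" and nonneg: "\<And>z. 0 \<le> w z"
    and J: "joint_law PX MY K = density (PX \<Otimes>\<^sub>M output_law PX MY K) w"
    and Kw: "AE x in PX. K x = density (output_law PX MY K) (\<lambda>y. ennreal (w (x, y)))"
    and g1: "AE y in output_law PX MY K. (\<integral>\<^sup>+x. w (x, y) \<partial>PX) = 1"
    and i: "\<And>z. info_density PX MY K z = ln (w z)"
    and Qp: "prob_space (output_law PX MY K)" and sQ: "sets (output_law PX MY K) = sets MY"
    by (rule channel_density[OF PX K ac version]) (rule that; assumption)
  define Q where "Q = output_law PX MY K"
  note [measurable] = w0[folded Q_def]
  interpret PX: prob_space PX by fact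
  interpret Q: prob_space Q using Qp by (simp add: Q_def)
  interpret PXQ: pair_prob_space PX Q ..
  interpret PXn: product_prob_space "\<lambda>_. PX" "{..<n}" ..
  interpret Qn: product_prob_space "\<lambda>_. Q" "{..<n}" ..
  interpret C: product_prob_space "\<lambda>_. Pi\<^sub>M {..<n} (\<lambda>_. PX)" "{..<M}" ..
  let ?A = "Pi\<^sub>M {..<n} (\<lambda>_. PX)" and ?B = "Pi\<^sub>M {..<n} (\<lambda>_. Q)"
  let ?C = "Pi\<^sub>M {..<M} (\<lambda>_. ?A)" and ?J = "joint_law PX MY K"
  interpret CB: pair_sigma_finite ?C ?B ..
  interpret AB: pair_prob_space ?A ?B ..
  have Kp: "prob_space (K x)" if "x \<in> space PX" for x
    using measurable_space[OF K that] by (simp add: space_prob_algebra)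
  define W where "W x y = (\<Prod>i<n. w (x i, y i))" for x y
  have Wnn: "0 \<le> W x y" for x y unfolding W_def by (intro prod_nonneg) (simp add: nonneg)
  have wi [measurable]: "(\<lambda>z. w (fst z i, snd z i)) \<in> borel_measurable (?A \<Otimes>\<^sub>M ?B)" if "i < n" for i
  proof -
    have "(\<lambda>z. (fst z i, snd z i)) \<in> measurable (?A \<Otimes>\<^sub>M ?B) (PX \<Otimes>\<^sub>M Q)"
      using that by (intro measurable_Pair measurable_compose[OF measurable_fst] measurable_compose[OF measurable_snd]
        measurable_component_singleton) auto
    then show ?thesis by (rule measurable_compose) measurable
  qed
  have W [measurable]: "(\<lambda>z. W (fst z) (snd z)) \<in> borel_measurable (?A \<Otimes>\<^sub>M ?B)"
    unfolding W_def by measurable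
  have Wx: "(\<lambda>x. W x y) \<in> borel_measurable ?A" if "y \<in> space ?B" for y
    using measurable_compose[OF measurable_Pair2'[OF that] W] by simp
  have Wk [measurable]: "(\<lambda>z. W (fst z k) (snd z)) \<in> borel_measurable (?C \<Otimes>\<^sub>M ?B)" if "k < M" for k
  proof -
    have "(\<lambda>z. (fst z k, snd z)) \<in> measurable (?C \<Otimes>\<^sub>M ?B) (?A \<Otimes>\<^sub>M ?B)"
      using that by (intro measurable_Pair measurable_compose[OF measurable_fst] measurable_snd
        measurable_component_singleton) auto
    from measurable_compose[OF this W] show ?thesis by simp
  qed
  have "expected_divergence PX MY K R n =
      (\<integral>\<^sup>+c. \<integral>\<^sup>+y. ent_fun ((\<Sum>k<M. W (c k) y) / M) \<partial>?B \<partial>?C)"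
    unfolding W_def
    using expected_divergence_eq[OF PX Q.prob_space_axioms Q_def sQ[folded Q_def] w0[folded Q_def] nonneg
        Kw[folded Q_def] Kp M(1)] M(2)
    by (simp add: iid_law_def codebook_law_def)
  also have "\<dots> = (\<integral>\<^sup>+y. \<integral>\<^sup>+c. ent_fun ((\<Sum>k<M. W (c k) y) / M) \<partial>?C \<partial>?B)"
  proof -
    have "(\<lambda>z. ennreal (ent_fun ((\<Sum>k<M. W (fst z k) (snd z)) / M))) \<in> borel_measurable (?C \<Otimes>\<^sub>M ?B)"
      by measurable
    then show ?thesis using CB.Fubini[where f = "\<lambda>z. ennreal (ent_fun ((\<Sum>k<M. W (fst z k) (snd z)) / M))"]
      by simp
  qed
  finally have ED: "expected_divergence PX MY K R n =
      (\<integral>\<^sup>+y. \<integral>\<^sup>+c. ent_fun ((\<Sum>k<M. W (c k) y) / M) \<partial>?C \<partial>?B)" .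
  have "AE y in ?B. \<forall>i\<in>{..<n}. (\<integral>\<^sup>+x. w (x, y i) \<partial>PX) = 1"
    by (intro AE_finite_allI AE_PiM_component[where P = "\<lambda>y. (\<integral>\<^sup>+x. w (x, y) \<partial>PX) = 1"])
       (use g1[folded Q_def] Q.prob_space_axioms in auto)
  then have W1: "AE y in ?B. y \<in> space ?B \<and> (\<integral>\<^sup>+x. W x y \<partial>?A) = 1"
    using AE_space
  proof eventually_elim
    case (elim y)
    have "(\<lambda>x. w (x, y i)) \<in> borel_measurable PX" if "i < n" for i
    proof -
      have "y i \<in> space Q" using elim(2) that by (auto simp: space_PiM PiE_def Pi_def)
      then show ?thesis by measurable
    qed
    then have "(\<integral>\<^sup>+x. W x y \<partial>?A) = 1"
      unfolding W_def using elim(1) by (intro nn_integral_PiM_prod_eq_1 PX) (auto simp: nonneg)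
    then show ?case using elim by simp
  qed
  \<comment> \<open>Change of measure: the factor \<open>W\<close> turns the product of input and
    output laws into the i.i.d. joint law.\<close>
  have transfer: "(\<integral>\<^sup>+y. \<integral>\<^sup>+x. ennreal (W x y * F (W x y / M)) \<partial>?A \<partial>?B) = (\<integral>\<^sup>+z. F (a z) \<partial>iid_law n ?J)"
    if [measurable]: "F \<in> borel_measurable borel" and F: "\<And>x. 0 \<le> x \<Longrightarrow> 0 \<le> F x" for F :: "real \<Rightarrow> real"
  proof -
    let ?AB = "Pi\<^sub>M {..<n} (\<lambda>_. PX \<Otimes>\<^sub>M Q)"
    define V where "V z = (\<Prod>i<n. w (z i))" for z
    have Vnn: "0 \<le> V z" for z unfolding V_def by (intro prod_nonneg) (simp add: nonneg)
    have [measurable]: "(\<lambda>z. z i) \<in> measurable ?AB (PX \<Otimes>\<^sub>M Q)" if "i < n" for i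
      using that by (intro measurable_component_singleton) auto
    have V [measurable]: "V \<in> borel_measurable ?AB" unfolding V_def by measurable
    have zip [measurable]: "(\<lambda>(x, y). \<lambda>i\<in>{..<n}. (x i, y i)) \<in> measurable (?A \<Otimes>\<^sub>M ?B) ?AB"
      unfolding case_prod_beta by (intro measurable_restrict) measurable
    have "(\<integral>\<^sup>+y. \<integral>\<^sup>+x. ennreal (W x y * F (W x y / M)) \<partial>?A \<partial>?B) =
        (\<integral>\<^sup>+z. ennreal (W (fst z) (snd z) * F (W (fst z) (snd z) / M)) \<partial>(?A \<Otimes>\<^sub>M ?B))"
      by (subst AB.nn_integral_snd[symmetric]) auto
    also have "\<dots> = (\<integral>\<^sup>+z. ennreal (V z * F (V z / M)) \<partial>distr (?A \<Otimes>\<^sub>M ?B) ?AB (\<lambda>(x, y). \<lambda>i\<in>{..<n}. (x i, y i)))"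
      by (subst nn_integral_distr) (auto simp: V_def W_def case_prod_beta)
    also have "\<dots> = (\<integral>\<^sup>+z. ennreal (V z * F (V z / M)) \<partial>?AB)"
      by (simp add: distr_PiM_zip PX Q.prob_space_axioms)
    also have "\<dots> = (\<integral>\<^sup>+z. ennreal (F (V z / M)) \<partial>density ?AB V)"
      by (subst nn_integral_density) (auto simp: ennreal_mult Vnn F)
    also have "density ?AB V = iid_law n ?J"
    proof -
      have "density ?AB (\<lambda>z. \<Prod>i<n. ennreal (w (z i))) = Pi\<^sub>M {..<n} (\<lambda>_. density (PX \<Otimes>\<^sub>M Q) w)"
        using prob_space_joint_law[OF PX K, unfolded J[folded Q_def]]
        by (intro PiM_density[symmetric]) (auto intro: PXQ.prob_space_axioms)
      then show ?thesis by (simp add: J[folded Q_def] iid_law_def prod_ennreal nonneg V_def)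
    qed
    also have "(\<integral>\<^sup>+z. ennreal (F (V z / M)) \<partial>iid_law n ?J) = (\<integral>\<^sup>+z. F (a z) \<partial>iid_law n ?J)"
    proof (rule nn_integral_cong_AE)
      \<comment> \<open>As \<open>ln 0 = 0\<close>, \<open>exp\<close> of the information density is
        1 instead of \<open>w z\<close> where \<open>w\<close> vanishes. These points are null for
        the joint law.\<close>
      have "AE z in ?J. 0 < w z"
        unfolding J[folded Q_def] by (subst AE_density) (use nonneg in \<open>auto simp: less_le\<close>)
      then have "AE z in iid_law n ?J. \<forall>i\<in>{..<n}. 0 < w (z i)"
        unfolding iid_law_def using prob_space_joint_law[OF PX K]
        by (intro AE_finite_allI AE_PiM_component) auto
      then show "AE z in iid_law n ?J. ennreal (F (V z / M)) = F (a z)"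
        by eventually_elim (simp add: a_def i V_def exp_sum)
    qed
    finally show ?thesis .
  qed
  have "expected_divergence PX MY K R n \<le>
      (\<integral>\<^sup>+y. \<integral>\<^sup>+x. W x y * ln (1 + W x y / M) \<partial>?A \<partial>?B)"
    unfolding ED
  proof (rule nn_integral_mono_AE)
    show "AE y in ?B. (\<integral>\<^sup>+c. ent_fun ((\<Sum>k<M. W (c k) y) / M) \<partial>?C) \<le> (\<integral>\<^sup>+x. W x y * ln (1 + W x y / M) \<partial>?A)"
      using W1
    proof eventually_elim
      case (elim y)
      then show ?case using M(2) Wnn Wx by (intro soft_covering_upper PXn.prob_space_axioms) auto
    qed
  qed
  also have "\<dots> = (\<integral>\<^sup>+z. ennreal (ln (1 + a z)) \<partial>iid_law n ?J)"
    by (intro transfer) auto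
  finally show "expected_divergence PX MY K R n \<le> (\<integral>\<^sup>+z. ennreal (ln (1 + a z)) \<partial>iid_law n ?J)" .
  have mp: "0 < real M" using M(2) by simp
  have "(\<integral>\<^sup>+z. ennreal (min 1 (a z) / 4) \<partial>iid_law n ?J) =
      (\<integral>\<^sup>+y. \<integral>\<^sup>+x. ennreal (W x y * (min 1 (W x y / M) / 4)) \<partial>?A \<partial>?B)"
    by (intro transfer[symmetric]) auto
  also have "\<dots> \<le> (\<integral>\<^sup>+y. M * (\<integral>\<^sup>+x. exp_rem (W x y / M) \<partial>?A) \<partial>?B)"
  proof (rule nn_integral_mono)
    fix y assume y: "y \<in> space ?B"
    have "(\<integral>\<^sup>+x. ennreal (W x y * (min 1 (W x y / M) / 4)) \<partial>?A) \<le> (\<integral>\<^sup>+x. M * ennreal (exp_rem (W x y / M)) \<partial>?A)"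
    proof (intro nn_integral_mono)
      fix x
      have "M * (W x y / M * min 1 (W x y / M) / 4) \<le> M * exp_rem (W x y / M)"
        using mp Wnn by (intro mult_left_mono exp_rem_ge) auto
      then have "W x y * (min 1 (W x y / M) / 4) \<le> M * exp_rem (W x y / M)"
        using mp by simp
      then have "ennreal (W x y * (min 1 (W x y / M) / 4)) \<le> ennreal (M * exp_rem (W x y / M))"
        by (rule ennreal_leI)
      then show "ennreal (W x y * (min 1 (W x y / M) / 4)) \<le> M * ennreal (exp_rem (W x y / M))"
        by (simp add: ennreal_mult exp_rem_nonneg ennreal_of_nat_eq_real_of_nat)
    qed
    also have "\<dots> = M * (\<integral>\<^sup>+x. exp_rem (W x y / M) \<partial>?A)"
    proof -
      note [measurable] = Wx[OF y]
      show ?thesis by (intro nn_integral_cmult) measurable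
    qed
    finally show "(\<integral>\<^sup>+x. ennreal (W x y * (min 1 (W x y / M) / 4)) \<partial>?A) \<le> M * (\<integral>\<^sup>+x. exp_rem (W x y / M) \<partial>?A)" .
  qed
  finally have le: "(\<integral>\<^sup>+z. ennreal (min 1 (a z) / 4) \<partial>iid_law n ?J) \<le>
      (\<integral>\<^sup>+y. M * (\<integral>\<^sup>+x. exp_rem (W x y / M) \<partial>?A) \<partial>?B)" .
  have em [measurable]: "(\<lambda>y. \<integral>\<^sup>+x. exp_rem (W x y / M) \<partial>?A) \<in> borel_measurable ?B"
  proof -
    have [measurable]: "(\<lambda>z. W (snd z) (fst z)) \<in> borel_measurable (?B \<Otimes>\<^sub>M ?A)"
      using measurable_compose[OF measurable_pair_swap' W] by (simp add: case_prod_beta)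
    have "(\<lambda>z. ennreal (exp_rem (W (snd z) (fst z) / M))) \<in> borel_measurable (?B \<Otimes>\<^sub>M ?A)"
      by measurable
    from PXn.P.borel_measurable_nn_integral_fst[OF this] show ?thesis by simp
  qed
  have "ennreal (1 - 2 / real M) * (1 + (\<integral>\<^sup>+z. ennreal (min 1 (a z) / 4) \<partial>iid_law n ?J)) \<le>
      ennreal (1 - 2 / real M) * (1 + (\<integral>\<^sup>+y. M * (\<integral>\<^sup>+x. exp_rem (W x y / M) \<partial>?A) \<partial>?B))"
    by (intro mult_left_mono add_left_mono le) auto
  also have "\<dots> = (\<integral>\<^sup>+y. ennreal (1 - 2 / real M) * (1 + M * (\<integral>\<^sup>+x. exp_rem (W x y / M) \<partial>?A)) \<partial>?B)"
    by (simp add: nn_integral_cmult nn_integral_add Qn.emeasure_space_1)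
  also have "\<dots> \<le> (\<integral>\<^sup>+y. (\<integral>\<^sup>+c. ent_fun ((\<Sum>k<M. W (c k) y) / M) \<partial>?C) + 1 \<partial>?B)"
  proof (rule nn_integral_mono_AE)
    show "AE y in ?B. ennreal (1 - 2 / real M) * (1 + M * (\<integral>\<^sup>+x. exp_rem (W x y / M) \<partial>?A)) \<le>
        (\<integral>\<^sup>+c. ent_fun ((\<Sum>k<M. W (c k) y) / M) \<partial>?C) + 1"
      using W1
    proof eventually_elim
      case (elim y)
      then show ?case using M(2) Wnn Wx by (intro soft_covering_lower PXn.prob_space_axioms) auto
    qed
  qed
  also have "\<dots> = expected_divergence PX MY K R n + 1"
  proof -
    have "(\<lambda>z. ennreal (ent_fun ((\<Sum>k<M. W (fst z k) (snd z)) / M))) \<in> borel_measurable (?C \<Otimes>\<^sub>M ?B)"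
      by measurable
    from measurable_compose[OF measurable_pair_swap' this]
    have "(\<lambda>z. ennreal (ent_fun ((\<Sum>k<M. W (snd z k) (fst z)) / M))) \<in> borel_measurable (?B \<Otimes>\<^sub>M ?C)"
      by (simp add: case_prod_beta)
    from C.P.borel_measurable_nn_integral_fst[OF this]
    have "(\<lambda>y. \<integral>\<^sup>+c. ent_fun ((\<Sum>k<M. W (c k) y) / M) \<partial>?C) \<in> borel_measurable ?B" by simp
    then show ?thesis unfolding ED by (subst nn_integral_add) (auto simp: Qn.emeasure_space_1)
  qed
  finally show "ennreal (1 - 2 / real M) * (1 + (\<integral>\<^sup>+z. ennreal (min 1 (a z) / 4) \<partial>iid_law n ?J)) \<le>
      expected_divergence PX MY K R n + 1" .
qed

section \<open>The Fejer kernel and the local limit estimate\<close>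

text \<open>The square of \<open>sin (x / 2) / (x / 2)\<close>, continued by 1 at 0: the Fourier
  transform of the triangle function on [-1, 1].\<close>

definition fejer :: "real \<Rightarrow> real" where
  "fejer x = (if x = 0 then 1 else 2 * (1 - cos x) / x\<^sup>2)"

lemma fejer_measurable [measurable]: "fejer \<in> borel_measurable borel"
  unfolding fejer_def[abs_def] by measurable

lemma fejer_nonneg: "0 \<le> fejer x"
  by (simp add: fejer_def)

lemma one_minus_cos_le: "2 * (1 - cos x) \<le> (x::real)\<^sup>2"
proof -
  have "2 * (1 - cos x) = 4 * (sin (x / 2))\<^sup>2" using cos_double_sin[of "x / 2"] by simp
  also have "\<dots> \<le> 4 * (x / 2)\<^sup>2"
    using power_mono[OF abs_sin_x_le_abs_x[of "x / 2"] abs_ge_zero, of 2] by (intro mult_left_mono) (auto simp: power_divide)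
  finally show ?thesis by (simp add: power2_eq_square)
qed

lemma fejer_le_1: "fejer x \<le> 1"
  using one_minus_cos_le[of x] by (simp add: fejer_def field_simps)

lemma fejer_le:
  fixes x :: real
  shows "x \<noteq> 0 \<Longrightarrow> fejer x \<le> 4 / x\<^sup>2"
proof -
  have "2 * (1 - cos x) \<le> 4" by (smt (verit) cos_ge_minus_one)
  then show "x \<noteq> 0 \<Longrightarrow> fejer x \<le> 4 / x\<^sup>2" unfolding fejer_def by (simp add: divide_right_mono del: cos_ge_minus_one)
qed

text \<open>The kernel vanishes at the nonzero multiples of \<open>2 * pi\<close>, but a shift by
  \<open>pi\<close> changes \<open>1 - cos x\<close> into \<open>1 + cos x\<close>, so the two
  numerators add up to 4. Both denominators are at most \<open>20 * (1 + x^2)\<close>, where 20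
  exceeds \<open>2 * pi^2\<close>; this leaves \<open>4 / 20 = 1 / 5\<close>.\<close>

lemma fejer_shift_ge: "1 / (1 + x\<^sup>2) \<le> 5 * (fejer x + fejer (x - pi))"
proof -
  have 1: "2 * (1 - cos y) / (20 * (1 + x\<^sup>2)) \<le> fejer y" if "y\<^sup>2 \<le> 20 * (1 + x\<^sup>2)" for y
  proof (cases "y = 0")
    case False
    then show ?thesis unfolding fejer_def using that
      by (auto intro!: divide_left_mono mult_pos_pos add_pos_nonneg)
  qed (simp add: fejer_def)
  have "x\<^sup>2 \<le> 20 * (1 + x\<^sup>2)" by simp
  note a = 1[OF this]
  have "(x - pi)\<^sup>2 \<le> 20 * (1 + x\<^sup>2)"
  proof -
    have "(x - pi)\<^sup>2 \<le> 2 * x\<^sup>2 + 2 * pi\<^sup>2"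
      using zero_le_power2[of "x + pi"] by (simp add: power2_eq_square algebra_simps)
    moreover have "pi\<^sup>2 \<le> 3.15\<^sup>2" using pi_approx by (intro power_mono) auto
    moreover have "0 \<le> x * x" by simp
    ultimately show ?thesis by (simp add: power2_eq_square del: zero_le_square)
  qed
  note b = 1[OF this]
  have "2 * (1 - cos x) / (20 * (1 + x\<^sup>2)) + 2 * (1 - cos (x - pi)) / (20 * (1 + x\<^sup>2)) = 1 / (5 * (1 + x\<^sup>2))"
  proof -
    have "2 * (1 - c) / (20 * D) + 2 * (1 + c) / (20 * D) = 1 / (5 * D)" if "D \<noteq> 0" for c D :: real
      using that by (simp add: field_simps)
    from this[of "1 + x\<^sup>2" "cos x"] show ?thesis
      using add_pos_nonneg[of 1 "x\<^sup>2"] by (simp add: cos_diff)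
  qed
  moreover have "1 / (5 * (1 + x\<^sup>2)) = 1 / (1 + x\<^sup>2) / 5" by simp
  moreover have "t \<le> 5 * (p + q)" if "u + v = t / 5" "u \<le> p" "v \<le> q" for t p q u v :: real
    using that by argo
  ultimately show ?thesis using a b by metis
qed

lemma fejer_integral:
  "(\<integral>v. indicator {0..1} v * ((1 - v) * cos (x * v)) \<partial>lborel) = fejer x / 2"
proof (cases "x = 0")
  case True
  have "(\<integral>v. (1 - v) * indicator {0..1} v \<partial>lborel) = (1 - 1\<^sup>2 / 2) - (0 - 0\<^sup>2 / 2 :: real)"
    by (rule integral_FTC_Icc_real) (auto intro!: derivative_eq_intros)
  then show ?thesis using True by (simp add: fejer_def mult.commute)
next
  case False
  define G where "G v = (1 - v) * sin (x * v) / x - cos (x * v) / x\<^sup>2" for v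
  have "(\<integral>v. (1 - v) * cos (x * v) * indicator {0..1} v \<partial>lborel) = G 1 - G 0"
    unfolding G_def using False
    by (intro integral_FTC_Icc_real)
       (auto intro!: derivative_eq_intros continuous_intros simp: power2_eq_square field_simps)
  also have "\<dots> = fejer x / 2" using False by (simp add: G_def fejer_def diff_divide_distrib)
  finally show ?thesis by (simp add: ac_simps)
qed

lemma gaussian_integral:
  assumes "0 < \<sigma>"
  shows "integrable lborel (\<lambda>x. exp (- x\<^sup>2 / (2 * \<sigma>\<^sup>2)))"
    and "(\<integral>x. exp (- x\<^sup>2 / (2 * \<sigma>\<^sup>2)) \<partial>lborel) = sqrt (2 * pi) * \<sigma>"
proof -
  have eq: "exp (- x\<^sup>2 / (2 * \<sigma>\<^sup>2)) = sqrt (2 * pi) * \<sigma> * normal_density 0 \<sigma> x" for x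
    using assms by (simp add: normal_density_def real_sqrt_mult)
  show "integrable lborel (\<lambda>x. exp (- x\<^sup>2 / (2 * \<sigma>\<^sup>2)))"
    unfolding eq using assms by (intro integrable_mult_right integrable_normal_density)
  show "(\<integral>x. exp (- x\<^sup>2 / (2 * \<sigma>\<^sup>2)) \<partial>lborel) = sqrt (2 * pi) * \<sigma>"
    unfolding eq using assms by (simp add: integral_normal_density)
qed

section \<open>Random walks and their characteristic functions\<close>

locale iid_walk = prob_space N for N :: "'a measure" +
  fixes Z :: "'a \<Rightarrow> real"
  assumes Z [measurable]: "Z \<in> borel_measurable N"
begin

definition walk :: "nat \<Rightarrow> (nat \<Rightarrow> 'a) \<Rightarrow> real" where
  "walk n x = (\<Sum>i<n. Z (x i))"

definition chf :: "real \<Rightarrow> complex" where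
  "chf v = char (distr N borel Z) v"

abbreviation law :: "nat \<Rightarrow> (nat \<Rightarrow> 'a) measure" where
  "law n \<equiv> Pi\<^sub>M {..<n} (\<lambda>_. N)"

lemma prob_space_law: "prob_space (law n)"
  by (intro prob_space_PiM prob_space_axioms)

lemma walk_measurable [measurable]: "walk n \<in> borel_measurable (law n)"
proof -
  have [measurable]: "(\<lambda>x. x i) \<in> measurable (law n) N" if "i < n" for i
    using that by (intro measurable_component_singleton) auto
  show ?thesis unfolding walk_def by measurable
qed

lemma real_distribution_Z: "real_distribution (distr N borel Z)"
  by (rule real_distribution_distr) simp

lemma norm_chf_le_1: "cmod (chf v) \<le> 1"
  unfolding chf_def by (rule real_distribution.cmod_char_le_1[OF real_distribution_Z])

lemma chf_measurable [measurable]: "chf \<in> borel_measurable borel"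
  unfolding chf_def by (rule real_distribution.char_measurable[OF real_distribution_Z])

lemma chf_walk: "(\<integral>x. iexp (v * walk n x) \<partial>law n) = chf v ^ n"
proof -
  interpret P: product_sigma_finite "\<lambda>_. N" ..
  have "(\<integral>x. iexp (v * walk n x) \<partial>law n) = (\<integral>x. (\<Prod>i<n. iexp (v * Z (x i))) \<partial>law n)"
    by (simp add: walk_def sum_distrib_left sum_distrib_right exp_sum)
  also have "\<dots> = (\<Prod>i<n. \<integral>x. iexp (v * Z x) \<partial>N)"
    by (intro P.product_integral_prod integrable_const_bound[of _ 1]) auto
  also have "(\<integral>x. iexp (v * Z x) \<partial>N) = chf v"
    unfolding chf_def char_def by (subst integral_distr) auto
  finally show ?thesis by simp
qed

lemma expectation_cos_walk: "(\<integral>x. cos (v * (walk n x - s)) \<partial>law n) = Re (iexp (- v * s) * chf v ^ n)"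
proof -
  interpret L: prob_space "law n" by (rule prob_space_law)
  have i: "integrable (law n) (\<lambda>x. iexp (v * walk n x))"
    by (intro L.integrable_const_bound[of _ 1]) auto
  have "iexp (- v * s) * chf v ^ n = (\<integral>x. iexp (- v * s) * iexp (v * walk n x) \<partial>law n)"
    unfolding chf_walk[symmetric] by (rule integral_mult_right_zero[symmetric])
  also have "Re \<dots> = (\<integral>x. Re (iexp (- v * s) * iexp (v * walk n x)) \<partial>law n)"
    using i by (intro integral_Re[symmetric] integrable_mult_right)
  also have "\<dots> = (\<integral>x. cos (v * (walk n x - s)) \<partial>law n)"
  proof (intro Bochner_Integration.integral_cong refl)
    fix x
    have "iexp (- v * s) * iexp (v * walk n x) = iexp (v * (walk n x - s))"
      by (simp add: algebra_simps flip: exp_add)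
    then show "Re (iexp (- v * s) * iexp (v * walk n x)) = cos (v * (walk n x - s))"
      by (simp add: Re_exp)
  qed
  finally show ?thesis by simp
qed

text \<open>Only frequencies between 0 and \<open>d\<close> enter. Hence estimates of
  \<open>chf\<close> near 0 suffice, and the larger frequencies, at which a lattice step can have
  modulus 1, never occur.\<close>

lemma expectation_fejer_walk:
  "(\<integral>x. fejer (d * (walk n x - s)) \<partial>law n) =
    2 * (\<integral>v. indicator {0..1} v * ((1 - v) * Re (iexp (- (d * v) * s) * chf (d * v) ^ n)) \<partial>lborel)"
proof -
  interpret L: prob_space "law n" by (rule prob_space_law)
  interpret P: pair_sigma_finite "law n" lborel ..
  let ?f = "\<lambda>x v. indicator {0..1} v * ((1 - v) * cos (d * (walk n x - s) * v)) :: real"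
  have int: "integrable (law n \<Otimes>\<^sub>M lborel) (\<lambda>(x, v). ?f x v)"
  proof (rule Bochner_Integration.integrable_bound)
    have "integrable (law n \<Otimes>\<^sub>M lborel) (indicator (space (law n) \<times> {0..1::real}) :: _ \<Rightarrow> real)"
      by (intro integrable_real_indicator pair_measureI)
         (auto simp: lborel.emeasure_pair_measure_Times L.emeasure_space_1)
    then show "integrable (law n \<Otimes>\<^sub>M lborel) (\<lambda>z. indicator (space (law n) \<times> {0..1::real}) z :: real)" .
    show "AE z in law n \<Otimes>\<^sub>M lborel. norm (case z of (x, v) \<Rightarrow> ?f x v) \<le>
        norm (indicator (space (law n) \<times> {0..1::real}) z :: real)"
    proof (rule AE_I2)
      fix z :: "(nat \<Rightarrow> 'a) \<times> real" assume "z \<in> space (law n \<Otimes>\<^sub>M lborel)"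
      then have "fst z \<in> space (law n)" by (auto simp: space_pair_measure)
      moreover have "\<bar>(1 - v) * cos y\<bar> \<le> 1" if "v \<in> {0..1}" for v y :: real
        using that mult_mono[of "\<bar>1 - v\<bar>" 1 "\<bar>cos y\<bar>" 1] by (simp add: abs_mult)
      ultimately show "norm (case z of (x, v) \<Rightarrow> ?f x v) \<le> norm (indicator (space (law n) \<times> {0..1::real}) z :: real)"
        by (auto simp: indicator_def split: prod.split)
    qed
  qed measurable
  have "(\<integral>x. fejer (d * (walk n x - s)) \<partial>law n) = (\<integral>x. 2 * (\<integral>v. ?f x v \<partial>lborel) \<partial>law n)"
    by (simp only: fejer_integral) simp
  also have "\<dots> = 2 * (\<integral>x. (\<integral>v. ?f x v \<partial>lborel) \<partial>law n)" by simp
  also have "(\<integral>x. (\<integral>v. ?f x v \<partial>lborel) \<partial>law n) = (\<integral>v. (\<integral>x. ?f x v \<partial>law n) \<partial>lborel)"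
    by (rule P.Fubini_integral[OF int, symmetric])
  also have "\<dots> = (\<integral>v. indicator {0..1} v * ((1 - v) * Re (iexp (- (d * v) * s) * chf (d * v) ^ n)) \<partial>lborel)"
  proof (intro Bochner_Integration.integral_cong refl)
    fix v
    have "(\<integral>x. ?f x v \<partial>law n) = indicator {0..1} v * ((1 - v) * (\<integral>x. cos ((d * v) * (walk n x - s)) \<partial>law n))"
      by (simp add: ac_simps)
    then show "(\<integral>x. ?f x v \<partial>law n) = indicator {0..1} v * ((1 - v) * Re (iexp (- (d * v) * s) * chf (d * v) ^ n))"
      by (simp only: expectation_cos_walk)
  qed
  finally show ?thesis .
qed

end

section \<open>Centred steps of finite variance\<close>

locale centered_walk = iid_walk +
  assumes square_integrable: "integrable N (\<lambda>x. (Z x)\<^sup>2)"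
    and mean_zero: "(\<integral>x. Z x \<partial>N) = 0"
    and nondegenerate: "0 < (\<integral>x. (Z x)\<^sup>2 \<partial>N)"
begin

definition var :: real where "var = (\<integral>x. (Z x)\<^sup>2 \<partial>N)"

text \<open>The Taylor remainder of the characteristic function under a second moment alone: the
  minimum of a quadratic and a cubic bound is dominated by the former and tends to 0 by the
  latter.\<close>

definition rem :: "real \<Rightarrow> real" where
  "rem v = (\<integral>x. min (6 * (Z x)\<^sup>2) (\<bar>v\<bar> * \<bar>Z x\<bar> ^ 3) \<partial>N)"

lemma var_pos: "0 < var" using nondegenerate by (simp add: var_def)

lemma chf_approx: "cmod (chf v - (1 - v\<^sup>2 * var / 2)) \<le> v\<^sup>2 / 6 * rem v"
proof -
  have "integrable N Z"
    by (rule square_integrable_imp_integrable[OF Z square_integrable])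
  then show ?thesis
    unfolding chf_def rem_def
    by (intro char_approx3'[OF Z _ square_integrable mean_zero _ refl]) (auto simp: mean_zero var_def)
qed

lemma rem_tendsto_0:
  assumes "v \<longlonglongrightarrow> 0"
  shows "(\<lambda>k. rem (v k)) \<longlonglongrightarrow> 0"
proof -
  have "(\<lambda>k. rem (v k)) \<longlonglongrightarrow> (\<integral>x. 0 \<partial>N)"
    unfolding rem_def
  proof (rule integral_dominated_convergence[where w = "\<lambda>x. 6 * (Z x)\<^sup>2"])
    show "AE x in N. (\<lambda>k. min (6 * (Z x)\<^sup>2) (\<bar>v k\<bar> * \<bar>Z x\<bar> ^ 3)) \<longlonglongrightarrow> 0"
    proof (rule AE_I2)
      fix x
      have "(\<lambda>k. min (6 * (Z x)\<^sup>2) (\<bar>v k\<bar> * \<bar>Z x\<bar> ^ 3)) \<longlonglongrightarrow> min (6 * (Z x)\<^sup>2) (\<bar>0\<bar> * \<bar>Z x\<bar> ^ 3)"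
        by (intro tendsto_intros assms)
      then show "(\<lambda>k. min (6 * (Z x)\<^sup>2) (\<bar>v k\<bar> * \<bar>Z x\<bar> ^ 3)) \<longlonglongrightarrow> 0" by (simp add: min_absorb2)
    qed
  qed (use square_integrable in auto)
  then show ?thesis by simp
qed

lemma rem_mono: "\<bar>u\<bar> \<le> \<bar>v\<bar> \<Longrightarrow> rem u \<le> rem v"
proof -
  assume uv: "\<bar>u\<bar> \<le> \<bar>v\<bar>"
  have "integrable N (\<lambda>x. min (6 * (Z x)\<^sup>2) (\<bar>v\<bar> * \<bar>Z x\<bar> ^ 3))" for v
    by (rule Bochner_Integration.integrable_bound[where f = "\<lambda>x. 6 * (Z x)\<^sup>2"])
       (use square_integrable in auto)
  then show ?thesis
    unfolding rem_def using uv
    by (intro integral_mono min.mono mult_right_mono) auto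
qed

text \<open>Near 0 the remainder uses up at most half of the quadratic term
  \<open>v^2 * var / 2\<close>, which leaves \<open>1 - v^2 * var / 4\<close>.\<close>

lemma chf_gaussian_bound:
  obtains \<delta> where "0 < \<delta>" "\<And>v. \<bar>v\<bar> \<le> \<delta> \<Longrightarrow> cmod (chf v) \<le> exp (- (var / 4) * v\<^sup>2)"
proof -
  have "(\<lambda>k. rem (1 / real (Suc k))) \<longlonglongrightarrow> 0"
    by (intro rem_tendsto_0 LIMSEQ_Suc[OF lim_inverse_n'])
  then have "\<forall>\<^sub>F k in sequentially. rem (1 / real (Suc k)) < 3 / 2 * var"
    using var_pos by (intro order_tendstoD) auto
  then obtain k where k: "rem (1 / real (Suc k)) < 3 / 2 * var"
    by (auto simp: eventually_sequentially)
  \<comment> \<open>The first bound makes the remainder at most \<open>v^2 * var / 4\<close>; the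
    second keeps \<open>1 - v^2 * var / 2\<close> nonnegative, hence equal to its modulus.\<close>
  define \<delta> where "\<delta> = min (1 / real (Suc k)) (1 / sqrt var)"
  show ?thesis
  proof (rule that[of \<delta>])
    show "0 < \<delta>" using var_pos by (simp add: \<delta>_def)
    fix v assume v: "\<bar>v\<bar> \<le> \<delta>"
    have "\<bar>v\<bar> * sqrt var \<le> 1"
      using v var_pos by (simp add: \<delta>_def field_simps)
    then have "(\<bar>v\<bar> * sqrt var)\<^sup>2 \<le> 1\<^sup>2" using var_pos by (intro power_mono) auto
    then have 1: "v\<^sup>2 * var \<le> 1" using var_pos by (simp add: power_mult_distrib)
    have "rem v \<le> 3 / 2 * var"
      using rem_mono[of v "1 / real (Suc k)"] v k by (simp add: \<delta>_def)
    then have "v\<^sup>2 / 6 * rem v \<le> v\<^sup>2 / 6 * (3 / 2 * var)" by (intro mult_left_mono) auto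
    then have 2: "cmod (chf v - (1 - v\<^sup>2 * var / 2)) \<le> v\<^sup>2 * var / 4"
      by (intro order_trans[OF chf_approx[of v]]) (simp add: mult.commute)
    have "cmod (chf v) \<le> cmod (chf v - of_real (1 - v\<^sup>2 * var / 2)) + cmod (of_real (1 - v\<^sup>2 * var / 2))"
      by (metis diff_add_cancel norm_triangle_ineq)
    also have "cmod (of_real (1 - v\<^sup>2 * var / 2)) = 1 - v\<^sup>2 * var / 2"
      using 1 by (simp only: norm_of_real abs_of_nonneg)
    also have "cmod (chf v - of_real (1 - v\<^sup>2 * var / 2)) \<le> v\<^sup>2 * var / 4" using 2 by simp
    finally have "cmod (chf v) \<le> 1 + (- (var / 4) * v\<^sup>2)" by (simp add: algebra_simps)
    also have "\<dots> \<le> exp (- (var / 4) * v\<^sup>2)" by (rule exp_ge_add_one_self)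
    finally show "cmod (chf v) \<le> exp (- (var / 4) * v\<^sup>2)" .
  qed
qed

text \<open>The central limit theorem at one frequency. For numbers of modulus at most 1,
  \<open>n\<close>-th powers differ by at most \<open>n\<close> times the difference of the bases,
  and here that is \<open>u^2 / 6 * rem (t n)\<close>, which tends to 0.\<close>

lemma chf_power_tendsto:
  "(\<lambda>n. chf (u / sqrt (real n)) ^ n) \<longlonglongrightarrow> of_real (exp (- (var * u\<^sup>2 / 2)))"
proof -
  define t where "t n = u / sqrt (real n)" for n :: nat
  have t0: "t \<longlonglongrightarrow> 0"
    unfolding t_def
    by (intro tendsto_divide_0[OF tendsto_const] filterlim_at_top_imp_at_infinity
        filterlim_compose[OF sqrt_at_top filterlim_real_sequentially])
  have "(\<lambda>n. u\<^sup>2 / 6 * rem (t n)) \<longlonglongrightarrow> u\<^sup>2 / 6 * 0"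
    by (intro tendsto_intros rem_tendsto_0 t0)
  then have r: "(\<lambda>n. u\<^sup>2 / 6 * rem (t n)) \<longlonglongrightarrow> 0" by simp
  have b: "\<forall>\<^sub>F n in sequentially.
      cmod (chf (t n) ^ n - of_real ((1 + (- (var * u\<^sup>2 / 2)) / real n) ^ n)) \<le> u\<^sup>2 / 6 * rem (t n)"
  proof (rule eventually_sequentiallyI)
    \<comment> \<open>From this \<open>n\<close> on the comparison base
      \<open>1 - var * u^2 / (2 * n)\<close> lies in [0, 1].\<close>
    fix n :: nat assume n: "nat \<lceil>var * u\<^sup>2 / 2\<rceil> + 1 \<le> n"
    then have n0: "0 < n" and n1: "var * u\<^sup>2 / 2 \<le> real n" by linarith+
    have t2: "(t n)\<^sup>2 = u\<^sup>2 / real n" using n0 by (simp add: t_def power_divide)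
    have q: "1 + (- (var * u\<^sup>2 / 2)) / real n = 1 - (t n)\<^sup>2 * var / 2" by (simp add: t2 mult.commute)
    have "0 \<le> var * u\<^sup>2 / 2" using var_pos by simp
    then have q1: "\<bar>1 + (- (var * u\<^sup>2 / 2)) / real n\<bar> \<le> 1"
      using n0 n1 by (simp add: abs_le_iff field_simps)
    have "cmod (chf (t n) ^ n - (of_real (1 + (- (var * u\<^sup>2 / 2)) / real n)) ^ n) \<le>
        n * cmod (chf (t n) - of_real (1 + (- (var * u\<^sup>2 / 2)) / real n))"
      using q1 by (intro norm_power_diff norm_chf_le_1) (simp only: norm_of_real)
    also have "\<dots> \<le> n * ((t n)\<^sup>2 / 6 * rem (t n))"
      unfolding q using chf_approx[of "t n"] by (intro mult_left_mono) auto
    also have "\<dots> = u\<^sup>2 / 6 * rem (t n)" using n0 by (simp add: t2)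
    finally show "cmod (chf (t n) ^ n - of_real ((1 + (- (var * u\<^sup>2 / 2)) / real n) ^ n)) \<le> u\<^sup>2 / 6 * rem (t n)"
      by (simp only: of_real_power)
  qed
  have "(\<lambda>n. complex_of_real ((1 + (- (var * u\<^sup>2 / 2)) / real n) ^ n)) \<longlonglongrightarrow> of_real (exp (- (var * u\<^sup>2 / 2)))"
    by (intro tendsto_of_real tendsto_exp_limit_sequentially)
  from Lim_transform[OF this Lim_null_comparison[OF b r]] show ?thesis by (simp add: t_def)
qed

text \<open>The frequency integral is at most a Gaussian integral of width proportional to
  \<open>1 / (d * sqrt n)\<close>, and the prefactor \<open>d\<close> cancels the scale. Uniformity
  in \<open>d\<close> allows the scale to be shrunk later, uniformity in \<open>s\<close> covers the
  shifted kernel. The bound on \<open>chf\<close> is passed on so that the limit can be taken with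
  the same \<delta>.\<close>

lemma expectation_fejer_le:
  obtains \<delta> A where "0 < \<delta>" "0 < A"
    "\<And>n d s. 0 < n \<Longrightarrow> 0 < d \<Longrightarrow> d \<le> \<delta> \<Longrightarrow> d * (\<integral>x. fejer (d * (walk n x - s)) \<partial>law n) \<le> A / sqrt (real n)"
    "\<And>v. \<bar>v\<bar> \<le> \<delta> \<Longrightarrow> cmod (chf v) \<le> exp (- (var / 4) * v\<^sup>2)"
proof -
  obtain \<delta> where \<delta>: "0 < \<delta>" and bd: "\<And>v. \<bar>v\<bar> \<le> \<delta> \<Longrightarrow> cmod (chf v) \<le> exp (- (var / 4) * v\<^sup>2)"
    using chf_gaussian_bound by blast
  define A where "A = 2 * (sqrt (2 * pi) * sqrt (2 / var))"
  show ?thesis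
  proof (rule that[of \<delta> A])
    show "0 < A" using var_pos by (simp add: A_def)
    fix n :: nat and d s :: real assume n: "0 < n" and d: "0 < d" "d \<le> \<delta>"
    \<comment> \<open>Chosen so that \<open>exp (- v^2 / (2 * \<sigma>^2))\<close> is the
      \<open>n\<close>-th power of the bound on \<open>chf (d * v)\<close>.\<close>
    define \<sigma> where "\<sigma> = sqrt (2 / var) / (d * sqrt (real n))"
    have \<sigma>: "0 < \<sigma>" using n d var_pos by (simp add: \<sigma>_def)
    have \<sigma>2: "1 / (2 * \<sigma>\<^sup>2) = var / 4 * d\<^sup>2 * real n"
      using n d var_pos by (simp add: \<sigma>_def power_mult_distrib power_divide)
    have "(\<integral>v. indicator {0..1} v * ((1 - v) * Re (iexp (- (d * v) * s) * chf (d * v) ^ n)) \<partial>lborel) \<le>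
        (\<integral>v. exp (- v\<^sup>2 / (2 * \<sigma>\<^sup>2)) \<partial>lborel)"
    proof (rule integral_mono')
      show "integrable lborel (\<lambda>v. exp (- v\<^sup>2 / (2 * \<sigma>\<^sup>2)))" by (rule gaussian_integral(1)[OF \<sigma>])
      fix v :: real
      show "0 \<le> exp (- v\<^sup>2 / (2 * \<sigma>\<^sup>2))" by simp
      show "indicator {0..1} v * ((1 - v) * Re (iexp (- (d * v) * s) * chf (d * v) ^ n)) \<le> exp (- v\<^sup>2 / (2 * \<sigma>\<^sup>2))"
      proof (cases "v \<in> {0..1}")
        case True
        have "\<bar>d * v\<bar> \<le> \<delta>" using True d mult_mono[of d \<delta> v 1] by simp
        then have "cmod (chf (d * v)) \<le> exp (- (var / 4) * (d * v)\<^sup>2)" by (rule bd)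
        then have "cmod (chf (d * v)) ^ n \<le> exp (- (var / 4) * (d * v)\<^sup>2) ^ n" by (intro power_mono) auto
        also have "\<dots> = exp (- v\<^sup>2 * (1 / (2 * \<sigma>\<^sup>2)))"
          unfolding \<sigma>2 exp_of_nat_mult[symmetric] by (simp add: power_mult_distrib ac_simps)
        finally have "cmod (iexp (- (d * v) * s) * chf (d * v) ^ n) \<le> exp (- v\<^sup>2 / (2 * \<sigma>\<^sup>2))"
          by (simp add: norm_mult norm_power norm_exp_i_times[of "- (d * v) * s", simplified])
        then have "Re (iexp (- (d * v) * s) * chf (d * v) ^ n) \<le> exp (- v\<^sup>2 / (2 * \<sigma>\<^sup>2))"
          using complex_Re_le_cmod order_trans by blast
        then have "(1 - v) * Re (iexp (- (d * v) * s) * chf (d * v) ^ n) \<le> (1 - v) * exp (- v\<^sup>2 / (2 * \<sigma>\<^sup>2))"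
          using True by (intro mult_left_mono) auto
        also have "\<dots> \<le> 1 * exp (- v\<^sup>2 / (2 * \<sigma>\<^sup>2))" using True by (intro mult_right_mono) auto
        finally show ?thesis using True by simp
      qed simp
    qed
    also have "\<dots> = sqrt (2 * pi) * \<sigma>" by (rule gaussian_integral(2)[OF \<sigma>])
    finally have "(\<integral>x. fejer (d * (walk n x - s)) \<partial>law n) \<le> 2 * (sqrt (2 * pi) * \<sigma>)"
      unfolding expectation_fejer_walk by simp
    then have "d * (\<integral>x. fejer (d * (walk n x - s)) \<partial>law n) \<le> d * (2 * (sqrt (2 * pi) * \<sigma>))"
      using d by (intro mult_left_mono) auto
    also have "\<dots> = A / sqrt (real n)" using d by (simp add: A_def \<sigma>_def)
    finally show "d * (\<integral>x. fejer (d * (walk n x - s)) \<partial>law n) \<le> A / sqrt (real n)" .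
  qed (use \<delta> bd in auto)
qed

text \<open>On the scale \<open>u = \<delta> * sqrt n * v\<close> the frequency integrand converges
  pointwise to a Gaussian, and the bound on \<open>chf\<close> dominates it. The limit is twice a
  Gaussian integral over the half-line and hence positive.\<close>

lemma expectation_fejer_tendsto:
  assumes \<delta>: "0 < \<delta>" and bd: "\<And>v. \<bar>v\<bar> \<le> \<delta> \<Longrightarrow> cmod (chf v) \<le> exp (- (var / 4) * v\<^sup>2)"
  obtains c where "0 < c" "(\<lambda>n. sqrt (real n) * (\<delta> * (\<integral>x. fejer (\<delta> * walk n x) \<partial>law n))) \<longlonglongrightarrow> c"
proof -
  define g where "g n u = indicator {0..\<delta> * sqrt (real n)} u *
      ((1 - u / (\<delta> * sqrt (real n))) * Re (chf (u / sqrt (real n)) ^ n))" for n :: nat and u :: real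
  define h where "h u = indicator {0..} u * exp (- (var * u\<^sup>2 / 2))" for u :: real
  have sq: "filterlim (\<lambda>n. sqrt (real n)) at_top sequentially"
    by (rule filterlim_compose[OF sqrt_at_top filterlim_real_sequentially])
  have eq: "sqrt (real n) * (\<delta> * (\<integral>x. fejer (\<delta> * walk n x) \<partial>law n)) = 2 * (\<integral>u. g n u \<partial>lborel)"
    if n: "0 < n" for n
  proof -
    let ?a = "\<delta> * sqrt (real n)"
    have a: "0 < ?a" using n \<delta> by simp
    have "(\<integral>u. g n u \<partial>lborel) = ?a * (\<integral>v. g n (?a * v) \<partial>lborel)"
    proof -
      have "?a \<noteq> 0" using a by linarith
      from lborel_integral_real_affine[OF this, of "g n" 0] show ?thesis
        using a by (simp only: add_0 abs_of_pos real_scaleR_def)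
    qed
    also have "(\<integral>v. g n (?a * v) \<partial>lborel) =
        (\<integral>v. indicator {0..1} v * ((1 - v) * Re (iexp (- (\<delta> * v) * 0) * chf (\<delta> * v) ^ n)) \<partial>lborel)"
    proof (intro Bochner_Integration.integral_cong refl)
      fix v :: real
      have "?a * v \<in> {0..?a} \<longleftrightarrow> v \<in> {0..1}"
      proof -
        have "b * v \<in> {0..b} \<longleftrightarrow> v \<in> {0..1}" if "0 < b" for b :: real
          using that by (auto simp: zero_le_mult_iff mult_le_cancel_left2)
        from this[OF a] show ?thesis .
      qed
      moreover have "?a * v / ?a = v" "?a * v / sqrt (real n) = \<delta> * v" using a n \<delta> by auto
      ultimately show "g n (?a * v) = indicator {0..1} v * ((1 - v) * Re (iexp (- (\<delta> * v) * 0) * chf (\<delta> * v) ^ n))"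
        unfolding g_def by (simp add: indicator_def)
    qed
    finally show ?thesis using expectation_fejer_walk[where d = \<delta> and n = n and s = 0] by simp
  qed
  have "0 < 1 / sqrt var" using var_pos by simp
  note gi = gaussian_integral[OF this]
  have e: "- u\<^sup>2 / (2 * (1 / sqrt var)\<^sup>2) = - (var * u\<^sup>2 / 2)" for u :: real
    using var_pos by (simp add: power_divide)
  have "0 < sqrt (2 / var)" using var_pos by simp
  note gi2 = gaussian_integral(1)[OF this]
  have e2: "- u\<^sup>2 / (2 * (sqrt (2 / var))\<^sup>2) = - (var / 4) * u\<^sup>2" for u :: real
    using var_pos by simp
  have [measurable]: "g n \<in> borel_measurable lborel" for n unfolding g_def by measurable
  have [measurable]: "h \<in> borel_measurable lborel" unfolding h_def by measurable
  have lim: "(\<lambda>n. \<integral>u. g n u \<partial>lborel) \<longlonglongrightarrow> (\<integral>u. h u \<partial>lborel)"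
  proof (rule integral_dominated_convergence)
    show "integrable lborel (\<lambda>u. exp (- (var / 4) * u\<^sup>2))" using gi2 by (simp only: e2)
    show "AE u in lborel. (\<lambda>n. g n u) \<longlonglongrightarrow> h u"
    proof (rule AE_I2)
      fix u :: real
      have ev: "\<forall>\<^sub>F n in sequentially. u \<le> \<delta> * sqrt (real n)"
      proof -
        have "\<forall>\<^sub>F n in sequentially. u / \<delta> \<le> sqrt (real n)" using sq by (simp add: filterlim_at_top)
        then show ?thesis by eventually_elim (use \<delta> in \<open>simp add: field_simps\<close>)
      qed
      have "(\<lambda>n. indicator {0..} u * ((1 - u / (\<delta> * sqrt (real n))) * Re (chf (u / sqrt (real n)) ^ n)))
          \<longlonglongrightarrow> indicator {0..} u * ((1 - 0) * Re (of_real (exp (- (var * u\<^sup>2 / 2)))))"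
        using \<delta> by (intro tendsto_intros chf_power_tendsto tendsto_divide_0[OF tendsto_const]
            filterlim_at_top_imp_at_infinity filterlim_tendsto_pos_mult_at_top[OF tendsto_const _ sq])
      then have "(\<lambda>n. indicator {0..} u * ((1 - u / (\<delta> * sqrt (real n))) * Re (chf (u / sqrt (real n)) ^ n)))
          \<longlonglongrightarrow> h u" by (simp add: h_def)
      moreover have "\<forall>\<^sub>F n in sequentially.
          indicator {0..} u * ((1 - u / (\<delta> * sqrt (real n))) * Re (chf (u / sqrt (real n)) ^ n)) = g n u"
        using ev by eventually_elim (auto simp: g_def indicator_def)
      ultimately show "(\<lambda>n. g n u) \<longlonglongrightarrow> h u" by (rule Lim_transform_eventually)
    qed
    fix n
    show "AE u in lborel. norm (g n u) \<le> exp (- (var / 4) * u\<^sup>2)"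
    proof (rule AE_I2)
      fix u :: real
      show "norm (g n u) \<le> exp (- (var / 4) * u\<^sup>2)"
      proof (cases "u \<in> {0..\<delta> * sqrt (real n)} \<and> 0 < n")
        case True
        then have n: "0 < sqrt (real n)" and u: "0 \<le> u" "u \<le> \<delta> * sqrt (real n)" by auto
        have "cmod (chf (u / sqrt (real n))) \<le> exp (- (var / 4) * (u / sqrt (real n))\<^sup>2)"
          using n u by (intro bd) (simp add: field_simps)
        then have "cmod (chf (u / sqrt (real n))) ^ n \<le> exp (- (var / 4) * (u / sqrt (real n))\<^sup>2) ^ n"
          by (intro power_mono) auto
        also have "\<dots> = exp (- (var / 4) * u\<^sup>2)"
          using True unfolding exp_of_nat_mult[symmetric] by (simp add: power_divide)
        finally have "\<bar>Re (chf (u / sqrt (real n)) ^ n)\<bar> \<le> exp (- (var / 4) * u\<^sup>2)"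
          using abs_Re_le_cmod[of "chf (u / sqrt (real n)) ^ n"] by (simp add: norm_power)
        moreover have "\<bar>1 - u / (\<delta> * sqrt (real n))\<bar> \<le> 1"
          using n u \<delta> by (simp add: abs_le_iff field_simps)
        ultimately have "\<bar>1 - u / (\<delta> * sqrt (real n))\<bar> * \<bar>Re (chf (u / sqrt (real n)) ^ n)\<bar> \<le>
            1 * exp (- (var / 4) * u\<^sup>2)" by (intro mult_mono) auto
        then show ?thesis using True by (simp add: g_def abs_mult)
      next
        case False
        \<comment> \<open>For \<open>n = 0\<close> the interval shrinks to the point 0, where the
          convention for division by 0 gives \<open>g\<close> the value 1, equal to the
          bound.\<close>
        then show ?thesis by (cases "n = 0"; cases "u = 0") (auto simp: g_def indicator_def)
      qed
    qed
  qed auto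
  have hpos: "0 < (\<integral>u. h u \<partial>lborel)"
  proof -
    have ih: "integrable lborel h"
      unfolding h_def by (rule Bochner_Integration.integrable_bound[OF gi(1)[unfolded e]]) (auto simp: indicator_def)
    have "exp (- (var / 2)) * (\<integral>u. indicator {0..1::real} u \<partial>lborel) \<le> (\<integral>u. h u \<partial>lborel)"
    proof -
      have "(\<integral>u. exp (- (var / 2)) * indicator {0..1::real} u \<partial>lborel) \<le> (\<integral>u. h u \<partial>lborel)"
      proof (intro integral_mono ih)
        fix u :: real
        have "u\<^sup>2 \<le> 1" if "0 \<le> u" "u \<le> 1" using that by (simp add: power_le_one)
        then have "var * u\<^sup>2 \<le> var * 1" if "0 \<le> u" "u \<le> 1" using that var_pos by (intro mult_left_mono) auto
        then show "exp (- (var / 2)) * indicator {0..1::real} u \<le> h u" by (auto simp: h_def indicator_def)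
      qed auto
      then show ?thesis by simp
    qed
    then have "exp (- (var / 2)) \<le> (\<integral>u. h u \<partial>lborel)" by simp
    with exp_gt_zero[of "- (var / 2)"] show ?thesis by (rule less_le_trans)
  qed
  show ?thesis
  proof (rule that[of "2 * (\<integral>u. h u \<partial>lborel)"])
    show "0 < 2 * (\<integral>u. h u \<partial>lborel)" using hpos by simp
    have "(\<lambda>n. 2 * (\<integral>u. g n u \<partial>lborel)) \<longlonglongrightarrow> 2 * (\<integral>u. h u \<partial>lborel)" by (intro tendsto_intros lim)
    moreover have "\<forall>\<^sub>F n in sequentially. 2 * (\<integral>u. g n u \<partial>lborel) =
        sqrt (real n) * (\<delta> * (\<integral>x. fejer (\<delta> * walk n x) \<partial>law n))"
      using eventually_gt_at_top[of 0] by eventually_elim (simp add: eq)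
    ultimately show "(\<lambda>n. sqrt (real n) * (\<delta> * (\<integral>x. fejer (\<delta> * walk n x) \<partial>law n))) \<longlonglongrightarrow> 2 * (\<integral>u. h u \<partial>lborel)"
      by (rule Lim_transform_eventually)
  qed
qed

end

section \<open>Probability of bounded windows\<close>

context centered_walk
begin

lemma expectation_cauchy_le:
  obtains \<delta> A where "0 < \<delta>" "0 < A"
    "\<And>n d. 0 < n \<Longrightarrow> 0 < d \<Longrightarrow> d \<le> \<delta> \<Longrightarrow> (\<integral>x. d / (1 + (d * walk n x)\<^sup>2) \<partial>law n) \<le> A / sqrt (real n)"
    "\<And>v. \<bar>v\<bar> \<le> \<delta> \<Longrightarrow> cmod (chf v) \<le> exp (- (var / 4) * v\<^sup>2)"
proof -
  obtain \<delta> A where \<delta>: "0 < \<delta>" and A: "0 < A"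
    and fb: "\<And>n d s. 0 < n \<Longrightarrow> 0 < d \<Longrightarrow> d \<le> \<delta> \<Longrightarrow>
      d * (\<integral>x. fejer (d * (walk n x - s)) \<partial>law n) \<le> A / sqrt (real n)"
    and bd: "\<And>v. \<bar>v\<bar> \<le> \<delta> \<Longrightarrow> cmod (chf v) \<le> exp (- (var / 4) * v\<^sup>2)"
    using expectation_fejer_le by blast
  show ?thesis
  proof (rule that[of \<delta> "10 * A"])
    fix n :: nat and d :: real assume n: "0 < n" and d: "0 < d" "d \<le> \<delta>"
    interpret L: prob_space "law n" by (rule prob_space_law)
    have fi: "integrable (law n) (\<lambda>x. fejer (d * (walk n x - s)))" for s
      using fejer_nonneg fejer_le_1 by (intro L.integrable_const_bound[of _ 1]) auto
    have "(\<integral>x. d / (1 + (d * walk n x)\<^sup>2) \<partial>law n) \<le>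
        (\<integral>x. 5 * (d * fejer (d * (walk n x - 0)) + d * fejer (d * (walk n x - pi / d))) \<partial>law n)"
    proof (rule integral_mono')
      show "integrable (law n) (\<lambda>x. 5 * (d * fejer (d * (walk n x - 0)) + d * fejer (d * (walk n x - pi / d))))"
        using fi by (intro integrable_mult_right Bochner_Integration.integrable_add)
      fix x
      have "d * (1 / (1 + (d * walk n x)\<^sup>2)) \<le> d * (5 * (fejer (d * walk n x) + fejer (d * walk n x - pi)))"
        using d by (intro mult_left_mono fejer_shift_ge) auto
      also have "d * walk n x - pi = d * (walk n x - pi / d)" using d by (simp add: algebra_simps)
      finally show "d / (1 + (d * walk n x)\<^sup>2) \<le>
          5 * (d * fejer (d * (walk n x - 0)) + d * fejer (d * (walk n x - pi / d)))"
        by (simp add: algebra_simps)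
      show "0 \<le> 5 * (d * fejer (d * (walk n x - 0)) + d * fejer (d * (walk n x - pi / d)))"
        using d fejer_nonneg by (auto intro!: mult_nonneg_nonneg add_nonneg_nonneg)
    qed
    also have "\<dots> = 5 * (d * (\<integral>x. fejer (d * (walk n x - 0)) \<partial>law n) +
        d * (\<integral>x. fejer (d * (walk n x - pi / d)) \<partial>law n))"
      using fi[of 0] fi[of "pi / d"] by simp
    also have "\<dots> \<le> 5 * (A / sqrt (real n) + A / sqrt (real n))"
      using n d by (intro mult_left_mono add_mono fb) auto
    finally show "(\<integral>x. d / (1 + (d * walk n x)\<^sup>2) \<partial>law n) \<le> 10 * A / sqrt (real n)" by simp
  qed (use \<delta> A bd in auto)
qed

text \<open>The Fejer kernel at scale \<delta> has mean of exact order \<open>1 / sqrt n\<close>,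
  but its tails are not confined to a window. Outside \<open>\<bar>walk\<bar> \<le> 1 / d\<close> it
  is at most a multiple \<open>8 * d / \<delta>\<close> of the Cauchy profile of scale
  \<open>d\<close>, whose mean is \<open>O(1 / sqrt n)\<close> uniformly in \<open>d\<close>. For
  small \<open>d\<close> the tails therefore carry only a fraction of the total, and the rest lies
  in the window.\<close>

lemma prob_window_ge:
  obtains B c where "0 < c" "\<forall>\<^sub>F n in sequentially. c / sqrt (real n) \<le> measure (law n) {x \<in> space (law n). \<bar>walk n x\<bar> \<le> B}"
proof -
  obtain \<delta> A where \<delta>: "0 < \<delta>" and A: "0 < A"
    and cb: "\<And>n d. 0 < n \<Longrightarrow> 0 < d \<Longrightarrow> d \<le> \<delta> \<Longrightarrow>
      (\<integral>x. d / (1 + (d * walk n x)\<^sup>2) \<partial>law n) \<le> A / sqrt (real n)"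
    and bd: "\<And>v. \<bar>v\<bar> \<le> \<delta> \<Longrightarrow> cmod (chf v) \<le> exp (- (var / 4) * v\<^sup>2)"
    using expectation_cauchy_le by blast
  obtain c where c: "0 < c"
    and lim: "(\<lambda>n. sqrt (real n) * (\<delta> * (\<integral>x. fejer (\<delta> * walk n x) \<partial>law n))) \<longlonglongrightarrow> c"
    using expectation_fejer_tendsto[OF \<delta> bd] by blast
  \<comment> \<open>With this \<open>d\<close> the tails carry at most \<open>c / 4\<close>, while
    the total eventually exceeds \<open>c / 2\<close>, both in units of
    \<open>1 / sqrt n\<close>.\<close>
  define d where "d = min \<delta> (\<delta> * c / (32 * A))"
  have d: "0 < d" "d \<le> \<delta>" "8 * d / \<delta> * A \<le> c / 4"
    using \<delta> A c by (auto simp: d_def min_def field_simps)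
  have "\<forall>\<^sub>F n in sequentially. c / 2 < sqrt (real n) * (\<delta> * (\<integral>x. fejer (\<delta> * walk n x) \<partial>law n))"
    using c by (intro order_tendstoD[OF lim]) auto
  then have "\<forall>\<^sub>F n in sequentially. (c / (4 * \<delta>)) / sqrt (real n) \<le>
      measure (law n) {x \<in> space (law n). \<bar>walk n x\<bar> \<le> 1 / d}"
    using eventually_gt_at_top[of 0]
  proof eventually_elim
    case (elim n)
    interpret L: prob_space "law n" by (rule prob_space_law)
    have sn: "0 < sqrt (real n)" using elim(2) by simp
    let ?W = "{x \<in> space (law n). \<bar>walk n x\<bar> \<le> 1 / d}"
    have W [measurable]: "?W \<in> sets (law n)" by measurable
    have i1: "integrable (law n) (indicator ?W :: _ \<Rightarrow> real)" by (simp add: L.emeasure_eq_measure)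
    have i2: "integrable (law n) (\<lambda>x. d / (1 + (d * walk n x)\<^sup>2))"
    proof (rule L.integrable_const_bound[of _ d])
      show "AE x in law n. norm (d / (1 + (d * walk n x)\<^sup>2)) \<le> d"
        using d(1) by (intro AE_I2) (simp add: divide_le_eq add_pos_nonneg abs_of_pos mult_le_cancel_left1)
    qed measurable
    have "\<delta> * (\<integral>x. fejer (\<delta> * walk n x) \<partial>law n) = (\<integral>x. \<delta> * fejer (\<delta> * walk n x) \<partial>law n)" by simp
    also have "\<dots> \<le> (\<integral>x. \<delta> * indicator ?W x + (8 * d / \<delta>) * (d / (1 + (d * walk n x)\<^sup>2)) \<partial>law n)"
    proof (intro integral_mono)
      show "integrable (law n) (\<lambda>x. \<delta> * fejer (\<delta> * walk n x))"
        using fejer_nonneg fejer_le_1 by (intro integrable_mult_right L.integrable_const_bound[of _ 1]) auto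
      show "integrable (law n) (\<lambda>x. \<delta> * indicator ?W x + (8 * d / \<delta>) * (d / (1 + (d * walk n x)\<^sup>2)))"
        using i1 i2 by (intro Bochner_Integration.integrable_add integrable_mult_right)
      fix x assume x: "x \<in> space (law n)"
      let ?s = "walk n x"
      have D: "0 < 1 + (d * ?s)\<^sup>2" by (simp add: add_pos_nonneg)
      show "\<delta> * fejer (\<delta> * ?s) \<le> \<delta> * indicator ?W x + (8 * d / \<delta>) * (d / (1 + (d * ?s)\<^sup>2))"
      proof (cases "\<bar>?s\<bar> \<le> 1 / d")
        case True
        have "\<delta> * fejer (\<delta> * ?s) \<le> \<delta> * 1" using \<delta> fejer_le_1 by (intro mult_left_mono) auto
        moreover have "0 \<le> (8 * d / \<delta>) * (d / (1 + (d * ?s)\<^sup>2))" using \<delta> d D by simp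
        ultimately show ?thesis using True x by simp
      next
        case False
        then have s: "1 < \<bar>d * ?s\<bar>" using d(1) by (simp add: abs_mult field_simps)
        then have s0: "?s \<noteq> 0" by auto
        have "1 \<le> (d * ?s)\<^sup>2" using power_mono[of 1 "\<bar>d * ?s\<bar>" 2] s by simp
        then have "1 + (d * ?s)\<^sup>2 \<le> 2 * (d * ?s)\<^sup>2" by simp
        then have "1 / (2 * (d * ?s)\<^sup>2) \<le> 1 / (1 + (d * ?s)\<^sup>2)"
          using D \<open>1 \<le> (d * ?s)\<^sup>2\<close> by (intro divide_left_mono mult_pos_pos) linarith+
        then have "8 * d * d / \<delta> * (1 / (2 * (d * ?s)\<^sup>2)) \<le> 8 * d * d / \<delta> * (1 / (1 + (d * ?s)\<^sup>2))"
          using d \<delta> by (intro mult_left_mono) auto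
        moreover have "8 * d * d / \<delta> * (1 / (2 * (d * ?s)\<^sup>2)) = \<delta> * (4 / (\<delta> * ?s)\<^sup>2)"
          using d(1) \<delta> s0 by (simp add: power2_eq_square)
        moreover have "\<delta> * fejer (\<delta> * ?s) \<le> \<delta> * (4 / (\<delta> * ?s)\<^sup>2)"
          using \<delta> s0 by (intro mult_left_mono fejer_le) auto
        ultimately have "\<delta> * fejer (\<delta> * ?s) \<le> 8 * d * d / \<delta> * (1 / (1 + (d * ?s)\<^sup>2))" by linarith
        then show ?thesis using False by simp
      qed
    qed
    also have "\<dots> = \<delta> * measure (law n) ?W + 8 * d / \<delta> * (\<integral>x. d / (1 + (d * walk n x)\<^sup>2) \<partial>law n)"
    proof -
      have "(\<integral>x. indicator ?W x \<partial>law n) = measure (law n) ?W" using W by simp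
      with Bochner_Integration.integral_add[OF integrable_mult_right[OF i1, of \<delta>]
          integrable_mult_right[OF i2, of "8 * d / \<delta>"]]
      show ?thesis by (simp only: integral_mult_right_zero)
    qed
    also have "\<dots> \<le> \<delta> * measure (law n) ?W + 8 * d / \<delta> * (A / sqrt (real n))"
      using d \<delta> elim(2) by (intro add_left_mono mult_left_mono cb) auto
    also have "8 * d / \<delta> * (A / sqrt (real n)) \<le> c / 4 / sqrt (real n)"
      using divide_right_mono[OF d(3), of "sqrt (real n)"] sn by simp
    finally have "\<delta> * (\<integral>x. fejer (\<delta> * walk n x) \<partial>law n) \<le> \<delta> * measure (law n) ?W + c / 4 / sqrt (real n)" by simp
    moreover have "c / 2 / sqrt (real n) \<le> \<delta> * (\<integral>x. fejer (\<delta> * walk n x) \<partial>law n)"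
      using elim(1) sn by (simp add: field_simps)
    ultimately have "c / 4 / sqrt (real n) \<le> \<delta> * measure (law n) ?W"
      by (simp add: field_simps)
    then have "c / 4 / sqrt (real n) / \<delta> \<le> \<delta> * measure (law n) ?W / \<delta>"
      using \<delta> by (intro divide_right_mono) auto
    then show ?case using \<delta> by (simp add: ac_simps)
  qed
  then show ?thesis using c \<delta> by (intro that[of "c / (4 * \<delta>)" "1 / d"]) auto
qed

end

section \<open>Walks with nonpositive drift\<close>

lemma exp_minus_one_le: "\<bar>exp y - 1\<bar> \<le> \<bar>y\<bar> * exp \<bar>y\<bar>" for y :: real
proof (cases "0 \<le> y")
  case True
  have "exp y * (1 - y) \<le> exp y * exp (- y)"
    using exp_ge_add_one_self[of "- y"] by (intro mult_left_mono) auto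
  then have "exp y - 1 \<le> y * exp y" by (simp add: exp_minus algebra_simps)
  then show ?thesis using True by simp
next
  case False
  have "1 - exp y \<le> - y" using exp_ge_add_one_self[of y] by linarith
  also have "\<dots> \<le> \<bar>y\<bar> * exp \<bar>y\<bar>" using False mult_left_mono[of 1 "exp (- y)" "- y"] by simp
  finally show ?thesis using False by simp
qed

lemma exp_second_order: "exp y - 1 - y \<le> y\<^sup>2 * exp \<bar>y\<bar>" for y :: real
proof -
  have "exp y * (1 - y) \<le> exp y * exp (- y)"
    using exp_ge_add_one_self[of "- y"] by (intro mult_left_mono) auto
  then have "exp y - 1 - y \<le> y * (exp y - 1)" by (simp add: exp_minus algebra_simps)
  also have "\<dots> \<le> \<bar>y\<bar> * \<bar>exp y - 1\<bar>" by (simp add: abs_mult[symmetric])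
  also have "\<dots> \<le> \<bar>y\<bar> * (\<bar>y\<bar> * exp \<bar>y\<bar>)" by (intro mult_left_mono exp_minus_one_le) auto
  finally show ?thesis by (simp add: power2_eq_square)
qed

lemma square_le_exp: "x\<^sup>2 \<le> 2 * exp \<bar>x\<bar>" for x :: real
  using exp_lower_Taylor_quadratic[of "\<bar>x\<bar>"] by simp

lemma exp_abs_le: "exp \<bar>x\<bar> \<le> exp x + exp (- x)" for x :: real
  by (cases "0 \<le> x") (auto simp: add_nonneg_nonneg)

context iid_walk
begin

lemma expectation_exp_walk:
  assumes "integrable N (\<lambda>x. exp (u * Z x))"
  shows "integrable (law n) (\<lambda>x. exp (u * walk n x))"
    and "(\<integral>x. exp (u * walk n x) \<partial>law n) = (\<integral>x. exp (u * Z x) \<partial>N) ^ n"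
proof -
  interpret P: product_sigma_finite "\<lambda>_. N" ..
  have eq: "exp (u * walk n x) = (\<Prod>i<n. exp (u * Z (x i)))" for x
    by (simp add: walk_def sum_distrib_left exp_sum)
  show "integrable (law n) (\<lambda>x. exp (u * walk n x))"
    unfolding eq by (intro P.product_integrable_prod assms) auto
  show "(\<integral>x. exp (u * walk n x) \<partial>law n) = (\<integral>x. exp (u * Z x) \<partial>N) ^ n"
    unfolding eq by (subst P.product_integral_prod) (auto intro: assms)
qed

text \<open>No second moment is assumed: the exponential Chebyshev function \<open>l\<close> satisfies a doubling
  condition near 0, which makes the Paley-Zygmund inequality applicable to \<open>exp (- s * walk n)\<close>
  with \<open>s\<close> chosen so that \<open>l s = 1 + 1 / n\<close>.\<close>

lemma prob_walk_nonpos_ge: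
  assumes int: "\<And>u. 0 \<le> u \<Longrightarrow> u \<le> 1 \<Longrightarrow> integrable N (\<lambda>x. exp (- u * Z x))"
    and ge1: "\<And>u. 0 \<le> u \<Longrightarrow> u \<le> 1 \<Longrightarrow> 1 \<le> (\<integral>x. exp (- u * Z x) \<partial>N)"
    and nz: "\<not> (AE x in N. Z x = 0)"
  obtains c where "0 < c" "\<forall>\<^sub>F n in sequentially. c \<le> measure (law n) {x \<in> space (law n). walk n x \<le> 0}"
proof -
  define l where "l u = (\<integral>x. exp (- u * Z x) \<partial>N)" for u
  have l0: "l 0 = 1" by (simp add: l_def prob_space)
  have sqe: "(exp (- s * z) - 1)\<^sup>2 = exp (- (2 * s) * z) - 2 * exp (- s * z) + 1" for s z :: real
    by (simp add: power2_eq_square algebra_simps flip: exp_add)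
  \<comment> \<open>This second moment is what \<open>l (2 * s) - 1\<close> has in excess of twice
    \<open>l s - 1\<close>, so doubling amounts to bounding it by a multiple of
    \<open>l s - 1\<close>.\<close>
  have sqi: "integrable N (\<lambda>x. (exp (- s * Z x) - 1)\<^sup>2)"
    and sq: "(\<integral>x. (exp (- s * Z x) - 1)\<^sup>2 \<partial>N) = (l (2 * s) - 1) - 2 * (l s - 1)"
    if s: "0 \<le> s" "s \<le> 1 / 2" for s
  proof -
    have i: "integrable N (\<lambda>x. exp (- (2 * s) * Z x))" "integrable N (\<lambda>x. exp (- s * Z x))"
      using s by (intro int; simp)+
    show "integrable N (\<lambda>x. (exp (- s * Z x) - 1)\<^sup>2)"
      unfolding sqe using i by (intro Bochner_Integration.integrable_add Bochner_Integration.integrable_diff integrable_mult_right) auto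
    have "(\<integral>x. (exp (- s * Z x) - 1)\<^sup>2 \<partial>N) = l (2 * s) - 2 * l s + 1"
      unfolding sqe l_def using i by (simp add: prob_space)
    then show "(\<integral>x. (exp (- s * Z x) - 1)\<^sup>2 \<partial>N) = (l (2 * s) - 1) - 2 * (l s - 1)" by simp
  qed
  \<comment> \<open>A bounded integrand replaces \<open>Z^2\<close>, whose mean may be infinite;
    \<open>c\<close> is positive because \<open>Z\<close> is not almost surely 0. By convexity of
    \<open>exp\<close> it yields a quadratic lower bound.\<close>
  define c where "c = (\<integral>x. (1 - exp (- \<bar>Z x\<bar> / 2))\<^sup>2 \<partial>N)"
  have ci: "integrable N (\<lambda>x. (1 - exp (- \<bar>Z x\<bar> / 2))\<^sup>2)"
    by (intro integrable_const_bound[of _ 1]) (auto simp: power_le_one)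
  have c: "0 < c"
  proof -
    have "c \<noteq> 0"
    proof
      assume "c = 0"
      then have "AE x in N. (1 - exp (- \<bar>Z x\<bar> / 2))\<^sup>2 = 0"
        unfolding c_def using ci by (subst (asm) integral_nonneg_eq_0_iff_AE) auto
      then show False using nz by (auto elim: AE_mp)
    qed
    moreover have "0 \<le> c" unfolding c_def by (intro integral_nonneg_AE) auto
    ultimately show ?thesis by simp
  qed
  have low: "c * s\<^sup>2 \<le> (\<integral>x. (exp (- (s / 2) * Z x) - 1)\<^sup>2 \<partial>N)" if s: "0 \<le> s" "s \<le> 1" for s
  proof -
    have "s\<^sup>2 * c = (\<integral>x. s\<^sup>2 * (1 - exp (- \<bar>Z x\<bar> / 2))\<^sup>2 \<partial>N)" by (simp add: c_def)
    also have "\<dots> \<le> (\<integral>x. (exp (- (s / 2) * Z x) - 1)\<^sup>2 \<partial>N)"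
    proof (intro integral_mono integrable_mult_right ci sqi)
      fix x
      have "exp ((1 - s) *\<^sub>R 0 + s *\<^sub>R (- \<bar>Z x\<bar> / 2)) \<le> (1 - s) * exp 0 + s * exp (- \<bar>Z x\<bar> / 2)"
        using s by (intro convex_onD[OF exp_convex]) auto
      then have 1: "s * (1 - exp (- \<bar>Z x\<bar> / 2)) \<le> 1 - exp (- (s / 2) * \<bar>Z x\<bar>)"
        by (simp add: algebra_simps)
      have 2: "1 - exp (- (s / 2) * \<bar>Z x\<bar>) \<le> \<bar>exp (- (s / 2) * Z x) - 1\<bar>"
      proof (cases "0 \<le> Z x")
        case False
        have "1 - exp (- y) \<le> \<bar>exp y - 1\<bar>" for y :: real
          using exp_ge_add_one_self[of y] exp_ge_add_one_self[of "- y"] by linarith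
        from this[of "- (s / 2) * Z x"] False show ?thesis by simp
      qed simp
      have "0 \<le> s * (1 - exp (- \<bar>Z x\<bar> / 2))" using s by simp
      then have "(s * (1 - exp (- \<bar>Z x\<bar> / 2)))\<^sup>2 \<le> \<bar>exp (- (s / 2) * Z x) - 1\<bar>\<^sup>2"
        using 1 2 by (intro power_mono) auto
      then show "s\<^sup>2 * (1 - exp (- \<bar>Z x\<bar> / 2))\<^sup>2 \<le> (exp (- (s / 2) * Z x) - 1)\<^sup>2"
        by (simp add: power_mult_distrib)
    qed (use s in auto)
    finally show ?thesis by (simp add: mult.commute)
  qed
  \<comment> \<open>Where \<open>Z \<ge> 0\<close>, factor
    \<open>q^2 - 1 = (q - 1) * (q + 1)\<close> with \<open>q + 1 \<le> 2\<close>. Where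
    \<open>Z < 0\<close>, the integrable \<open>exp (- Z)\<close> dominates:
    \<open>s \<le> 1 / 4\<close> costs half of the exponent, and the square of \<open>Z\<close>
    another quarter.\<close>
  have up: "(\<integral>x. (exp (- s * Z x) - 1)\<^sup>2 \<partial>N) \<le>
      4 * (\<integral>x. (exp (- (s / 2) * Z x) - 1)\<^sup>2 \<partial>N) + s\<^sup>2 * (32 * l 1)" if s: "0 \<le> s" "s \<le> 1 / 4" for s
  proof -
    have i1: "integrable N (\<lambda>x. (exp (- (s / 2) * Z x) - 1)\<^sup>2)" using s by (intro sqi) auto
    have i2: "integrable N (\<lambda>x. exp (- 1 * Z x))" by (intro int) auto
    have "(\<integral>x. (exp (- s * Z x) - 1)\<^sup>2 \<partial>N) \<le>
        (\<integral>x. 4 * (exp (- (s / 2) * Z x) - 1)\<^sup>2 + s\<^sup>2 * (32 * exp (- 1 * Z x)) \<partial>N)"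
    proof (intro integral_mono Bochner_Integration.integrable_add integrable_mult_right i1 i2 sqi)
      fix x
      show "(exp (- s * Z x) - 1)\<^sup>2 \<le> 4 * (exp (- (s / 2) * Z x) - 1)\<^sup>2 + s\<^sup>2 * (32 * exp (- 1 * Z x))"
      proof (cases "0 \<le> Z x")
        case True
        define q where "q = exp (- (s / 2) * Z x)"
        have q: "0 \<le> q" "q \<le> 1" unfolding q_def using True s by auto
        have "exp (- s * Z x) = q * q" unfolding q_def by (simp flip: exp_add)
        then have "(exp (- s * Z x) - 1)\<^sup>2 = (q - 1)\<^sup>2 * (q + 1)\<^sup>2"
          by (simp add: power2_eq_square algebra_simps)
        also have "\<dots> \<le> (q - 1)\<^sup>2 * 2\<^sup>2" using q by (intro mult_left_mono power_mono) auto
        finally have "(exp (- s * Z x) - 1)\<^sup>2 \<le> 4 * (q - 1)\<^sup>2" by simp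
        moreover have "0 \<le> s\<^sup>2 * (32 * exp (- 1 * Z x))" by simp
        ultimately show ?thesis unfolding q_def by linarith
      next
        case False
        define y where "y = - Z x"
        have y: "0 < y" using False by (simp add: y_def)
        have "\<bar>exp (s * y) - 1\<bar> \<le> s * y * exp (s * y)"
          using exp_minus_one_le[of "s * y"] s y by simp
        then have "\<bar>exp (s * y) - 1\<bar>\<^sup>2 \<le> (s * y * exp (s * y))\<^sup>2" by (intro power_mono) auto
        also have "\<dots> = s\<^sup>2 * (16 * (y / 4)\<^sup>2 * exp (2 * s * y))"
        proof -
          have "(exp (s * y))\<^sup>2 = exp (2 * s * y)" by (simp add: power2_eq_square flip: exp_add)
          then show ?thesis by (simp add: power_mult_distrib power_divide)
        qed
        also have "\<dots> \<le> s\<^sup>2 * (16 * (2 * exp (y / 4)) * exp (y / 2))"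
        proof (intro mult_left_mono mult_mono)
          show "(y / 4)\<^sup>2 \<le> 2 * exp (y / 4)" using square_le_exp[of "y / 4"] y by simp
          show "exp (2 * s * y) \<le> exp (y / 2)" using mult_right_mono[of "2 * s" "1 / 2" y] s y by simp
        qed auto
        also have "\<dots> = s\<^sup>2 * (32 * exp (3 / 4 * y))" by (simp flip: exp_add)
        also have "\<dots> \<le> s\<^sup>2 * (32 * exp (- 1 * Z x))" using y by (intro mult_left_mono) (auto simp: y_def)
        finally have "(exp (- s * Z x) - 1)\<^sup>2 \<le> s\<^sup>2 * (32 * exp (- 1 * Z x))" by (simp add: y_def)
        moreover have "0 \<le> 4 * (exp (- (s / 2) * Z x) - 1)\<^sup>2" by simp
        ultimately show ?thesis by linarith
      qed
    qed (use s in auto)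
    also have "\<dots> = 4 * (\<integral>x. (exp (- (s / 2) * Z x) - 1)\<^sup>2 \<partial>N) + s\<^sup>2 * (32 * l 1)"
      unfolding l_def using i1 i2 by (subst Bochner_Integration.integral_add) (auto intro!: integrable_mult_right)
    finally show ?thesis .
  qed
  have l1: "1 \<le> l 1" unfolding l_def by (intro ge1) auto
  \<comment> \<open>The error \<open>s^2 * 32 * l 1\<close> is absorbed by the quadratic lower
    bound, which gives \<open>32 * l 1 / c\<close>; the 6 is 4 from \<open>up\<close> plus 2 from
    \<open>sq\<close>.\<close>
  define C where "C = 6 + 32 * l 1 / c"
  have C0: "0 \<le> C" using l1 c by (simp add: C_def)
  have lowl: "c * s\<^sup>2 \<le> l s - 1" and doubling: "l (2 * s) - 1 \<le> C * (l s - 1)"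
    if s: "0 \<le> s" "s \<le> 1 / 4" for s
  proof -
    let ?D = "\<integral>x. (exp (- (s / 2) * Z x) - 1)\<^sup>2 \<partial>N"
    have "1 \<le> l (s / 2)" unfolding l_def using s by (intro ge1) auto
    then have D: "?D \<le> l s - 1" using sq[of "s / 2"] s by simp
    have cs: "c * s\<^sup>2 \<le> ?D" using s by (intro low) auto
    then show "c * s\<^sup>2 \<le> l s - 1" using D by linarith
    have "s\<^sup>2 \<le> ?D / c" using cs c by (simp add: field_simps)
    then have "s\<^sup>2 * (32 * l 1) \<le> ?D / c * (32 * l 1)" using l1 by (intro mult_right_mono) auto
    then have "(\<integral>x. (exp (- s * Z x) - 1)\<^sup>2 \<partial>N) \<le> (4 + 32 * l 1 / c) * ?D"
      using up[OF s] by (simp add: algebra_simps)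
    also have "\<dots> \<le> (4 + 32 * l 1 / c) * (l s - 1)" using l1 c D by (intro mult_left_mono) auto
    finally show "l (2 * s) - 1 \<le> C * (l s - 1)"
      using sq[of s] s by (simp add: C_def algebra_simps)
  qed
  have cont: "continuous_on {0..1 / 4} l"
    unfolding continuous_on_sequentially
  proof (intro allI ballI impI)
    fix u :: "nat \<Rightarrow> real" and a assume a: "a \<in> {0..1 / 4}" and u: "(\<forall>n. u n \<in> {0..1 / 4}) \<and> u \<longlonglongrightarrow> a"
    show "(l \<circ> u) \<longlonglongrightarrow> l a"
      unfolding l_def comp_def
    proof (rule integral_dominated_convergence[where w = "\<lambda>x. 1 + exp (- 1 * Z x)"])
      show "integrable N (\<lambda>x. 1 + exp (- 1 * Z x))"
        using int[of 1] by (intro Bochner_Integration.integrable_add) auto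
      show "AE x in N. (\<lambda>n. exp (- u n * Z x)) \<longlonglongrightarrow> exp (- a * Z x)"
        using u by (intro AE_I2 tendsto_intros) auto
      fix n
      show "AE x in N. norm (exp (- u n * Z x)) \<le> 1 + exp (- 1 * Z x)"
      proof (rule AE_I2)
        fix x
        have un: "0 \<le> u n" "u n \<le> 1" using u[THEN conjunct1, rule_format, of n] by auto
        have "- u n * Z x \<le> 0 \<or> - u n * Z x \<le> - Z x"
        proof (cases "0 \<le> Z x")
          case False
          then have "u n * (- Z x) \<le> 1 * (- Z x)" using un by (intro mult_right_mono) auto
          then show ?thesis by simp
        qed (use un in simp)
        then show "norm (exp (- u n * Z x)) \<le> 1 + exp (- 1 * Z x)"
          by (auto simp: add_increasing add_increasing2)
      qed
    qed auto
  qed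
  have "\<forall>\<^sub>F n in sequentially. exp (- C) \<le> measure (law n) {x \<in> space (law n). walk n x \<le> 0}"
  proof (rule eventually_sequentiallyI)
    \<comment> \<open>The threshold makes \<open>1 / n\<close> at most \<open>c * (1 / 4)^2\<close>,
      hence at most \<open>l (1 / 4) - 1\<close>, so that the intermediate value theorem provides
      \<open>s\<close>.\<close>
    fix n assume n: "nat \<lceil>16 / c\<rceil> + 1 \<le> n"
    then have n0: "0 < n" and "16 / c \<le> real n" by linarith+
    then have nc: "1 / real n \<le> c * (1 / 4)\<^sup>2" using c by (simp add: field_simps power2_eq_square)
    interpret L: prob_space "law n" by (rule prob_space_law)
    have "\<exists>s\<ge>0. s \<le> 1 / 4 \<and> l s = 1 + 1 / real n"
      using cont nc lowl[of "1 / 4"] by (intro IVT') (auto simp: l0)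
    then obtain s where s: "0 \<le> s" "s \<le> 1 / 4" and ls: "l s = 1 + 1 / real n" by blast
    let ?S = "{x \<in> space (law n). walk n x \<le> 0}"
    have S [measurable]: "?S \<in> sets (law n)" by measurable
    have "integrable N (\<lambda>x. exp ((- s) * Z x))" "integrable N (\<lambda>x. exp ((- (2 * s)) * Z x))"
      using s by (intro int; simp)+
    note V = expectation_exp_walk[OF this(1), of n] and V2 = expectation_exp_walk[OF this(2), of n]
    have EV: "2 \<le> (\<integral>x. exp (- s * walk n x) \<partial>law n)"
    proof -
      have "1 + real n * (1 / real n) \<le> (1 + 1 / real n) ^ n"
        by (intro Bernoulli_inequality) (use n0 in \<open>auto intro: order_trans[of _ 0]\<close>)
      then show ?thesis unfolding V(2) using ls n0 by (simp add: l_def)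
    qed
    have EV2: "(\<integral>x. exp (- (2 * s) * walk n x) \<partial>law n) \<le> exp C"
    proof -
      have nn: "0 \<le> l (2 * s)" unfolding l_def by (intro integral_nonneg_AE) auto
      have "l (2 * s) \<le> 1 + C / real n" using doubling[OF s] ls by simp
      also have "\<dots> \<le> exp (C / real n)" by (rule exp_ge_add_one_self)
      finally have "l (2 * s) ^ n \<le> exp (C / real n) ^ n" using nn by (intro power_mono)
      also have "\<dots> = exp C" using n0 by (simp flip: exp_of_nat_mult)
      finally show ?thesis unfolding V2(2) by (simp add: l_def)
    qed
    have iS: "integrable (law n) (indicator ?S :: _ \<Rightarrow> real)" by (simp add: L.emeasure_eq_measure)
    \<comment> \<open>With \<open>V = exp (- s * walk n)\<close>: where the walk is positive,
      \<open>V \<le> 1\<close>; on the event, the arithmetic-geometric mean inequality is weighted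
      so that the second moment, at most \<open>exp C\<close>, contributes at most 1/2. As the mean
      is at least 2, the remaining 1/2 is the share of the event.\<close>
    have "(\<integral>x. exp (- s * walk n x) \<partial>law n) \<le>
        (\<integral>x. 1 + (exp (- (2 * s) * walk n x) * (exp (- C) / 2) + exp C / 2 * indicator ?S x) \<partial>law n)"
    proof (intro integral_mono V(1))
      show "integrable (law n) (\<lambda>x. 1 + (exp (- (2 * s) * walk n x) * (exp (- C) / 2) + exp C / 2 * indicator ?S x))"
        using V2(1) iS by (intro Bochner_Integration.integrable_add integrable_mult_right integrable_mult_left) auto
      fix x assume x: "x \<in> space (law n)"
      define v where "v = exp (- s * walk n x)"
      have v1: "exp (- s * walk n x) = v" by (simp only: v_def)
      have v2: "exp (- (2 * s) * walk n x) = v\<^sup>2"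
        by (simp add: v_def power2_eq_square flip: exp_add)
      show "exp (- s * walk n x) \<le> 1 + (exp (- (2 * s) * walk n x) * (exp (- C) / 2) + exp C / 2 * indicator ?S x)"
      proof (cases "walk n x \<le> 0")
        case True
        have "0 \<le> (v * exp (- C / 2) - exp (C / 2))\<^sup>2" by simp
        also have "\<dots> = v\<^sup>2 * exp (- C) - 2 * v + exp C"
          by (simp add: power2_eq_square algebra_simps flip: exp_add)
        finally have "v \<le> v\<^sup>2 * (exp (- C) / 2) + exp C / 2" by simp
        then show ?thesis using True x unfolding v1 v2 by simp
      next
        case False
        then have "v \<le> 1" using s by (simp add: v_def)
        moreover have "0 \<le> v\<^sup>2 * (exp (- C) / 2)" by simp
        ultimately have "v \<le> 1 + v\<^sup>2 * (exp (- C) / 2)" by linarith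
        then show ?thesis using False unfolding v1 v2 by simp
      qed
    qed
    also have "\<dots> = 1 + ((\<integral>x. exp (- (2 * s) * walk n x) \<partial>law n) * (exp (- C) / 2) + exp C / 2 * measure (law n) ?S)"
      using V2(1) iS by (simp add: L.prob_space)
    also have "\<dots> \<le> 1 + (exp C * (exp (- C) / 2) + exp C / 2 * measure (law n) ?S)"
      by (intro add_left_mono add_right_mono mult_right_mono EV2) auto
    also have "exp C * (exp (- C) / 2) = 1 / 2" by (simp add: exp_minus)
    finally have "1 \<le> exp C * measure (law n) ?S" using EV by linarith
    then have "exp (- C) * 1 \<le> exp (- C) * (exp C * measure (law n) ?S)" by (intro mult_left_mono) auto
    also have "\<dots> = measure (law n) ?S" by (simp add: exp_minus)
    finally show "exp (- C) \<le> measure (law n) ?S" by simp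
  qed
  then show ?thesis by (intro that[of "exp (- C)"]) auto
qed

end

section \<open>Exponential tilting\<close>

text \<open>A one-sided Taylor bound replaces differentiation under the integral. It yields both the
  vanishing mean of the tilted step and the positivity of the optimal \<tau>.\<close>

lemma (in iid_walk) exp_moment_le_quadratic:
  assumes e: "0 < e" and i: "integrable N (\<lambda>x. exp (e * Z x))" "integrable N (\<lambda>x. exp (- e * Z x))"
  obtains k where "0 \<le> k" "integrable N (\<lambda>x. (Z x)\<^sup>2)"
    "\<And>h. \<bar>h\<bar> \<le> e / 2 \<Longrightarrow> (\<integral>x. exp (h * Z x) \<partial>N) \<le> 1 + h * (\<integral>x. Z x \<partial>N) + h\<^sup>2 * k"
proof -
  define w where "w x = exp (e * Z x) + exp (- e * Z x)" for x
  have iw: "integrable N w" unfolding w_def using i by auto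
  have ew: "exp (e * \<bar>Z x\<bar>) \<le> w x" for x
    using exp_abs_le[of "e * Z x"] e by (simp add: w_def abs_mult)
  have w0: "0 \<le> w x" for x by (simp add: w_def add_nonneg_nonneg)
  \<comment> \<open>Half of the available exponent \<open>e\<close> pays for the square; the other
    half is left for \<open>exp \<bar>h * Z x\<bar>\<close>, hence the range \<open>e / 2\<close>
    for \<open>h\<close>.\<close>
  have sq: "(Z x)\<^sup>2 \<le> 8 / e\<^sup>2 * exp (e / 2 * \<bar>Z x\<bar>)" for x
  proof -
    have "(e / 2 * Z x)\<^sup>2 \<le> 2 * exp (e / 2 * \<bar>Z x\<bar>)" using square_le_exp[of "e / 2 * Z x"] e by (simp add: abs_mult)
    then show ?thesis using e by (simp add: power_mult_distrib power_divide field_simps)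
  qed
  have isq: "integrable N (\<lambda>x. (Z x)\<^sup>2)"
  proof (rule Bochner_Integration.integrable_bound)
    show "integrable N (\<lambda>x. 8 / e\<^sup>2 * w x)" using iw by simp
    show "AE x in N. norm ((Z x)\<^sup>2) \<le> norm (8 / e\<^sup>2 * w x)"
    proof (rule AE_I2)
      fix x
      have "e / 2 * \<bar>Z x\<bar> \<le> e * \<bar>Z x\<bar>" using e by (intro mult_right_mono) auto
      then have "exp (e / 2 * \<bar>Z x\<bar>) \<le> w x" by (intro order_trans[OF _ ew[of x]]) simp
      then have "8 / e\<^sup>2 * exp (e / 2 * \<bar>Z x\<bar>) \<le> 8 / e\<^sup>2 * w x" by (intro mult_left_mono) auto
      then show "norm ((Z x)\<^sup>2) \<le> norm (8 / e\<^sup>2 * w x)" using sq[of x] w0[of x] by simp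
    qed
  qed simp
  have iZ: "integrable N Z" by (rule square_integrable_imp_integrable[OF Z isq])
  define m where "m = (\<integral>x. Z x \<partial>N)"
  define k where "k = 8 / e\<^sup>2 * (\<integral>x. w x \<partial>N)"
  have ih: "integrable N (\<lambda>x. exp (h * Z x))" if h: "\<bar>h\<bar> \<le> e" for h
  proof (rule Bochner_Integration.integrable_bound[OF iw])
    show "AE x in N. norm (exp (h * Z x)) \<le> norm (w x)"
    proof (rule AE_I2)
      fix x
      have "h * Z x \<le> e * \<bar>Z x\<bar>" using mult_right_mono[OF h, of "\<bar>Z x\<bar>"] by (simp add: abs_mult[symmetric])
      then have "exp (h * Z x) \<le> exp (e * \<bar>Z x\<bar>)" by simp
      then have "exp (h * Z x) \<le> w x" by (rule order_trans[OF _ ew])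
      then show "norm (exp (h * Z x)) \<le> norm (w x)" using w0[of x] by simp
    qed
  qed simp
  have key: "(\<integral>x. exp (h * Z x) \<partial>N) \<le> 1 + h * m + h\<^sup>2 * k" if h: "\<bar>h\<bar> \<le> e / 2" for h
  proof -
    have "(\<integral>x. exp (h * Z x) \<partial>N) \<le> (\<integral>x. 1 + h * Z x + h\<^sup>2 * (8 / e\<^sup>2 * w x) \<partial>N)"
    proof (intro integral_mono ih)
      show "integrable N (\<lambda>x. 1 + h * Z x + h\<^sup>2 * (8 / e\<^sup>2 * w x))" using iZ iw by auto
      fix x
      have "exp (h * Z x) - 1 - h * Z x \<le> (h * Z x)\<^sup>2 * exp \<bar>h * Z x\<bar>" by (rule exp_second_order)
      also have "\<dots> = h\<^sup>2 * ((Z x)\<^sup>2 * exp (\<bar>h\<bar> * \<bar>Z x\<bar>))" by (simp add: power_mult_distrib abs_mult)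
      also have "\<dots> \<le> h\<^sup>2 * (8 / e\<^sup>2 * exp (e / 2 * \<bar>Z x\<bar>) * exp (e / 2 * \<bar>Z x\<bar>))"
        using mult_right_mono[OF h, of "\<bar>Z x\<bar>"] by (intro mult_left_mono mult_mono sq) auto
      also have "\<dots> = h\<^sup>2 * (8 / e\<^sup>2 * exp (e * \<bar>Z x\<bar>))" by (simp flip: exp_add)
      also have "\<dots> \<le> h\<^sup>2 * (8 / e\<^sup>2 * w x)" using ew by (intro mult_left_mono) auto
      finally show "exp (h * Z x) \<le> 1 + h * Z x + h\<^sup>2 * (8 / e\<^sup>2 * w x)" by simp
    qed (use h e in auto)
    also have "\<dots> = 1 + h * m + h\<^sup>2 * k" using iZ iw by (simp add: prob_space m_def k_def)
    finally show ?thesis .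
  qed
  have k0: "0 \<le> k" unfolding k_def using w0 by (intro mult_nonneg_nonneg integral_nonneg_AE) auto
  show ?thesis using that[OF k0 isq key[unfolded m_def]] .
qed

text \<open>The first-order condition at an interior minimum: the quadratic bound at
  \<open>h\<close> and at \<open>- h\<close> gives \<open>\<bar>m\<bar> \<le> h * k\<close> for all
  small positive \<open>h\<close>.\<close>

lemma (in iid_walk) mean_zero_if_exp_ge_1:
  assumes e: "0 < e" and i: "integrable N (\<lambda>x. exp (e * Z x))" "integrable N (\<lambda>x. exp (- e * Z x))"
    and ge: "\<And>h. \<bar>h\<bar> \<le> e \<Longrightarrow> 1 \<le> (\<integral>x. exp (h * Z x) \<partial>N)"
  shows "integrable N (\<lambda>x. (Z x)\<^sup>2)" and "(\<integral>x. Z x \<partial>N) = 0"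
proof -
  define m where "m = (\<integral>x. Z x \<partial>N)"
  obtain k where k0: "0 \<le> k" and isq: "integrable N (\<lambda>x. (Z x)\<^sup>2)"
    and le: "\<And>h. \<bar>h\<bar> \<le> e / 2 \<Longrightarrow> (\<integral>x. exp (h * Z x) \<partial>N) \<le> 1 + h * m + h\<^sup>2 * k"
    using exp_moment_le_quadratic[OF e i] unfolding m_def by blast
  show "integrable N (\<lambda>x. (Z x)\<^sup>2)" by (rule isq)
  have key: "0 \<le> h * m + h\<^sup>2 * k" if "\<bar>h\<bar> \<le> e / 2" for h
    using le[OF that] ge[of h] that e by simp
  have "\<bar>m\<bar> \<le> h * k" if h: "0 < h" "h \<le> e / 2" for h
  proof -
    have "0 \<le> h * (m + h * k)" "0 \<le> h * (- m + h * k)"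
      using key[of h] key[of "- h"] h by (simp_all add: power2_eq_square algebra_simps)
    then show ?thesis using h by (simp add: zero_le_mult_iff)
  qed
  note bound = this
  have "\<bar>m\<bar> \<le> 0 + \<epsilon>" if \<epsilon>: "0 < \<epsilon>" for \<epsilon>
  proof -
    define h where "h = min (e / 2) (\<epsilon> / (k + 1))"
    have "0 < h" using e \<epsilon> k0 by (simp add: h_def)
    moreover have "h \<le> e / 2" unfolding h_def by (rule min.cobounded1)
    ultimately have "\<bar>m\<bar> \<le> h * k" by (rule bound)
    also have "\<dots> \<le> \<epsilon> / (k + 1) * k" using k0 by (intro mult_right_mono) (auto simp: h_def)
    also have "\<dots> \<le> \<epsilon>" using k0 \<epsilon> by (simp add: field_simps)
    finally show ?thesis by simp
  qed
  then have "\<bar>m\<bar> \<le> 0" by (rule field_le_epsilon)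
  then show "(\<integral>x. Z x \<partial>N) = 0" by (simp add: m_def)
qed

context iid_walk
begin

text \<open>The normalising constant is a parameter of its own; the context below requires it to be
  the exponential moment at \<open>t\<close>, which makes this a probability measure.\<close>

definition tilt :: "real \<Rightarrow> real \<Rightarrow> 'a measure" where
  "tilt t G = density N (\<lambda>x. ennreal (exp (t * Z x) / G))"

context
  fixes t G :: real
  assumes G: "0 < G" and GI: "(\<integral>\<^sup>+x. ennreal (exp (t * Z x)) \<partial>N) = ennreal G"
begin

lemma nn_integral_exp_tilt:
  "(\<integral>\<^sup>+x. ennreal (exp (u * Z x)) \<partial>tilt t G) = (\<integral>\<^sup>+x. ennreal (exp ((t + u) * Z x)) \<partial>N) / ennreal G"
proof -
  have "(\<integral>\<^sup>+x. ennreal (exp (u * Z x)) \<partial>tilt t G) = (\<integral>\<^sup>+x. ennreal (exp ((t + u) * Z x)) / ennreal G \<partial>N)"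
    unfolding tilt_def using G
    by (subst nn_integral_density)
       (auto simp: divide_ennreal ennreal_mult[symmetric] exp_add[symmetric] algebra_simps intro!: nn_integral_cong)
  then show ?thesis by (simp add: nn_integral_divide)
qed

lemma iid_walk_tilt: "iid_walk (tilt t G) Z"
proof -
  have "emeasure (tilt t G) (space (tilt t G)) = (\<integral>\<^sup>+x. 1 \<partial>tilt t G)" by simp
  also have "\<dots> = 1" using nn_integral_exp_tilt[of 0] G GI by (simp add: ennreal_divide_self)
  finally have "prob_space (tilt t G)" by (rule prob_spaceI)
  then show ?thesis unfolding iid_walk_def iid_walk_axioms_def by (simp add: tilt_def)
qed

lemma AE_tilt: "(AE x in tilt t G. P x) \<longleftrightarrow> (AE x in N. P x)"
  unfolding tilt_def using G by (subst AE_density) auto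

text \<open>The product of the \<open>n\<close> letter densities depends on the walk alone: it is
  \<open>exp (t * walk n x) / G ^ n\<close>.\<close>

lemma nn_integral_walk_tilt:
  fixes F :: "real \<Rightarrow> real"
  assumes [measurable]: "F \<in> borel_measurable borel" and F: "\<And>s. 0 \<le> F s"
  shows "(\<integral>\<^sup>+x. ennreal (F (walk n x)) \<partial>law n) =
    ennreal (G ^ n) * (\<integral>\<^sup>+x. ennreal (exp (- t * walk n x) * F (walk n x)) \<partial>Pi\<^sub>M {..<n} (\<lambda>_. tilt t G))"
proof -
  interpret T: iid_walk "tilt t G" Z by (rule iid_walk_tilt)
  have [measurable]: "(\<lambda>x. x i) \<in> measurable (law n) N" if "i < n" for i
    using that by (intro measurable_component_singleton) auto
  have "Pi\<^sub>M {..<n} (\<lambda>_. tilt t G) = density (law n) (\<lambda>x. \<Prod>i<n. ennreal (exp (t * Z (x i)) / G))"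
    using T.prob_space_axioms unfolding tilt_def by (intro PiM_density prob_space_axioms) auto
  also have "(\<lambda>x. \<Prod>i<n. ennreal (exp (t * Z (x i)) / G)) = (\<lambda>x. ennreal (exp (t * walk n x) / G ^ n))"
    using G by (simp add: prod_ennreal prod_dividef walk_def sum_distrib_left exp_sum)
  finally have T: "Pi\<^sub>M {..<n} (\<lambda>_. tilt t G) = density (law n) (\<lambda>x. ennreal (exp (t * walk n x) / G ^ n))" .
  have "ennreal (G ^ n) * (\<integral>\<^sup>+x. ennreal (exp (- t * walk n x) * F (walk n x)) \<partial>Pi\<^sub>M {..<n} (\<lambda>_. tilt t G)) =
      (\<integral>\<^sup>+x. ennreal (G ^ n) * (ennreal (exp (t * walk n x) / G ^ n) * ennreal (exp (- t * walk n x) * F (walk n x))) \<partial>law n)"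
    unfolding T by (subst nn_integral_density) (auto simp: nn_integral_cmult)
  also have "\<dots> = (\<integral>\<^sup>+x. ennreal (F (walk n x)) \<partial>law n)"
  proof (intro nn_integral_cong)
    fix x
    have "ennreal (G ^ n) * (ennreal (exp (t * walk n x) / G ^ n) * ennreal (exp (- t * walk n x) * F (walk n x))) =
        ennreal (G ^ n * (exp (t * walk n x) / G ^ n * (exp (- t * walk n x) * F (walk n x))))"
      using G F by (simp add: flip: ennreal_mult)
    also have "G ^ n * (exp (t * walk n x) / G ^ n * (exp (- t * walk n x) * F (walk n x))) =
        (exp (t * walk n x) * exp (- t * walk n x)) * F (walk n x)" using G by simp
    also have "exp (t * walk n x) * exp (- t * walk n x) = 1" by (simp flip: exp_add)
    finally show "ennreal (G ^ n) * (ennreal (exp (t * walk n x) / G ^ n) * ennreal (exp (- t * walk n x) * F (walk n x))) =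
        ennreal (F (walk n x))" by simp
  qed
  finally show ?thesis by simp
qed

end

end

text \<open>For \<open>s \<ge> 0\<close> the logarithm grows linearly; of the rate
  \<open>t \<ge> 2 * \<kappa>\<close>, one \<kappa> absorbs this growth and one remains. For
  \<open>s < 0\<close>, \<open>ln (1 + exp s) \<le> exp s\<close> leaves the rate
  \<open>1 - t\<close>.\<close>

lemma ln_one_plus_exp_bound:
  fixes t s \<kappa> :: real
  assumes \<kappa>: "0 < \<kappa>" "2 * \<kappa> \<le> t" "2 * \<kappa> \<le> 1 - t"
  shows "exp (- t * s) * ln (1 + exp s) \<le> (1 + 1 / \<kappa>) * exp (- \<kappa> * \<bar>s\<bar>)"
proof (cases "0 \<le> s")
  case True
  have "ln (1 + exp s) \<le> ln (2 * exp s)" using True by (subst ln_le_cancel_iff) (auto simp: add_pos_pos)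
  also have "\<dots> = ln 2 + s" by (simp add: ln_mult)
  also have "\<dots> \<le> 1 + s" using ln_2_less_1 by simp
  also have "1 + s \<le> (1 + 1 / \<kappa>) * exp (\<kappa> * s)"
  proof -
    have 1: "1 \<le> exp (\<kappa> * s)" using \<kappa> True by simp
    have "\<kappa> * s \<le> exp (\<kappa> * s)" using exp_ge_add_one_self[of "\<kappa> * s"] by linarith
    then have "s \<le> 1 / \<kappa> * exp (\<kappa> * s)" using \<kappa> by (simp add: field_simps)
    with 1 show ?thesis unfolding distrib_right by linarith
  qed
  finally have "exp (- t * s) * ln (1 + exp s) \<le> exp (- t * s) * ((1 + 1 / \<kappa>) * exp (\<kappa> * s))"
    by (intro mult_left_mono) auto
  also have "\<dots> = (1 + 1 / \<kappa>) * exp (- (t - \<kappa>) * s)" by (simp add: algebra_simps flip: exp_add)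
  also have "\<dots> \<le> (1 + 1 / \<kappa>) * exp (- \<kappa> * \<bar>s\<bar>)"
  proof (rule mult_left_mono)
    have "\<kappa> * s \<le> (t - \<kappa>) * s" using \<kappa> True by (intro mult_right_mono) auto
    then show "exp (- (t - \<kappa>) * s) \<le> exp (- \<kappa> * \<bar>s\<bar>)" using True by (simp add: left_diff_distrib)
  qed (use \<kappa> in auto)
  finally show ?thesis .
next
  case False
  have "exp (- t * s) * ln (1 + exp s) \<le> exp (- t * s) * exp s"
    by (intro mult_left_mono ln_add_one_self_le_self) auto
  also have "\<dots> = exp ((1 - t) * s)" by (simp add: algebra_simps flip: exp_add)
  also have "\<dots> \<le> exp (- \<kappa> * \<bar>s\<bar>)"
    using mult_right_mono_neg[of \<kappa> "1 - t" s] \<kappa> False by simp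
  also have "\<dots> \<le> (1 + 1 / \<kappa>) * exp (- \<kappa> * \<bar>s\<bar>)"
    using \<kappa> mult_right_mono[of 1 "1 + 1 / \<kappa>" "exp (- \<kappa> * \<bar>s\<bar>)"] by simp
  finally show ?thesis .
qed

lemma exp_minus_abs_le_cauchy:
  fixes \<kappa> d s :: real
  assumes \<kappa>: "0 < \<kappa>"
  shows "exp (- \<kappa> * \<bar>s\<bar>) \<le> (1 + 2 * d\<^sup>2 / \<kappa>\<^sup>2) / (1 + (d * s)\<^sup>2)"
proof -
  let ?E = "exp (\<kappa> * \<bar>s\<bar>)"
  have "(d * s)\<^sup>2 = d\<^sup>2 / \<kappa>\<^sup>2 * (\<kappa> * s)\<^sup>2" using \<kappa> by (simp add: power_mult_distrib)
  also have "\<dots> \<le> d\<^sup>2 / \<kappa>\<^sup>2 * (2 * ?E)"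
    using square_le_exp[of "\<kappa> * s"] \<kappa> by (intro mult_left_mono) (auto simp: abs_mult)
  finally have "1 + (d * s)\<^sup>2 \<le> (1 + 2 * d\<^sup>2 / \<kappa>\<^sup>2) * ?E"
    using \<kappa> by (simp add: algebra_simps add_mono)
  then have "exp (- \<kappa> * \<bar>s\<bar>) * (1 + (d * s)\<^sup>2) \<le> exp (- \<kappa> * \<bar>s\<bar>) * ((1 + 2 * d\<^sup>2 / \<kappa>\<^sup>2) * ?E)"
    by (intro mult_left_mono) auto
  also have "\<dots> = 1 + 2 * d\<^sup>2 / \<kappa>\<^sup>2" by (simp add: exp_minus)
  finally show ?thesis by (simp add: pos_le_divide_eq add_pos_nonneg)
qed

text \<open>Minimality on both sides of \<open>t\<close> says that the tilted step has exponential
  moments at least 1 around 0, hence mean 0. The upper bound then follows from the Cauchy profile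
  and the lower bound from the window, whose probability is of order
  \<open>1 / sqrt n\<close>.\<close>

lemma (in iid_walk) interior_asymptotics:
  assumes t: "0 < t" "t < 1" and G: "0 < G" and GI: "(\<integral>\<^sup>+x. ennreal (exp (t * Z x)) \<partial>N) = ennreal G"
    and e: "0 < e"
    and fin: "\<And>u. \<bar>u\<bar> \<le> e \<Longrightarrow> (\<integral>\<^sup>+x. ennreal (exp ((t + u) * Z x)) \<partial>N) < \<infinity>"
    and min: "\<And>u. \<bar>u\<bar> \<le> e \<Longrightarrow> ennreal G \<le> (\<integral>\<^sup>+x. ennreal (exp ((t + u) * Z x)) \<partial>N)"
    and nz: "\<not> (AE x in N. Z x = 0)"
  obtains c C where "0 < c" "0 < C"
    "\<And>n. 0 < n \<Longrightarrow> (\<integral>\<^sup>+x. ennreal (ln (1 + exp (walk n x))) \<partial>law n) \<le> ennreal (C * (G ^ n / sqrt (real n)))"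
    "\<forall>\<^sub>F n in sequentially. ennreal (c * (G ^ n / sqrt (real n))) \<le> (\<integral>\<^sup>+x. ennreal (min 1 (exp (walk n x))) \<partial>law n)"
proof -
  interpret T: iid_walk "tilt t G" Z by (rule iid_walk_tilt[OF G GI])
  have Tint: "integrable (tilt t G) (\<lambda>x. exp (u * Z x))"
    and Tge: "1 \<le> (\<integral>x. exp (u * Z x) \<partial>tilt t G)" if u: "\<bar>u\<bar> \<le> e" for u
  proof -
    have "(\<integral>\<^sup>+x. ennreal (exp (u * Z x)) \<partial>tilt t G) < \<infinity>"
      using fin[OF u] G by (simp add: nn_integral_exp_tilt[OF G GI] ennreal_divide_eq_top_iff less_top[symmetric])
    then show i: "integrable (tilt t G) (\<lambda>x. exp (u * Z x))" by (auto simp: integrable_iff_bounded)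
    have "1 = ennreal G / ennreal G" using G by (simp add: ennreal_divide_self)
    also have "\<dots> \<le> (\<integral>\<^sup>+x. ennreal (exp (u * Z x)) \<partial>tilt t G)"
      unfolding nn_integral_exp_tilt[OF G GI] by (intro divide_right_mono_ennreal min u)
    also have "\<dots> = ennreal (\<integral>x. exp (u * Z x) \<partial>tilt t G)" using i by (intro nn_integral_eq_integral) auto
    finally show "1 \<le> (\<integral>x. exp (u * Z x) \<partial>tilt t G)" by simp
  qed
  have mz: "integrable (tilt t G) (\<lambda>x. (Z x)\<^sup>2)" "(\<integral>x. Z x \<partial>tilt t G) = 0"
    using T.mean_zero_if_exp_ge_1[OF e Tint Tint Tge] e by auto
  have nd: "0 < (\<integral>x. (Z x)\<^sup>2 \<partial>tilt t G)"
  proof -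
    have "(\<integral>x. (Z x)\<^sup>2 \<partial>tilt t G) \<noteq> 0"
    proof
      assume "(\<integral>x. (Z x)\<^sup>2 \<partial>tilt t G) = 0"
      then have "AE x in tilt t G. (Z x)\<^sup>2 = 0"
        using mz(1) by (subst (asm) integral_nonneg_eq_0_iff_AE) auto
      then show False using nz by (simp add: AE_tilt[OF G GI])
    qed
    moreover have "0 \<le> (\<integral>x. (Z x)\<^sup>2 \<partial>tilt t G)" by (intro integral_nonneg_AE) auto
    ultimately show ?thesis by linarith
  qed
  interpret T: centered_walk "tilt t G" Z by unfold_locales (use mz nd in auto)
  obtain d A where d: "0 < d" and A: "0 < A"
    and cb: "\<And>n. 0 < n \<Longrightarrow> (\<integral>x. d / (1 + (d * walk n x)\<^sup>2) \<partial>T.law n) \<le> A / sqrt (real n)"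
    using T.expectation_cauchy_le by (metis order_refl)
  obtain B c where c: "0 < c"
    and win: "\<forall>\<^sub>F n in sequentially. c / sqrt (real n) \<le> measure (T.law n) {x \<in> space (T.law n). \<bar>walk n x\<bar> \<le> B}"
    using T.prob_window_ge by blast
  define \<kappa> where "\<kappa> = min t (1 - t) / 2"
  have \<kappa>: "0 < \<kappa>" "2 * \<kappa> \<le> t" "2 * \<kappa> \<le> 1 - t" using t by (auto simp: \<kappa>_def)
  define D where "D = (1 + 1 / \<kappa>) * ((1 + 2 * d\<^sup>2 / \<kappa>\<^sup>2) / d)"
  have D: "0 < D" unfolding D_def using \<kappa> d by (intro mult_pos_pos divide_pos_pos add_pos_nonneg) auto
  have walkT [measurable]: "walk n \<in> borel_measurable (T.law n)" for n by (rule T.walk_measurable)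
  show ?thesis
  proof (rule that[of "exp (- B) * c" "D * A"])
    fix n :: nat assume n: "0 < n"
    interpret L: prob_space "T.law n" by (rule T.prob_space_law)
    have ic: "integrable (T.law n) (\<lambda>x. d / (1 + (d * walk n x)\<^sup>2))"
    proof (rule L.integrable_const_bound[of _ d])
      show "AE x in T.law n. norm (d / (1 + (d * walk n x)\<^sup>2)) \<le> d"
        using d by (intro AE_I2) (simp add: divide_le_eq add_pos_nonneg abs_of_pos mult_le_cancel_left1)
    qed measurable
    have "(\<integral>\<^sup>+x. ennreal (exp (- t * walk n x) * ln (1 + exp (walk n x))) \<partial>T.law n) \<le>
        (\<integral>\<^sup>+x. ennreal (D * (d / (1 + (d * walk n x)\<^sup>2))) \<partial>T.law n)"
    proof (intro nn_integral_mono ennreal_leI)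
      fix x
      have "exp (- t * walk n x) * ln (1 + exp (walk n x)) \<le> (1 + 1 / \<kappa>) * exp (- \<kappa> * \<bar>walk n x\<bar>)"
        by (rule ln_one_plus_exp_bound[OF \<kappa>])
      also have "\<dots> \<le> (1 + 1 / \<kappa>) * ((1 + 2 * d\<^sup>2 / \<kappa>\<^sup>2) / (1 + (d * walk n x)\<^sup>2))"
        using \<kappa> by (intro mult_left_mono exp_minus_abs_le_cauchy) auto
      also have "\<dots> = D * (d / (1 + (d * walk n x)\<^sup>2))" using d by (simp add: D_def)
      finally show "exp (- t * walk n x) * ln (1 + exp (walk n x)) \<le> D * (d / (1 + (d * walk n x)\<^sup>2))" .
    qed
    also have "\<dots> = ennreal (\<integral>x. D * (d / (1 + (d * walk n x)\<^sup>2)) \<partial>T.law n)"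
      using ic D d by (intro nn_integral_eq_integral integrable_mult_right AE_I2 mult_nonneg_nonneg divide_nonneg_nonneg add_nonneg_nonneg) auto
    also have "(\<integral>x. D * (d / (1 + (d * walk n x)\<^sup>2)) \<partial>T.law n) = D * (\<integral>x. d / (1 + (d * walk n x)\<^sup>2) \<partial>T.law n)"
      by (rule integral_mult_right_zero)
    also have "ennreal \<dots> \<le> ennreal (D * (A / sqrt (real n)))"
      using D n by (intro ennreal_leI mult_left_mono cb) auto
    finally have le: "(\<integral>\<^sup>+x. ennreal (exp (- t * walk n x) * ln (1 + exp (walk n x))) \<partial>T.law n) \<le> ennreal (D * (A / sqrt (real n)))" .
    have "(\<integral>\<^sup>+x. ennreal (ln (1 + exp (walk n x))) \<partial>law n) =
        ennreal (G ^ n) * (\<integral>\<^sup>+x. ennreal (exp (- t * walk n x) * ln (1 + exp (walk n x))) \<partial>T.law n)"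
      by (rule nn_integral_walk_tilt[OF G GI]) (auto intro!: ln_ge_zero)
    also have "\<dots> \<le> ennreal (G ^ n) * ennreal (D * (A / sqrt (real n)))"
      by (intro mult_left_mono le) auto
    also have "\<dots> = ennreal (D * A * (G ^ n / sqrt (real n)))"
      using G D A by (subst ennreal_mult[symmetric]) (auto simp: ac_simps)
    finally show "(\<integral>\<^sup>+x. ennreal (ln (1 + exp (walk n x))) \<partial>law n) \<le> ennreal (D * A * (G ^ n / sqrt (real n)))" .
  next
    show "\<forall>\<^sub>F n in sequentially. ennreal (exp (- B) * c * (G ^ n / sqrt (real n))) \<le>
        (\<integral>\<^sup>+x. ennreal (min 1 (exp (walk n x))) \<partial>law n)"
      using win
    proof eventually_elim
      case (elim n)
      interpret L: prob_space "T.law n" by (rule T.prob_space_law)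
      let ?W = "{x \<in> space (T.law n). \<bar>walk n x\<bar> \<le> B}"
      have W [measurable]: "?W \<in> sets (T.law n)" by measurable
      have "ennreal (exp (- B) * c * (G ^ n / sqrt (real n))) = ennreal (G ^ n) * (ennreal (exp (- B)) * ennreal (c / sqrt (real n)))"
        using G c by (simp add: ennreal_mult[symmetric] ac_simps)
      also have "\<dots> \<le> ennreal (G ^ n) * (ennreal (exp (- B)) * emeasure (T.law n) ?W)"
        using elim unfolding L.emeasure_eq_measure by (intro mult_left_mono ennreal_leI) auto
      finally have a: "ennreal (exp (- B) * c * (G ^ n / sqrt (real n))) \<le>
          ennreal (G ^ n) * (ennreal (exp (- B)) * emeasure (T.law n) ?W)" .
      have "ennreal (exp (- B)) * emeasure (T.law n) ?W = (\<integral>\<^sup>+x. ennreal (exp (- B)) * indicator ?W x \<partial>T.law n)"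
        using W by (simp add: nn_integral_cmult)
      also have "\<dots> \<le> (\<integral>\<^sup>+x. ennreal (exp (- t * walk n x) * min 1 (exp (walk n x))) \<partial>T.law n)"
      proof (intro nn_integral_mono)
        fix x
        show "ennreal (exp (- B)) * indicator ?W x \<le> ennreal (exp (- t * walk n x) * min 1 (exp (walk n x)))"
        proof (cases "x \<in> ?W")
          case True
          then have w: "\<bar>walk n x\<bar> \<le> B" by simp
          \<comment> \<open>For \<open>0 < t < 1\<close> the left factor times the minimum is at
            least \<open>exp (- \<bar>walk n x\<bar>)\<close> for either sign of the walk.\<close>
          have "exp (- B) \<le> exp (- t * walk n x) * min 1 (exp (walk n x))"
          proof (cases "0 \<le> walk n x")
            case True
            then have "t * walk n x \<le> 1 * walk n x" using t by (intro mult_right_mono) auto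
            then show ?thesis using True w by simp
          next
            case False
            then have "exp (- t * walk n x) * min 1 (exp (walk n x)) = exp ((1 - t) * walk n x)"
              by (simp add: min_def algebra_simps flip: exp_add)
            moreover have "1 * walk n x \<le> (1 - t) * walk n x"
              using t False by (intro mult_right_mono_neg) auto
            moreover have "- B \<le> 1 * walk n x" using False w by simp
            ultimately show ?thesis by (simp only: exp_le_cancel_iff order_trans)
          qed
          then show ?thesis using True by (simp add: ennreal_leI)
        qed simp
      qed
      finally have b: "ennreal (exp (- B)) * emeasure (T.law n) ?W \<le>
          (\<integral>\<^sup>+x. ennreal (exp (- t * walk n x) * min 1 (exp (walk n x))) \<partial>T.law n)" .
      have "(\<integral>\<^sup>+x. ennreal (min 1 (exp (walk n x))) \<partial>law n) =
          ennreal (G ^ n) * (\<integral>\<^sup>+x. ennreal (exp (- t * walk n x) * min 1 (exp (walk n x))) \<partial>T.law n)"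
        by (rule nn_integral_walk_tilt[OF G GI]) auto
      with order_trans[OF a mult_left_mono[OF b]] show ?case by simp
    qed
  qed (use c D A in auto)
qed

text \<open>Under the tilt at 1 the integrand \<open>exp (- S) * ln (1 + exp S)\<close> never
  exceeds 1, and \<open>exp (- S) * min 1 (exp S)\<close> equals 1 on \<open>S \<le> 0\<close>.
  Minimality is known only to the left of 1 and says that the tilted walk does not drift
  upwards.\<close>

lemma (in iid_walk) boundary_asymptotics:
  assumes G: "0 < G" and GI: "(\<integral>\<^sup>+x. ennreal (exp (Z x)) \<partial>N) = ennreal G"
    and fin: "\<And>u. 0 \<le> u \<Longrightarrow> u \<le> 1 \<Longrightarrow> (\<integral>\<^sup>+x. ennreal (exp (u * Z x)) \<partial>N) < \<infinity>"
    and min: "\<And>u. 0 \<le> u \<Longrightarrow> u \<le> 1 \<Longrightarrow> ennreal G \<le> (\<integral>\<^sup>+x. ennreal (exp (u * Z x)) \<partial>N)"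
    and nz: "\<not> (AE x in N. Z x = 0)"
  obtains c where "0 < c"
    "\<And>n. (\<integral>\<^sup>+x. ennreal (ln (1 + exp (walk n x))) \<partial>law n) \<le> ennreal (G ^ n)"
    "\<forall>\<^sub>F n in sequentially. ennreal (c * G ^ n) \<le> (\<integral>\<^sup>+x. ennreal (min 1 (exp (walk n x))) \<partial>law n)"
proof -
  have GI': "(\<integral>\<^sup>+x. ennreal (exp (1 * Z x)) \<partial>N) = ennreal G" using GI by simp
  interpret T: iid_walk "tilt 1 G" Z by (rule iid_walk_tilt[OF G GI'])
  have Tint: "integrable (tilt 1 G) (\<lambda>x. exp (- u * Z x))"
    and Tge: "1 \<le> (\<integral>x. exp (- u * Z x) \<partial>tilt 1 G)" if u: "0 \<le> u" "u \<le> 1" for u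
  proof -
    have "(\<integral>\<^sup>+x. ennreal (exp (- u * Z x)) \<partial>tilt 1 G) < \<infinity>"
      using fin[of "1 - u"] u G unfolding nn_integral_exp_tilt[OF G GI'] by (simp add: ennreal_divide_eq_top_iff less_top[symmetric])
    then show i: "integrable (tilt 1 G) (\<lambda>x. exp (- u * Z x))" by (auto simp: integrable_iff_bounded)
    have "1 = ennreal G / ennreal G" using G by (simp add: ennreal_divide_self)
    also have "\<dots> \<le> (\<integral>\<^sup>+x. ennreal (exp (- u * Z x)) \<partial>tilt 1 G)"
      unfolding nn_integral_exp_tilt[OF G GI'] using min[of "1 - u"] u by (intro divide_right_mono_ennreal) auto
    also have "\<dots> = ennreal (\<integral>x. exp (- u * Z x) \<partial>tilt 1 G)" using i by (intro nn_integral_eq_integral) auto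
    finally show "1 \<le> (\<integral>x. exp (- u * Z x) \<partial>tilt 1 G)" by simp
  qed
  have nzT: "\<not> (AE x in tilt 1 G. Z x = 0)" using nz by (simp add: AE_tilt[OF G GI'])
  obtain c where c: "0 < c"
    and win: "\<forall>\<^sub>F n in sequentially. c \<le> measure (T.law n) {x \<in> space (T.law n). walk n x \<le> 0}"
    using T.prob_walk_nonpos_ge[OF Tint Tge nzT] by blast
  have walkT [measurable]: "walk n \<in> borel_measurable (T.law n)" for n by (rule T.walk_measurable)
  show ?thesis
  proof (rule that[OF c])
    fix n
    interpret L: prob_space "T.law n" by (rule T.prob_space_law)
    have "(\<integral>\<^sup>+x. ennreal (ln (1 + exp (walk n x))) \<partial>law n) =
        ennreal (G ^ n) * (\<integral>\<^sup>+x. ennreal (exp (- 1 * walk n x) * ln (1 + exp (walk n x))) \<partial>T.law n)"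
      by (rule nn_integral_walk_tilt[OF G GI']) (auto intro!: ln_ge_zero)
    also have "\<dots> \<le> ennreal (G ^ n) * (\<integral>\<^sup>+x. 1 \<partial>T.law n)"
    proof (intro mult_left_mono nn_integral_mono)
      fix x
      have "exp (- 1 * walk n x) * ln (1 + exp (walk n x)) \<le> exp (- 1 * walk n x) * exp (walk n x)"
        by (intro mult_left_mono ln_add_one_self_le_self) auto
      also have "\<dots> = 1" by (simp flip: exp_add)
      finally show "ennreal (exp (- 1 * walk n x) * ln (1 + exp (walk n x))) \<le> 1"
        by (simp add: ennreal_le_1)
    qed auto
    also have "\<dots> = ennreal (G ^ n)" by (simp add: L.emeasure_space_1)
    finally show "(\<integral>\<^sup>+x. ennreal (ln (1 + exp (walk n x))) \<partial>law n) \<le> ennreal (G ^ n)" .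
  next
    show "\<forall>\<^sub>F n in sequentially. ennreal (c * G ^ n) \<le> (\<integral>\<^sup>+x. ennreal (min 1 (exp (walk n x))) \<partial>law n)"
      using win
    proof eventually_elim
      case (elim n)
      interpret L: prob_space "T.law n" by (rule T.prob_space_law)
      let ?W = "{x \<in> space (T.law n). walk n x \<le> 0}"
      have W [measurable]: "?W \<in> sets (T.law n)" by measurable
      have "ennreal (c * G ^ n) = ennreal (G ^ n) * ennreal c"
        using G c by (simp add: ennreal_mult[symmetric] ac_simps)
      also have "\<dots> \<le> ennreal (G ^ n) * emeasure (T.law n) ?W"
        using elim unfolding L.emeasure_eq_measure by (intro mult_left_mono ennreal_leI) auto
      finally have a: "ennreal (c * G ^ n) \<le> ennreal (G ^ n) * emeasure (T.law n) ?W" .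
      have "emeasure (T.law n) ?W = (\<integral>\<^sup>+x. indicator ?W x \<partial>T.law n)"
        using W by simp
      also have "\<dots> \<le> (\<integral>\<^sup>+x. ennreal (exp (- 1 * walk n x) * min 1 (exp (walk n x))) \<partial>T.law n)"
      proof (intro nn_integral_mono)
        fix x
        show "indicator ?W x \<le> ennreal (exp (- 1 * walk n x) * min 1 (exp (walk n x)))"
          by (auto simp: indicator_def exp_minus)
      qed
      finally have b: "emeasure (T.law n) ?W \<le>
          (\<integral>\<^sup>+x. ennreal (exp (- 1 * walk n x) * min 1 (exp (walk n x))) \<partial>T.law n)" .
      have "(\<integral>\<^sup>+x. ennreal (min 1 (exp (walk n x))) \<partial>law n) =
          ennreal (G ^ n) * (\<integral>\<^sup>+x. ennreal (exp (- 1 * walk n x) * min 1 (exp (walk n x))) \<partial>T.law n)"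
        by (rule nn_integral_walk_tilt[OF G GI']) auto
      with order_trans[OF a mult_left_mono[OF b]] show ?case by simp
    qed
  qed
qed

section \<open>The optimal tilting parameter\<close>

context iid_walk
begin

definition mgf :: "real \<Rightarrow> ennreal" where
  "mgf \<tau> = (\<integral>\<^sup>+x. ennreal (exp (\<tau> * Z x)) \<partial>N)"

lemma mgf_0: "mgf 0 = 1"
  by (simp add: mgf_def emeasure_space_1)

lemma mgf_pos: "0 < mgf \<tau>"
proof -
  have "mgf \<tau> \<noteq> 0"
  proof
    assume "mgf \<tau> = 0"
    then have "AE x in N. ennreal (exp (\<tau> * Z x)) = 0"
      unfolding mgf_def by (subst (asm) nn_integral_0_iff_AE) auto
    then have "AE x in N. False" by eventually_elim simp
    then show False by simp
  qed
  then show ?thesis by (simp add: zero_less_iff_neq_zero)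
qed

lemma mgf_finite_between:
  assumes "mgf b < \<infinity>" "0 \<le> \<tau> \<and> \<tau> \<le> b \<or> b \<le> \<tau> \<and> \<tau> \<le> 0"
  shows "mgf \<tau> < \<infinity>"
proof -
  have "mgf \<tau> \<le> (\<integral>\<^sup>+x. 1 + ennreal (exp (b * Z x)) \<partial>N)"
    unfolding mgf_def
  proof (rule nn_integral_mono)
    fix x
    have "\<tau> * z \<le> 0 \<or> \<tau> * z \<le> b * z" for z :: real
    proof (cases "0 \<le> z")
      case True
      then show ?thesis using assms(2) by (auto intro: mult_right_mono mult_nonpos_nonneg)
    next
      case False
      then show ?thesis using assms(2) by (auto intro: mult_right_mono_neg mult_nonneg_nonpos)
    qed
    from this[of "Z x"] have "exp (\<tau> * Z x) \<le> 1 + exp (b * Z x)"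
      by (auto intro: add_increasing add_increasing2)
    then have "ennreal (exp (\<tau> * Z x)) \<le> ennreal (1 + exp (b * Z x))" by (rule ennreal_leI)
    then show "ennreal (exp (\<tau> * Z x)) \<le> 1 + ennreal (exp (b * Z x))" by simp
  qed
  also have "\<dots> = 1 + mgf b"
    unfolding mgf_def by (subst nn_integral_add) (auto simp: emeasure_space_1)
  also have "\<dots> < \<infinity>" using assms(1) by simp
  finally show ?thesis .
qed

lemma integrable_exp_iff_mgf: "integrable N (\<lambda>x. exp (\<tau> * Z x)) \<longleftrightarrow> mgf \<tau> < \<infinity>"
  by (simp add: integrable_iff_bounded mgf_def)

lemma mgf_eq_integral: "mgf \<tau> < \<infinity> \<Longrightarrow> mgf \<tau> = ennreal (\<integral>x. exp (\<tau> * Z x) \<partial>N)"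
  unfolding mgf_def by (intro nn_integral_eq_integral) (auto simp: integrable_exp_iff_mgf mgf_def)

text \<open>The moment generating function is lower semicontinuous by Fatou's lemma; it may jump to
  \<open>\<infinity>\<close>, so that continuity is not available.\<close>

lemma mgf_attains_min:
  obtains a where "a \<in> {0..1}" "\<And>\<tau>. \<tau> \<in> {0..1} \<Longrightarrow> mgf a \<le> mgf \<tau>"
proof -
  have "mgf ` {0..1} \<noteq> {}" by simp
  from ennreal_Inf_countable_INF[OF this] obtain f :: "nat \<Rightarrow> ennreal" where
    f: "decseq f" "range f \<subseteq> mgf ` {0..1}" "Inf (mgf ` {0..1}) = (INF i. f i)" by blast
  have "\<forall>k. \<exists>\<tau>. \<tau> \<in> {0..1} \<and> f k = mgf \<tau>" using f(2) by blast
  then obtain \<tau> where \<tau>: "\<And>k. \<tau> k \<in> {0..1}" "\<And>k. f k = mgf (\<tau> k)" by metis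
  have "compact {0..1::real}" by simp
  then have "seq_compact {0..1::real}" by (rule compact_imp_seq_compact)
  then obtain a r where a: "a \<in> {0..1}" and r: "strict_mono r" and lim: "(\<tau> \<circ> r) \<longlonglongrightarrow> a"
    using \<tau>(1) unfolding seq_compact_def by blast
  have "mgf a = (\<integral>\<^sup>+x. liminf (\<lambda>k. ennreal (exp ((\<tau> \<circ> r) k * Z x))) \<partial>N)"
    unfolding mgf_def
  proof (intro nn_integral_cong)
    fix x
    have "(\<lambda>k. ennreal (exp ((\<tau> \<circ> r) k * Z x))) \<longlonglongrightarrow> ennreal (exp (a * Z x))"
      by (intro tendsto_ennrealI tendsto_intros lim)
    then show "ennreal (exp (a * Z x)) = liminf (\<lambda>k. ennreal (exp ((\<tau> \<circ> r) k * Z x)))"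
      by (rule lim_imp_Liminf[OF sequentially_bot, symmetric])
  qed
  also have "\<dots> \<le> liminf (\<lambda>k. mgf ((\<tau> \<circ> r) k))"
    unfolding mgf_def by (intro nn_integral_liminf) auto
  also have "(\<lambda>k. mgf ((\<tau> \<circ> r) k)) = f \<circ> r" using \<tau>(2) by auto
  also have "liminf (f \<circ> r) = (INF i. f i)"
    using LIMSEQ_subseq_LIMSEQ[OF LIMSEQ_INF[OF f(1)] r] by (simp add: lim_imp_Liminf)
  finally have "mgf a \<le> Inf (mgf ` {0..1})" using f(3) by simp
  then have "mgf a \<le> mgf \<tau>" if "\<tau> \<in> {0..1}" for \<tau>
    by (rule order_trans) (use that in \<open>intro Inf_lower imageI\<close>)
  with a show ?thesis by (rule that)
qed

end

section \<open>The walk with information density steps\<close>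

lemma iid_walk_info_density:
  assumes PX: "prob_space PX" and K: "K \<in> PX \<rightarrow>\<^sub>M prob_algebra MY"
  shows "iid_walk (joint_law PX MY K) (\<lambda>z. info_density PX MY K z - R)"
proof -
  have "sets (joint_law PX MY K) = sets (product_law PX MY K)"
    unfolding sets_joint_law[OF PX K] product_law_def output_law_def
    by (intro sets_pair_measure_cong) auto
  from measurable_cong_sets[OF this refl, of borel]
  have "info_density PX MY K \<in> borel_measurable (joint_law PX MY K)"
    unfolding info_density_def by (metis measurable_entropy_density)
  then show ?thesis
    unfolding iid_walk_def iid_walk_axioms_def using prob_space_joint_law[OF PX K] by simp
qed

text \<open>With \<open>R\<close> absorbed into the step, the objective maximised by
  \<open>tau_star\<close> is minus the logarithm of this function.\<close>

lemma mgf_info_density: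
  assumes PX: "prob_space PX" and K: "K \<in> PX \<rightarrow>\<^sub>M prob_algebra MY"
  shows "iid_walk.mgf (joint_law PX MY K) (\<lambda>z. info_density PX MY K z - R) \<tau> =
    ennreal (exp (- \<tau> * R)) * info_mgf PX MY K \<tau>"
proof -
  have [measurable]: "info_density PX MY K \<in> borel_measurable (joint_law PX MY K)"
    using iid_walk.Z[OF iid_walk_info_density[OF PX K, of 0]] by simp
  interpret W: iid_walk "joint_law PX MY K" "\<lambda>z. info_density PX MY K z - R"
    by (rule iid_walk_info_density[OF PX K])
  have "W.mgf \<tau> = (\<integral>\<^sup>+z. ennreal (exp (- \<tau> * R)) * ennreal (exp (\<tau> * info_density PX MY K z)) \<partial>joint_law PX MY K)"
    unfolding W.mgf_def
  proof (intro nn_integral_cong)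
    fix z
    have "exp (\<tau> * (info_density PX MY K z - R)) = exp (- \<tau> * R) * exp (\<tau> * info_density PX MY K z)"
      by (simp add: right_diff_distrib flip: exp_add)
    then show "ennreal (exp (\<tau> * (info_density PX MY K z - R))) =
        ennreal (exp (- \<tau> * R)) * ennreal (exp (\<tau> * info_density PX MY K z))"
      by (simp only: ennreal_mult exp_ge_zero)
  qed
  also have "\<dots> = ennreal (exp (- \<tau> * R)) * info_mgf PX MY K \<tau>"
    unfolding info_mgf_def by (intro nn_integral_cmult) measurable
  finally show ?thesis .
qed

text \<open>\<open>tau_star\<close> is a Hilbert choice and means something only once a maximiser
  exists; \<open>mgf_attains_min\<close> supplies one.\<close>

lemma tau_star_minimizes:
  fixes R :: real
  assumes PX: "prob_space PX" and K: "K \<in> PX \<rightarrow>\<^sub>M prob_algebra MY"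
  defines "G \<equiv> iid_walk.mgf (joint_law PX MY K) (\<lambda>z. info_density PX MY K z - R)"
  shows "tau_star PX MY K R \<in> {0..1}"
    and "\<And>\<tau>. \<tau> \<in> {0..1} \<Longrightarrow> G (tau_star PX MY K R) \<le> G \<tau>"
proof -
  interpret W: iid_walk "joint_law PX MY K" "\<lambda>z. info_density PX MY K z - R"
    by (rule iid_walk_info_density[OF PX K])
  define f where "f \<tau> = ereal (\<tau> * R) - info_log_mgf PX MY K \<tau>" for \<tau>
  have G: "G \<tau> = ennreal (exp (- \<tau> * R)) * info_mgf PX MY K \<tau>" for \<tau>
    unfolding G_def by (rule mgf_info_density[OF PX K])
  have f: "f \<tau> = (if G \<tau> = \<infinity> then - \<infinity> else ereal (- ln (enn2real (G \<tau>))))" for \<tau>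
  proof (cases "info_mgf PX MY K \<tau> = \<infinity>")
    case True
    then have "G \<tau> = \<infinity>" by (simp add: G ennreal_mult_top)
    then show ?thesis using True by (simp add: f_def info_log_mgf_def)
  next
    case False
    then obtain m where m: "info_mgf PX MY K \<tau> = ennreal m" "0 \<le> m" by (cases "info_mgf PX MY K \<tau>") auto
    have Gm: "G \<tau> = ennreal (exp (- \<tau> * R) * m)" by (simp add: G m ennreal_mult)
    have "0 < m" using W.mgf_pos[of \<tau>] m unfolding G_def[symmetric] Gm by (cases "m = 0") auto
    then show ?thesis using False by (simp add: f_def info_log_mgf_def m Gm ln_mult)
  qed
  \<comment> \<open>The objective reverses the order of \<open>G\<close> also at infinite values, so
    maximisers of \<open>f\<close> and minimisers of \<open>G\<close> coincide.\<close>
  have lt: "f a < f b \<longleftrightarrow> G b < G a" for a b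
  proof -
    have pos: "0 < enn2real (G \<tau>)" if "G \<tau> \<noteq> \<infinity>" for \<tau>
      using that W.mgf_pos[of \<tau>] by (simp add: enn2real_positive_iff G_def less_top)
    show ?thesis
    proof (cases "G a = \<infinity>"; cases "G b = \<infinity>")
      assume fin: "G a \<noteq> \<infinity>" "G b \<noteq> \<infinity>"
      then have "f a < f b \<longleftrightarrow> enn2real (G b) < enn2real (G a)" using pos by (simp add: f)
      also have "\<dots> \<longleftrightarrow> G b < G a"
        using fin by (cases "G a"; cases "G b") (auto simp: ennreal_less_iff)
      finally show ?thesis .
    qed (auto simp: f less_top)
  qed
  obtain a where a: "a \<in> {0..1}" "\<And>\<tau>. \<tau> \<in> {0..1} \<Longrightarrow> G a \<le> G \<tau>"
    using W.mgf_attains_min unfolding G_def by blast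
  have "is_arg_max f (\<lambda>\<tau>. \<tau> \<in> {0..1}) a"
    using a by (auto simp: is_arg_max_def lt not_less)
  then have "is_arg_max f (\<lambda>\<tau>. \<tau> \<in> {0..1}) (tau_star PX MY K R)"
    unfolding tau_star_def arg_max_on_def arg_max_def f_def[symmetric] by (rule someI)
  then show "tau_star PX MY K R \<in> {0..1}"
    and "\<And>\<tau>. \<tau> \<in> {0..1} \<Longrightarrow> G (tau_star PX MY K R) \<le> G \<tau>"
    by (auto simp: is_arg_max_def lt not_less)
qed

lemma num_codewords_bounds:
  assumes "0 < R" "0 < n"
  shows "2 \<le> num_codewords R n" "exp (real n * R) \<le> real (num_codewords R n)"
    "real (num_codewords R n) \<le> 2 * exp (real n * R)"
proof -
  have e: "1 < exp (real n * R)" using assms by simp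
  then have c: "1 < \<lceil>exp (real n * R)\<rceil>" by simp
  have r: "real (num_codewords R n) = of_int \<lceil>exp (real n * R)\<rceil>"
    using c by (simp add: num_codewords_def)
  have "2 \<le> \<lceil>exp (real n * R)\<rceil>" using c by linarith
  from nat_mono[OF this] show "2 \<le> num_codewords R n" unfolding num_codewords_def by (simp only: nat_numeral)
  show "exp (real n * R) \<le> real (num_codewords R n)" unfolding r by simp
  show "real (num_codewords R n) \<le> 2 * exp (real n * R)"
  proof -
    have "real_of_int \<lceil>exp (real n * R)\<rceil> \<le> exp (real n * R) + 1" by (rule of_int_ceiling_le_add_one)
    with less_imp_le[OF e] show ?thesis unfolding r by argo
  qed
qed

text \<open>Rounding up changes the codebook size by a factor of at most 2, so \<open>a\<close> lies
  between \<open>exp S / 2\<close> and \<open>exp S\<close>. The 8 collects this 2 and the 4 from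
  \<open>exp_rem_ge\<close>; the 24 is 8 times 3, from \<open>2 / M\<close> and
  \<open>Y / (4 * M) \<le> 1 / M\<close>.\<close>

lemma expected_divergence_walk_bounds:
  fixes PX :: "'a measure" and MY :: "'b measure" and K :: "'a \<Rightarrow> 'b measure"
  assumes PX: "prob_space PX" and K: "K \<in> PX \<rightarrow>\<^sub>M prob_algebra MY"
    and ac: "absolutely_continuous (product_law PX MY K) (joint_law PX MY K)"
    and version: "regular_version PX MY K" and R: "0 < R" and n: "0 < n"
  defines "S \<equiv> iid_walk.walk (\<lambda>z. info_density PX MY K z - R) n"
    and "J \<equiv> Pi\<^sub>M {..<n} (\<lambda>_. joint_law PX MY K)"
  shows "expected_divergence PX MY K R n \<le> (\<integral>\<^sup>+z. ennreal (ln (1 + exp (S z))) \<partial>J)"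
    and "(\<integral>\<^sup>+z. ennreal (min 1 (exp (S z))) \<partial>J) \<le>
      8 * expected_divergence PX MY K R n + ennreal (24 * exp (- real n * R))"
proof -
  interpret W: iid_walk "joint_law PX MY K" "\<lambda>z. info_density PX MY K z - R"
    by (rule iid_walk_info_density[OF PX K])
  interpret L: prob_space J unfolding J_def by (rule W.prob_space_law)
  define M where "M = num_codewords R n"
  have M: "2 \<le> M" "exp (real n * R) \<le> real M" "real M \<le> 2 * exp (real n * R)"
    unfolding M_def by (rule num_codewords_bounds[OF R n])+
  define a where "a z = exp (\<Sum>i<n. info_density PX MY K (z i)) / real M" for z
  have [measurable]: "S \<in> borel_measurable J" unfolding S_def J_def by (rule W.walk_measurable)
  have a_eq: "a z = exp (S z) * (exp (real n * R) / real M)" for z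
    by (simp add: a_def S_def W.walk_def sum_subtractf exp_diff)
  have "0 < real M" using M(1) by simp
  then have q: "exp (real n * R) / real M \<le> 1" "1 / 2 \<le> exp (real n * R) / real M"
    using M(2,3) by (simp_all add: pos_divide_le_eq pos_le_divide_eq)
  have ale: "a z \<le> exp (S z)" for z
    unfolding a_eq using mult_left_mono[OF q(1), of "exp (S z)"] by simp
  have age: "exp (S z) / 2 \<le> a z" for z
    unfolding a_eq using mult_left_mono[OF q(2), of "exp (S z)"] by simp
  have a0: "0 \<le> a z" for z by (simp add: a_def)
  note bounds = expected_divergence_bounds[OF PX K ac version M_def M(1),
      folded a_def, unfolded iid_law_def, folded J_def]
  have "expected_divergence PX MY K R n \<le> (\<integral>\<^sup>+z. ennreal (ln (1 + a z)) \<partial>J)" by (rule bounds(1))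
  also have "\<dots> \<le> (\<integral>\<^sup>+z. ennreal (ln (1 + exp (S z))) \<partial>J)"
  proof (intro nn_integral_mono ennreal_leI)
    fix z
    show "ln (1 + a z) \<le> ln (1 + exp (S z))"
    proof (rule ln_mono)
      show "0 < 1 + a z" using a0[of z] by linarith
    qed (use ale in simp)
  qed
  finally show "expected_divergence PX MY K R n \<le> (\<integral>\<^sup>+z. ennreal (ln (1 + exp (S z))) \<partial>J)" .
  define Y where "Y = (\<integral>z. min 1 (exp (S z)) \<partial>J)"
  have iY: "integrable J (\<lambda>z. min 1 (exp (S z)))"
    by (intro L.integrable_const_bound[of _ 1]) auto
  have Y: "(\<integral>\<^sup>+z. ennreal (min 1 (exp (S z))) \<partial>J) = ennreal Y" "0 \<le> Y"
    unfolding Y_def using iY by (auto intro!: nn_integral_eq_integral integral_nonneg_AE)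
  have Y1: "Y \<le> 1"
    using integral_mono[OF iY L.integrable_const[of 1]] by (simp add: Y_def L.prob_space)
  show "(\<integral>\<^sup>+z. ennreal (min 1 (exp (S z))) \<partial>J) \<le>
      8 * expected_divergence PX MY K R n + ennreal (24 * exp (- real n * R))"
  proof (cases "expected_divergence PX MY K R n")
    case (real D)
    have "ennreal (Y / 8) = (\<integral>\<^sup>+z. ennreal (min 1 (exp (S z)) / 8) \<partial>J)"
      using iY by (subst nn_integral_eq_integral) (auto simp: Y_def)
    also have "\<dots> \<le> (\<integral>\<^sup>+z. ennreal (min 1 (a z) / 4) \<partial>J)"
    proof (intro nn_integral_mono ennreal_leI)
      fix z
      have "min 1 u / 8 \<le> min 1 v / 4" if "u / 2 \<le> v" for u v :: real
        using that by (auto simp: min_def)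
      from this[OF age] show "min 1 (exp (S z)) / 8 \<le> min 1 (a z) / 4" .
    qed
    finally have "ennreal (1 - 2 / real M) * (1 + ennreal (Y / 8)) \<le>
        ennreal (1 - 2 / real M) * (1 + (\<integral>\<^sup>+z. ennreal (min 1 (a z) / 4) \<partial>J))"
      by (intro mult_left_mono add_left_mono) auto
    also have "\<dots> \<le> ennreal D + 1" using bounds(2) real by simp
    finally have "ennreal (1 - 2 / real M) * (1 + ennreal (Y / 8)) \<le> ennreal D + 1" .
    moreover have "ennreal ((1 - 2 / real M) * (1 + Y / 8)) = ennreal (1 - 2 / real M) * (1 + ennreal (Y / 8))"
      using M(1) Y(2) by (subst ennreal_mult) auto
    moreover have "ennreal D + 1 = ennreal (D + 1)" using real(1) by simp
    ultimately have "ennreal ((1 - 2 / real M) * (1 + Y / 8)) \<le> ennreal (D + 1)" by (simp only:)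
    moreover have "0 \<le> D + 1" using real(1) by simp
    ultimately have "(1 - 2 / real M) * (1 + Y / 8) \<le> D + 1" by (simp only: ennreal_le_iff)
    moreover have "(1 - 2 / real M) * (1 + Y / 8) = 1 + Y / 8 - 2 / real M - Y / 4 / real M"
      by (simp add: algebra_simps)
    moreover have "Y / 4 / real M \<le> 1 / real M" using Y1 by (intro divide_right_mono) auto
    ultimately have "Y / 8 \<le> D + 3 * (1 / real M)" by simp
    moreover have "1 / real M \<le> exp (- real n * R)"
    proof -
      have "1 / real M \<le> 1 / exp (real n * R)" using M(2) by (intro frac_le) auto
      then show ?thesis by (simp add: exp_minus inverse_eq_divide)
    qed
    ultimately have "Y \<le> 8 * D + 24 * exp (- real n * R)" by linarith
    then have "ennreal Y \<le> ennreal (8 * D + 24 * exp (- real n * R))" by (rule ennreal_leI)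
    then show ?thesis using real(1) by (simp add: real(2) Y(1) ennreal_mult)
  next
    case top
    have "8 * (\<top> :: ennreal) = \<top>" by (simp add: ennreal_mult_eq_top_iff)
    then show ?thesis by (simp only: top top_add zero_le top_greatest)
  qed
qed

text \<open>The upper bound comes first in importance: it makes \<open>E\<close> finite, so that
  \<open>enn2real\<close> is faithful. The error term takes half of the lower bound, and division of
  the other half by 8 gives \<open>c / 16\<close>.\<close>

lemma bigtheta_enn2real:
  fixes E Y :: "nat \<Rightarrow> ennreal" and b \<epsilon> :: "nat \<Rightarrow> real"
  assumes upper: "\<forall>\<^sub>F n in sequentially. E n \<le> ennreal (C * b n)"
    and lower: "\<forall>\<^sub>F n in sequentially. ennreal (c * b n) \<le> Y n"
    and Y: "\<forall>\<^sub>F n in sequentially. Y n \<le> 8 * E n + ennreal (\<epsilon> n)"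
    and \<epsilon>: "\<forall>\<^sub>F n in sequentially. \<epsilon> n \<le> c / 2 * b n" "\<And>n. 0 \<le> \<epsilon> n"
    and c: "0 < c" "0 < C" and b: "\<forall>\<^sub>F n in sequentially. 0 < b n"
  shows "(\<forall>\<^sub>F n in sequentially. E n < \<infinity>) \<and> (\<lambda>n. enn2real (E n)) \<in> \<Theta>(b)"
proof (intro conjI bigthetaI)
  show "\<forall>\<^sub>F n in sequentially. E n < \<infinity>"
    using upper by eventually_elim (erule le_less_trans, simp)
  show "(\<lambda>n. enn2real (E n)) \<in> O(b)"
  proof (rule bigoI[where c = C])
    show "\<forall>\<^sub>F n in sequentially. norm (enn2real (E n)) \<le> C * norm (b n)"
      using upper b
    proof eventually_elim
      case (elim n)
      then have "enn2real (E n) \<le> C * b n"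
        using c by (intro enn2real_leI) auto
      then show ?case using elim by simp
    qed
  qed
  show "(\<lambda>n. enn2real (E n)) \<in> \<Omega>(b)"
  proof (rule landau_omega.bigI[where c = "c / 16"])
    show "\<forall>\<^sub>F n in sequentially. c / 16 * norm (b n) \<le> norm (enn2real (E n))"
      using upper lower Y \<epsilon>(1) b
    proof eventually_elim
      case (elim n)
      then obtain D where D: "E n = ennreal D" "0 \<le> D" by (cases "E n") (auto simp: top_unique)
      have "ennreal (c * b n) \<le> 8 * ennreal D + ennreal (\<epsilon> n)" using elim D by (metis order_trans)
      also have "\<dots> = ennreal (8 * D + \<epsilon> n)" using D \<epsilon>(2) by (simp add: ennreal_mult)
      finally have "c * b n \<le> 8 * D + \<epsilon> n" using D \<epsilon>(2)[of n] by (subst (asm) ennreal_le_iff) auto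
      then show ?case using elim D by simp
    qed
  qed (use c in auto)
qed

theorem theorem2:
  fixes PX :: "'a measure" and MY :: "'b measure" and K :: "'a \<Rightarrow> 'b measure" and R \<tau>s :: real
  assumes tau: "\<tau>s = tau_star PX MY K R"
    and input: "prob_space PX"
    and channel: "K \<in> PX \<rightarrow>\<^sub>M prob_algebra MY"
    and abs_cont: "absolutely_continuous (product_law PX MY K) (joint_law PX MY K)"
    and version: "regular_version PX MY K"
    and rate: "R > mutual_info PX MY K"
    and info_pos: "mutual_info PX MY K > 0"
    and mgf_origin: "\<exists>\<epsilon>>0. \<forall>\<tau>. \<bar>\<tau>\<bar> < \<epsilon> \<longrightarrow> info_mgf PX MY K \<tau> < \<infinity>"
    and mgf_beyond: "\<tau>s < 1 \<longrightarrow> (\<exists>\<tau>>\<tau>s. info_mgf PX MY K \<tau> < \<infinity>)"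
  shows "(\<forall>\<^sub>F n in sequentially. expected_divergence PX MY K R n < \<infinity>) \<and>
    (\<tau>s < 1 \<longrightarrow>
       (\<lambda>n. enn2real (expected_divergence PX MY K R n)) \<in>
         \<Theta>(\<lambda>n. exp (- real n * \<tau>s * R) / sqrt (real n) *
               enn2real (info_mgf PX MY K \<tau>s) ^ n)) \<and>
    (\<tau>s = 1 \<longrightarrow>
       (\<lambda>n. enn2real (expected_divergence PX MY K R n)) \<in>
         \<Theta>(\<lambda>n. exp (- real n * R) * enn2real (info_mgf PX MY K 1) ^ n))"
proof -
  let ?i = "info_density PX MY K" and ?J = "joint_law PX MY K" and ?I = "mutual_info PX MY K"
  interpret W: iid_walk ?J "\<lambda>z. ?i z - R" by (rule iid_walk_info_density[OF input channel])
  have R: "0 < R" using rate info_pos by linarith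
  have mgf: "W.mgf \<tau> = ennreal (exp (- \<tau> * R)) * info_mgf PX MY K \<tau>" for \<tau>
    by (rule mgf_info_density[OF input channel])
  have mgf_fin: "W.mgf \<tau> < \<infinity> \<longleftrightarrow> info_mgf PX MY K \<tau> < \<infinity>" for \<tau>
    by (auto simp: mgf less_top[symmetric] ennreal_mult_eq_top_iff)
  have \<tau>s: "0 \<le> \<tau>s" "\<tau>s \<le> 1" and min: "\<And>\<tau>. \<tau> \<in> {0..1} \<Longrightarrow> W.mgf \<tau>s \<le> W.mgf \<tau>"
    using tau_star_minimizes[OF input channel, where R = R] unfolding tau by auto
  obtain \<epsilon> where \<epsilon>: "0 < \<epsilon>" "\<And>\<tau>. \<bar>\<tau>\<bar> < \<epsilon> \<Longrightarrow> W.mgf \<tau> < \<infinity>"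
    using mgf_origin unfolding mgf_fin by blast
  have expi: "integrable ?J (\<lambda>z. exp (h * (?i z - R)))" if "\<bar>h\<bar> < \<epsilon>" for h
    using \<epsilon>(2)[OF that] by (simp add: W.integrable_exp_iff_mgf)
  obtain k where k: "0 \<le> k" and Z2: "integrable ?J (\<lambda>z. (?i z - R)\<^sup>2)"
    and le: "\<And>h. \<bar>h\<bar> \<le> \<epsilon> / 2 / 2 \<Longrightarrow> (\<integral>z. exp (h * (?i z - R)) \<partial>?J) \<le>
        1 + h * (\<integral>z. ?i z - R \<partial>?J) + h\<^sup>2 * k"
    using W.exp_moment_le_quadratic[of "\<epsilon> / 2"] \<epsilon>(1) expi[of "\<epsilon> / 2"] expi[of "- (\<epsilon> / 2)"] by auto
  have iZ: "integrable ?J (\<lambda>z. ?i z - R)"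
    by (rule W.square_integrable_imp_integrable[OF W.Z Z2])
  have ii: "integrable ?J ?i"
    using Bochner_Integration.integrable_add[OF iZ W.integrable_const[of R]] by simp
  have EZ: "(\<integral>z. ?i z - R \<partial>?J) = ?I - R"
    using ii by (simp add: mutual_info_def W.prob_space)
  \<comment> \<open>The mean step is \<open>I - R\<close>, which is negative.\<close>
  have nz: "\<not> (AE z in ?J. ?i z - R = 0)"
  proof
    assume "AE z in ?J. ?i z - R = 0"
    then have "(\<integral>z. ?i z - R \<partial>?J) = 0" by (rule integral_eq_zero_AE)
    then show False using EZ rate by simp
  qed
  \<comment> \<open>The function \<open>W.mgf\<close> starts at 1 with negative slope
    \<open>I - R\<close>, so it falls below 1 at a small \<open>h\<close> and 0 is no
    minimiser.\<close>
  have "0 < \<tau>s"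
  proof -
    define m where "m = R - ?I"
    have m: "0 < m" using rate by (simp add: m_def)
    define h where "h = Min {1, \<epsilon> / 4, m / (2 * (k + 1))}"
    have "0 < h" unfolding h_def using \<epsilon>(1) m k by auto
    moreover have "h \<le> x" if "x \<in> {1, \<epsilon> / 4, m / (2 * (k + 1))}" for x
      unfolding h_def using that by (intro Min_le) auto
    ultimately have h: "0 < h" "h \<le> 1" "h \<le> \<epsilon> / 4" "h \<le> m / (2 * (k + 1))" by blast+
    have "h * k \<le> m / (2 * (k + 1)) * k" using h k by (intro mult_right_mono) auto
    also have "\<dots> < m" using m k by (simp add: field_simps add_nonneg_pos)
    finally have "h * (h * k) < h * m" using h by simp
    moreover have "(\<integral>z. exp (h * (?i z - R)) \<partial>?J) \<le> 1 + h * (- m) + h\<^sup>2 * k"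
      using le[of h] h EZ by (simp add: m_def)
    ultimately have "(\<integral>z. exp (h * (?i z - R)) \<partial>?J) < 1" by (simp add: power2_eq_square)
    moreover have "W.mgf h = ennreal (\<integral>z. exp (h * (?i z - R)) \<partial>?J)"
      using h \<epsilon> by (intro W.mgf_eq_integral \<epsilon>(2)) auto
    ultimately have "W.mgf h < W.mgf 0"
      unfolding W.mgf_0 by (metis ennreal_1 ennreal_lessI zero_less_one)
    moreover have "W.mgf \<tau>s \<le> W.mgf h" using h by (intro min) auto
    ultimately show ?thesis using \<tau>s(1) by (cases "\<tau>s = 0") auto
  qed
  have fin_s: "W.mgf \<tau>s < \<infinity>" using min[of 0] W.mgf_0 by (simp add: le_less_trans)
  define G where "G = enn2real (W.mgf \<tau>s)"
  have G: "W.mgf \<tau>s = ennreal G" "0 < G"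
    using fin_s W.mgf_pos[of \<tau>s] by (auto simp: G_def enn2real_positive_iff)
  define m where "m = enn2real (info_mgf PX MY K \<tau>s)"
  have m: "info_mgf PX MY K \<tau>s = ennreal m" using fin_s unfolding mgf_fin by (simp add: m_def)
  have m0: "0 \<le> m" by (simp add: m_def)
  have Gm: "G = exp (- \<tau>s * R) * m" using G m m0 by (simp add: mgf flip: ennreal_mult)
  \<comment> \<open>By \<open>exp x \<ge> 1 + x\<close>, the moment at \<tau>s is at least 1 plus
    \<tau>s times the mutual information; both factors are positive.\<close>
  have m1: "1 < m"
  proof -
    have eq: "exp (\<tau>s * (?i z - R)) * exp (\<tau>s * R) = exp (\<tau>s * ?i z)" for z
      by (simp add: algebra_simps flip: exp_add)
    have ie: "integrable ?J (\<lambda>z. exp (\<tau>s * ?i z))"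
      using integrable_mult_left[of "exp (\<tau>s * R)" ?J "\<lambda>z. exp (\<tau>s * (?i z - R))"] fin_s
      unfolding eq by (simp add: W.integrable_exp_iff_mgf)
    have "1 + \<tau>s * ?I = (\<integral>z. 1 + \<tau>s * ?i z \<partial>?J)" using ii by (simp add: mutual_info_def W.prob_space)
    also have "\<dots> \<le> (\<integral>z. exp (\<tau>s * ?i z) \<partial>?J)"
      using ii by (intro integral_mono ie) (auto simp: exp_ge_add_one_self)
    also have "\<dots> = m"
      using nn_integral_eq_integral[OF ie] m m0 by (simp add: info_mgf_def)
    finally show ?thesis using \<open>0 < \<tau>s\<close> info_pos by (smt (verit) mult_pos_pos)
  qed
  \<comment> \<open>Geometric ratio of the error \<open>exp (- n R)\<close> to \<open>G ^ n\<close>.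
    It is below 1 because \<open>G\<close> exceeds \<open>exp (- \<tau>s * R)\<close> by the factor
    \<open>m > 1\<close>.\<close>
  define q where "q = exp (- R) / G"
  have q: "0 < q" "q < 1"
  proof -
    have "exp (- R) \<le> exp (- \<tau>s * R)" using \<tau>s R by simp
    also have "\<dots> < exp (- \<tau>s * R) * m" using m1 by simp
    finally show "q < 1" using G(2) by (simp add: q_def Gm)
  qed (use G in \<open>simp add: q_def\<close>)
  have qn: "exp (- real n * R) = q ^ n * G ^ n" for n
    using G(2) by (simp add: q_def power_divide flip: exp_of_nat_mult)
  have GI: "(\<integral>\<^sup>+z. ennreal (exp (\<tau>s * (?i z - R))) \<partial>?J) = ennreal G"
    using G(1) by (simp add: W.mgf_def)
  note walk_bounds = expected_divergence_walk_bounds[OF input channel abs_cont version R]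
  define E where "E n = expected_divergence PX MY K R n" for n
  define Y where "Y n = (\<integral>\<^sup>+z. ennreal (min 1 (exp (W.walk n z))) \<partial>W.law n)" for n
  have YE: "\<forall>\<^sub>F n in sequentially. Y n \<le> 8 * E n + ennreal (24 * exp (- real n * R))"
    using eventually_gt_at_top[of 0] by eventually_elim (use walk_bounds(2) in \<open>simp add: Y_def E_def\<close>)
  show ?thesis
  proof (cases "\<tau>s < 1")
    case True
    obtain \<tau>' where \<tau>': "\<tau>s < \<tau>'" "W.mgf \<tau>' < \<infinity>"
      using mgf_beyond True unfolding mgf_fin by blast
    \<comment> \<open>The first two bounds keep \<open>\<tau>s + u\<close> in [0, 1], where \<tau>s
      is minimal; the third keeps it below \<tau>', where the moment generating function is still
      finite.\<close>
    define e where "e = Min {\<tau>s, 1 - \<tau>s, \<tau>' - \<tau>s}"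
    have "0 < e" unfolding e_def using \<open>0 < \<tau>s\<close> True \<tau>' by auto
    moreover have "e \<le> x" if "x \<in> {\<tau>s, 1 - \<tau>s, \<tau>' - \<tau>s}" for x
      unfolding e_def using that by (intro Min_le) auto
    ultimately have e: "0 < e" "e \<le> \<tau>s" "e \<le> 1 - \<tau>s" "e \<le> \<tau>' - \<tau>s" by blast+
    have u_range: "0 \<le> \<tau>s + u" "\<tau>s + u \<le> \<tau>'" "\<tau>s + u \<le> 1" if "\<bar>u\<bar> \<le> e" for u
      using that e by linarith+
    have fin_u: "(\<integral>\<^sup>+z. ennreal (exp ((\<tau>s + u) * (?i z - R))) \<partial>?J) < \<infinity>" if "\<bar>u\<bar> \<le> e" for u
      using W.mgf_finite_between[OF \<tau>'(2), of "\<tau>s + u"] u_range[OF that] by (simp add: W.mgf_def)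
    have min_u: "ennreal G \<le> (\<integral>\<^sup>+z. ennreal (exp ((\<tau>s + u) * (?i z - R))) \<partial>?J)" if "\<bar>u\<bar> \<le> e" for u
      using min[of "\<tau>s + u", unfolded G(1)] u_range[OF that] by (simp add: W.mgf_def)
    obtain c C where c: "0 < c" and C: "0 < C"
      and up: "\<And>n. 0 < n \<Longrightarrow> (\<integral>\<^sup>+z. ennreal (ln (1 + exp (W.walk n z))) \<partial>W.law n) \<le>
          ennreal (C * (G ^ n / sqrt (real n)))"
      and low: "\<forall>\<^sub>F n in sequentially. ennreal (c * (G ^ n / sqrt (real n))) \<le> Y n"
    proof (rule W.interior_asymptotics[OF \<open>0 < \<tau>s\<close> True G(2) GI e(1) fin_u min_u nz], fold Y_def)
      fix c C :: real
      assume "0 < c" "0 < C" and up: "\<And>n. 0 < n \<Longrightarrow>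
          (\<integral>\<^sup>+z. ennreal (ln (1 + exp (W.walk n z))) \<partial>W.law n) \<le> ennreal (C * (G ^ n / sqrt (real n)))"
        and "\<forall>\<^sub>F n in sequentially. ennreal (c * (G ^ n / sqrt (real n))) \<le> Y n"
      then show thesis by (intro that[of c C] up) auto
    qed
    have E_up: "\<forall>\<^sub>F n in sequentially. E n \<le> ennreal (C * (G ^ n / sqrt (real n)))"
      using eventually_gt_at_top[of 0]
      by eventually_elim (use order_trans[OF walk_bounds(1) up] in \<open>simp add: E_def\<close>)
    have small: "\<forall>\<^sub>F n in sequentially. 24 * exp (- real n * R) \<le> c / 2 * (G ^ n / sqrt (real n))"
    proof -
      \<comment> \<open>Geometric decay beats the factor \<open>sqrt n\<close>; the threshold
        \<open>c / 48\<close> is \<open>c / 2\<close> divided by 24.\<close>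
      have "(\<lambda>n. sqrt (real n) * q ^ n) \<longlonglongrightarrow> 0" using q by real_asymp
      then have "\<forall>\<^sub>F n in sequentially. sqrt (real n) * q ^ n < c / 48"
        using c by (intro order_tendstoD) auto
      then show ?thesis using eventually_gt_at_top[of 0]
      proof eventually_elim
        case (elim n)
        then have "q ^ n \<le> c / 48 / sqrt (real n)" by (simp add: field_simps)
        then have "q ^ n * G ^ n \<le> c / 48 / sqrt (real n) * G ^ n"
          using G(2) by (intro mult_right_mono) auto
        then show ?case unfolding qn by simp
      qed
    qed
    have bpos: "\<forall>\<^sub>F n in sequentially. 0 < G ^ n / sqrt (real n)"
      using eventually_gt_at_top[of 0] by eventually_elim (use G(2) in simp)
    have "(\<forall>\<^sub>F n in sequentially. E n < \<infinity>) \<and> (\<lambda>n. enn2real (E n)) \<in> \<Theta>(\<lambda>n. G ^ n / sqrt (real n))"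
      by (rule bigtheta_enn2real[OF E_up low YE small _ c C bpos]) simp
    moreover have "(\<lambda>n. G ^ n / sqrt (real n)) =
        (\<lambda>n. exp (- real n * \<tau>s * R) / sqrt (real n) * enn2real (info_mgf PX MY K \<tau>s) ^ n)"
      by (simp add: Gm m_def power_mult_distrib exp_of_nat_mult[symmetric] mult.assoc)
    ultimately show ?thesis using True by (simp add: E_def)
  next
    case False
    then have s1: "\<tau>s = 1" using \<tau>s by simp
    have GI1: "(\<integral>\<^sup>+z. ennreal (exp (?i z - R)) \<partial>?J) = ennreal G" using GI s1 by simp
    have fin_u: "(\<integral>\<^sup>+z. ennreal (exp (u * (?i z - R))) \<partial>?J) < \<infinity>" if "0 \<le> u" "u \<le> 1" for u
      using W.mgf_finite_between[OF fin_s, of u] that s1 by (simp add: W.mgf_def)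
    have min_u: "ennreal G \<le> (\<integral>\<^sup>+z. ennreal (exp (u * (?i z - R))) \<partial>?J)" if "0 \<le> u" "u \<le> 1" for u
      using min[of u, unfolded G(1)] that by (simp add: W.mgf_def)
    obtain c where c: "0 < c"
      and up: "\<And>n. (\<integral>\<^sup>+z. ennreal (ln (1 + exp (W.walk n z))) \<partial>W.law n) \<le> ennreal (G ^ n)"
      and low: "\<forall>\<^sub>F n in sequentially. ennreal (c * G ^ n) \<le> Y n"
    proof (rule W.boundary_asymptotics[OF G(2) GI1 fin_u min_u nz], fold Y_def)
      fix c :: real
      assume "0 < c" and up: "\<And>n. (\<integral>\<^sup>+z. ennreal (ln (1 + exp (W.walk n z))) \<partial>W.law n) \<le> ennreal (G ^ n)"
        and "\<forall>\<^sub>F n in sequentially. ennreal (c * G ^ n) \<le> Y n"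
      then show thesis by (intro that[of c] up) auto
    qed
    have E_up: "\<forall>\<^sub>F n in sequentially. E n \<le> ennreal (1 * G ^ n)"
      using eventually_gt_at_top[of 0]
      by eventually_elim (use order_trans[OF walk_bounds(1) up] in \<open>simp add: E_def\<close>)
    have small: "\<forall>\<^sub>F n in sequentially. 24 * exp (- real n * R) \<le> c / 2 * G ^ n"
    proof -
      have "(\<lambda>n. q ^ n) \<longlonglongrightarrow> 0" using q by (intro LIMSEQ_realpow_zero) auto
      then have "\<forall>\<^sub>F n in sequentially. q ^ n < c / 48"
        using c by (intro order_tendstoD) auto
      then show ?thesis
      proof eventually_elim
        case (elim n)
        then have "q ^ n * G ^ n \<le> c / 48 * G ^ n"
          using G(2) by (intro mult_right_mono) auto
        then show ?case unfolding qn by simp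
      qed
    qed
    have "(\<forall>\<^sub>F n in sequentially. E n < \<infinity>) \<and> (\<lambda>n. enn2real (E n)) \<in> \<Theta>(\<lambda>n. G ^ n)"
      by (rule bigtheta_enn2real[OF E_up low YE small _ c]) (use G(2) in auto)
    moreover have "(\<lambda>n. G ^ n) = (\<lambda>n. exp (- real n * R) * enn2real (info_mgf PX MY K 1) ^ n)"
      using s1 by (simp add: Gm m_def power_mult_distrib exp_of_nat_mult[symmetric])
    ultimately show ?thesis using s1 by (simp add: E_def)
  qed
qed

end
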